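(* Let $N\ge 3$ and let $d\mu=\mu(x)\,dx$ be a measure on $\mathbb{R}^N$ with density $\mu$. Write $c_0(s):=\left(\frac{s-2}{2}\right)^2$ for $s\in\mathbb{R}$, and $U_\mu:=\frac14\left|\frac{\nabla\mu}{\mu}\right|^2-\frac12\frac{\Delta\mu}{\mu}$. Assume: (1) $\mu\ge 0$, $\mu^{1/2}\in H^1_{loc}(\mathbb{R}^N)$, $\Delta\mu\in L^1_{loc}(\mathbb{R}^N)$; (2) the constant $c_{0,\mu}:=\liminf_{x\to 0}\left(c_0(N)-|x|^2U_\mu(x)\right)$ is finite; (3) for every $R>0$ the function $U:=U_\mu-\frac{1}{|x|^2}\limsup_{x\to0}|x|^2U_\mu$ is bounded from above in $\mathbb{R}^N\setminus B_R$; (4) $\mu\in L^1_{loc}(\mathbb{R}^N)$ and $N_0:=\sup\{\delta\in\mathbb{R}: |x|^{-\delta}\in L^1_{loc}(\mathbb{R}^N,d\mu)\}$ exists (as a real number); (5) $\limsup_{\lambda\to0^+}\lambda\int_{B_1}|x|^{\lambda-N_0}\,d\mu=+\infty$; (6) $N_0>2$ and $c_{0,\mu}=c_0(N_0)$. Then, for $c\in\mathbb{R}$, the following are equivalent: (a) there exists a constant $C$ such that $$c\int_{\mathbb{R}^N}\frac{\varphi^2}{|x|^2}\,d\mu\le\int_{\mathbb{R}^N}|\nabla\varphi|^2\,d\mu+C\int_{\mathbb{R}^N}\varphi^2\,d\mu\qquad\text{for all }\varphi\in H^1_\mu;$$ (b) $c< c_0(N_0)$.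
   Context: $B_R$ denotes the open ball of $\mathbb{R}^N$ of radius $R$ centered at $0$. $L^2_\mu:=L^2(\mathbb{R}^N,d\mu)$, and $H^1_\mu$ is the Sobolev space of functions in $L^2_\mu$ whose weak first derivatives belong to $L^2_\mu$; $C_c^\infty(\mathbb{R}^N)$ is dense in $H^1_\mu$ when $\mu^{1/2}\in H^1_{loc}(\mathbb{R}^N)$ (known fact). Functions $\varphi$ are real-valued. *)

theory Defs
  imports "HOL-Analysis.Analysis"
begin

definition locally_integrable ::
    "('a::euclidean_space) measure \<Rightarrow> ('a \<Rightarrow> 'b::euclidean_space) \<Rightarrow> bool" where
  "locally_integrable M f \<longleftrightarrow> (\<forall>K. compact K \<longrightarrow> set_integrable M K f)"

definition square_integrable :: "'a measure \<Rightarrow> ('a \<Rightarrow> 'b::euclidean_space) \<Rightarrow> bool" where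
  "square_integrable M f \<longleftrightarrow> f \<in> borel_measurable M \<and> integrable M (\<lambda>x. (norm (f x))\<^sup>2)"

definition locally_square_integrable ::
    "('a::euclidean_space) measure \<Rightarrow> ('a \<Rightarrow> 'b::euclidean_space) \<Rightarrow> bool" where
  "locally_square_integrable M f \<longleftrightarrow>
     f \<in> borel_measurable M \<and> locally_integrable M (\<lambda>x. (norm (f x))\<^sup>2)"

text \<open>Classical partial derivative in direction \<open>i\<close> (used only for differentiable functions).\<close>

definition partial_deriv :: "('a::euclidean_space \<Rightarrow> real) \<Rightarrow> 'a \<Rightarrow> 'a \<Rightarrow> real" where
  "partial_deriv f i = (\<lambda>x. frechet_derivative f (at x) i)"

primrec C_k :: "nat \<Rightarrow> ('a::euclidean_space \<Rightarrow> real) \<Rightarrow> bool" where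
  "C_k 0 f \<longleftrightarrow> continuous_on UNIV f"
| "C_k (Suc k) f \<longleftrightarrow>
     (\<forall>x. f differentiable (at x)) \<and> (\<forall>i\<in>Basis. C_k k (partial_deriv f i))"

definition test_function :: "('a::euclidean_space \<Rightarrow> real) \<Rightarrow> bool" where
  "test_function \<eta> \<longleftrightarrow> (\<forall>k. C_k k \<eta>) \<and> compact (closure {x. \<eta> x \<noteq> 0})"

definition has_weak_gradient ::
    "('a::euclidean_space \<Rightarrow> real) \<Rightarrow> ('a \<Rightarrow> 'a) \<Rightarrow> bool" where
  "has_weak_gradient u g \<longleftrightarrow>
     locally_integrable lebesgue u \<and> locally_integrable lebesgue g \<and>
     (\<forall>\<eta>. test_function \<eta> \<longrightarrow> (\<forall>i\<in>Basis.
        (LINT x|lebesgue. u x * partial_deriv \<eta> i x) = - (LINT x|lebesgue. (g x \<bullet> i) * \<eta> x)))"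

definition has_weak_laplacian ::
    "('a::euclidean_space \<Rightarrow> real) \<Rightarrow> ('a \<Rightarrow> real) \<Rightarrow> bool" where
  "has_weak_laplacian u l \<longleftrightarrow>
     locally_integrable lebesgue u \<and> locally_integrable lebesgue l \<and>
     (\<forall>\<eta>. test_function \<eta> \<longrightarrow>
        (LINT x|lebesgue. u x * (\<Sum>i\<in>Basis. partial_deriv (partial_deriv \<eta> i) i x)) =
        (LINT x|lebesgue. l x * \<eta> x))"

text \<open>
  The weak gradient and Laplacian are unique only up to Lebesgue null sets; the following two
  operators pick arbitrary representatives, and below they occur only under integrals and in
  almost-everywhere statements.
\<close>

definition weak_gradient :: "('a::euclidean_space \<Rightarrow> real) \<Rightarrow> 'a \<Rightarrow> 'a" where
  "weak_gradient u = (SOME g. has_weak_gradient u g)"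

definition weak_laplacian :: "('a::euclidean_space \<Rightarrow> real) \<Rightarrow> 'a \<Rightarrow> real" where
  "weak_laplacian u = (SOME l. has_weak_laplacian u l)"

definition H1_loc :: "('a::euclidean_space \<Rightarrow> real) set" where
  "H1_loc = {u. (\<exists>g. has_weak_gradient u g) \<and>
     locally_square_integrable lebesgue u \<and>
     locally_square_integrable lebesgue (weak_gradient u)}"

definition weighted_measure :: "('a::euclidean_space \<Rightarrow> real) \<Rightarrow> 'a measure" where
  "weighted_measure \<mu> = density lebesgue (\<lambda>x. ennreal (\<mu> x))"

definition H1_weighted :: "('a::euclidean_space \<Rightarrow> real) \<Rightarrow> ('a \<Rightarrow> real) set" where
  "H1_weighted \<mu> = {\<phi>. (\<exists>g. has_weak_gradient \<phi> g) \<and>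
     square_integrable (weighted_measure \<mu>) \<phi> \<and>
     square_integrable (weighted_measure \<mu>) (weak_gradient \<phi>)}"

definition c0 :: "real \<Rightarrow> real" where
  "c0 s = ((s - 2) / 2)\<^sup>2"

text \<open>
  \<open>U_pot \<mu>\<close> is the function $U_\mu$. It is meaningful only where \<open>\<mu> > 0\<close>, i.e. almost everywhere
  with respect to \<open>\<mu> dx\<close>. Accordingly, \<open>essential_at_zero \<mu>\<close> restricts the limit \<open>x \<rightarrow> 0\<close> to sets
  of full \<open>\<mu> dx\<close>-measure, so that \<open>Liminf\<close> and \<open>Limsup\<close> along it are the essential lower and upper
  limits, which do not depend on representatives or on the convention for division by zero.
\<close>

definition U_pot :: "('a::euclidean_space \<Rightarrow> real) \<Rightarrow> 'a \<Rightarrow> real" where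
  "U_pot \<mu> x = 1/4 * (norm (weak_gradient \<mu> x /\<^sub>R \<mu> x))\<^sup>2 - 1/2 * (weak_laplacian \<mu> x / \<mu> x)"

definition essential_at_zero :: "('a::euclidean_space \<Rightarrow> real) \<Rightarrow> 'a filter" where
  "essential_at_zero \<mu> = inf (at 0) (ae_filter (weighted_measure \<mu>))"

definition c0_weighted :: "('a::euclidean_space \<Rightarrow> real) \<Rightarrow> ereal" where
  "c0_weighted \<mu> = Liminf (essential_at_zero \<mu>)
     (\<lambda>x. ereal (c0 (real DIM('a)) - (norm x)\<^sup>2 * U_pot \<mu> x))"

definition limsup_U_pot :: "('a::euclidean_space \<Rightarrow> real) \<Rightarrow> ereal" where
  "limsup_U_pot \<mu> = Limsup (essential_at_zero \<mu>) (\<lambda>x. ereal ((norm x)\<^sup>2 * U_pot \<mu> x))"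

text \<open>
  The function $U$. When \<open>c0_weighted \<mu>\<close> is finite, so is \<open>limsup_U_pot \<mu>\<close>, and \<open>real_of_ereal\<close>
  is then a mere change of type.
\<close>

definition U_reduced :: "('a::euclidean_space \<Rightarrow> real) \<Rightarrow> 'a \<Rightarrow> real" where
  "U_reduced \<mu> x = U_pot \<mu> x - 1 / (norm x)\<^sup>2 * real_of_ereal (limsup_U_pot \<mu>)"

definition N0_set :: "('a::euclidean_space \<Rightarrow> real) \<Rightarrow> real set" where
  "N0_set \<mu> = {\<delta>. locally_integrable (weighted_measure \<mu>) (\<lambda>x. norm x powr (- \<delta>))}"

definition N0 :: "('a::euclidean_space \<Rightarrow> real) \<Rightarrow> real" where
  "N0 \<mu> = Sup (N0_set \<mu>)"

text \<open>
  The Hardy term may a priori be infinite, hence the extended reals. The right-hand side is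
  finite for \<open>\<phi> \<in> H1_weighted \<mu>\<close>.
\<close>

definition weighted_Hardy_inequality ::
    "('a::euclidean_space \<Rightarrow> real) \<Rightarrow> real \<Rightarrow> real \<Rightarrow> ('a \<Rightarrow> real) \<Rightarrow> bool" where
  "weighted_Hardy_inequality \<mu> c C \<phi> \<longleftrightarrow>
     ereal c * enn2ereal (\<integral>\<^sup>+ x. ennreal ((\<phi> x)\<^sup>2 / (norm x)\<^sup>2) \<partial>weighted_measure \<mu>)
     \<le> ereal ((LINT x|weighted_measure \<mu>. (norm (weak_gradient \<phi> x))\<^sup>2)
              + C * (LINT x|weighted_measure \<mu>. (\<phi> x)\<^sup>2))"

end

theory Submission
  imports Defs
begin

text \<open>
  Sufficiency. For a smooth positive weight \<open>M\<close> on \<open>\<real>\<^sup>N\<close>, put \<open>a = (N - 2) / 2\<close> and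
  \<open>X = x / (|x|\<^sup>2 + \<epsilon>)\<close>; expanding \<open>M |\<nabla>\<phi> + \<phi> (\<nabla>M / (2 M) + a X)|\<^sup>2 \<ge> 0\<close> and integrating by parts gives
  \<open>\<integral>M |\<nabla>\<phi>|\<^sup>2 \<ge> \<integral>\<phi>\<^sup>2 (a\<^sup>2 M / (|x|\<^sup>2 + \<epsilon>) + \<Delta>M / 2 - |\<nabla>M|\<^sup>2 / (4 M))\<close>, whose last two terms make up
  \<open>- M U\<^sub>M\<close>. No density of smooth functions in the weighted Sobolev space is used. Instead \<open>\<phi>\<close> stays
  rough and the weight \<open>\<mu> = \<rho>\<^sup>2\<close> is mollified: by convexity \<open>|\<nabla>M|\<^sup>2 / (4 M)\<close> is bounded by the
  mollification of \<open>|\<nabla>\<rho>|\<^sup>2\<close>, so every term converges in \<open>L\<^sup>1\<close> up to bounded factors, provided that the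
  field is multiplied by \<open>m / (m + M)\<close> and that \<open>\<phi>\<close> is bounded, has compact support and is multiplied by
  \<open>n \<mu> / (1 + n \<mu>)\<close>, which puts its gradient into \<open>L\<^sup>2\<close>. These truncations are then removed by dominated
  convergence; this uses that \<open>\<mu> / |x|\<^sup>2\<close> is locally integrable because \<open>N0 > 2\<close>. Near the origin the
  resulting potential is at least \<open>c' / |x|\<^sup>2\<close> for every \<open>c' < c0 N0\<close>, and elsewhere it is bounded below.

  Necessity. Test the inequality with \<open>|x|\<^sup>\<gamma>\<close> near the origin, \<open>\<gamma> = (t + 2 - N0) / 2\<close>. Since
  \<open>c0 N0 - \<gamma>\<^sup>2\<close> is of order \<open>t\<close>, an inequality with \<open>c \<ge> c0 N0\<close> would bound
  \<open>t \<integral> |x| powr (t - N0) d\<mu>\<close> over the unit ball as \<open>t \<rightarrow> 0\<close>.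
\<close>

subsection \<open>Continuously differentiable functions and vector fields\<close>

text \<open>\<open>\<Delta>\<mu>\<close> is only locally integrable and can be paired with bounded
  functions only; hence the truncation of \<open>\<phi>\<close>. Since \<open>\<mu>\<close> has no
  positive lower bound, a finite integral of \<open>\<mu> |\<nabla>\<phi>|^2\<close> does not make
  \<open>\<nabla>\<phi>\<close> square integrable near the zeros of \<open>\<mu>\<close>; the
  cut-off vanishing there repairs this at the cost of a term with the locally square integrable
  gradient of \<open>sqrt \<mu>\<close>. The mollified weight \<open>M\<close> has no common bound,
  while \<open>(m / (m + M)) M \<le> m\<close>; the gradient of this factor leaves an error
  controlled by \<open>M / (m + M)\<close>, which vanishes pointwise as \<open>m\<close> grows. So
  mollification is removed for fixed \<open>m\<close>, then \<open>m\<close>, and last the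
  truncation height and the support. The value of \<open>a\<close> maximises
  \<open>a (N - 2) - a^2\<close>, the coefficient of \<open>1 / |x|^2\<close> in
  \<open>a div X - a^2 |X|^2\<close> at \<open>\<epsilon> = 0\<close>. In the necessity part
  \<open>(2 - N0) / 2\<close> is the borderline exponent, whose square is \<open>c0 N0\<close>; the
  shift by \<open>t / 2\<close> gains \<open>c0 N0 - \<gamma>^2 \<ge> t (N0 - 2) / 4\<close> for
  small \<open>t\<close>.\<close>

definition has_cont_gradient :: "('a::euclidean_space \<Rightarrow> real) \<Rightarrow> ('a \<Rightarrow> 'a) \<Rightarrow> bool" where
  "has_cont_gradient f g \<longleftrightarrow>
     (\<forall>x. (f has_derivative (\<lambda>v. g x \<bullet> v)) (at x)) \<and> continuous_on UNIV g"

text \<open>The Jacobian stays existentially hidden because only its trace is ever identified: a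
  weak Laplacian determines the divergence of the mollified gradient, not the individual second
  derivatives.\<close>

definition has_cont_divergence :: "('a::euclidean_space \<Rightarrow> 'a) \<Rightarrow> ('a \<Rightarrow> real) \<Rightarrow> bool" where
  "has_cont_divergence Y d \<longleftrightarrow>
     (\<exists>J. (\<forall>i\<in>Basis. has_cont_gradient (\<lambda>x. Y x \<bullet> i) (J i)) \<and>
          (\<forall>x. d x = (\<Sum>i\<in>Basis. J i x \<bullet> i)))"

lemma has_cont_gradientD: "has_cont_gradient f g \<Longrightarrow> (f has_derivative (\<lambda>v. g x \<bullet> v)) (at x)"
  by (simp add: has_cont_gradient_def)

lemma has_cont_gradient_cont_grad: "has_cont_gradient f g \<Longrightarrow> continuous_on S g"
  using continuous_on_subset by (fastforce simp: has_cont_gradient_def)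

lemma has_cont_gradient_cont: "has_cont_gradient f g \<Longrightarrow> continuous_on S f"
  by (meson continuous_at_imp_continuous_on has_cont_gradientD has_derivative_continuous)

lemma has_cont_gradient_const: "has_cont_gradient (\<lambda>x. c) (\<lambda>x. 0)"
  by (simp add: has_cont_gradient_def)

lemma has_cont_gradient_add:
  "has_cont_gradient f f' \<Longrightarrow> has_cont_gradient g g' \<Longrightarrow>
     has_cont_gradient (\<lambda>x. f x + g x) (\<lambda>x. f' x + g' x)"
  unfolding has_cont_gradient_def
  by (auto intro!: continuous_intros derivative_eq_intros simp: inner_add_left)

lemma has_cont_gradient_mult:
  assumes "has_cont_gradient f f'" "has_cont_gradient g g'"
  shows "has_cont_gradient (\<lambda>x. f x * g x) (\<lambda>x. g x *\<^sub>R f' x + f x *\<^sub>R g' x)"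
  unfolding has_cont_gradient_def
proof (intro conjI allI)
  fix x
  show "((\<lambda>x. f x * g x) has_derivative (\<lambda>v. (g x *\<^sub>R f' x + f x *\<^sub>R g' x) \<bullet> v)) (at x)"
    by (rule has_derivative_eq_rhs[OF has_derivative_mult[OF has_cont_gradientD[OF assms(1)] has_cont_gradientD[OF assms(2)]]])
      (auto simp: inner_add_left algebra_simps)
  show "continuous_on UNIV (\<lambda>x. g x *\<^sub>R f' x + f x *\<^sub>R g' x)"
    using assms by (auto intro!: continuous_intros intro: has_cont_gradient_cont has_cont_gradient_cont_grad)
qed

lemma has_cont_gradient_compose:
  assumes "has_cont_gradient f f'" "\<And>x. (F has_real_derivative F' (f x)) (at (f x))"
    "continuous_on (range f) F'"
  shows "has_cont_gradient (\<lambda>x. F (f x)) (\<lambda>x. F' (f x) *\<^sub>R f' x)"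
  unfolding has_cont_gradient_def
proof (intro conjI allI)
  fix x
  have "(F has_derivative (\<lambda>y. F' (f x) * y)) (at (f x))"
    using assms(2) by (simp add: has_field_derivative_def)
  from has_derivative_compose[OF has_cont_gradientD[OF assms(1)] this]
  show "((\<lambda>x. F (f x)) has_derivative (\<lambda>v. (F' (f x) *\<^sub>R f' x) \<bullet> v)) (at x)"
    by simp
  have "continuous_on UNIV (\<lambda>x. F' (f x))"
    using continuous_on_compose2[OF assms(3) has_cont_gradient_cont[OF assms(1)]] by auto
  then show "continuous_on UNIV (\<lambda>x. F' (f x) *\<^sub>R f' x)"
    using assms(1) by (auto intro!: continuous_intros intro: has_cont_gradient_cont_grad)
qed

lemma has_cont_gradient_inner_self:
  "has_cont_gradient (\<lambda>x. x \<bullet> x) (\<lambda>x. 2 *\<^sub>R x)"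
  unfolding has_cont_gradient_def
  by (auto intro!: continuous_intros derivative_eq_intros simp: inner_commute)

lemma has_cont_gradient_inner_left: "has_cont_gradient (\<lambda>x. x \<bullet> i) (\<lambda>x. i)"
  unfolding has_cont_gradient_def
  by (auto intro!: continuous_intros derivative_eq_intros simp: inner_commute)

lemma has_cont_divergence_add:
  assumes "has_cont_divergence Y d" "has_cont_divergence W e"
  shows "has_cont_divergence (\<lambda>x. Y x + W x) (\<lambda>x. d x + e x)"
proof -
  obtain J where J: "\<And>i. i \<in> Basis \<Longrightarrow> has_cont_gradient (\<lambda>x. Y x \<bullet> i) (J i)"
    "\<And>x. d x = (\<Sum>i\<in>Basis. J i x \<bullet> i)"
    using assms(1) unfolding has_cont_divergence_def by auto
  obtain I where I: "\<And>i. i \<in> Basis \<Longrightarrow> has_cont_gradient (\<lambda>x. W x \<bullet> i) (I i)"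
    "\<And>x. e x = (\<Sum>i\<in>Basis. I i x \<bullet> i)"
    using assms(2) unfolding has_cont_divergence_def by auto
  show ?thesis
    unfolding has_cont_divergence_def
    by (rule exI[of _ "\<lambda>i x. J i x + I i x"])
      (auto simp: inner_add_left J(2) I(2) sum.distrib intro!: has_cont_gradient_add J I)
qed

lemma has_cont_divergence_scaleR:
  assumes "has_cont_gradient f f'" "has_cont_divergence Y d"
  shows "has_cont_divergence (\<lambda>x. f x *\<^sub>R Y x) (\<lambda>x. f' x \<bullet> Y x + f x * d x)"
proof -
  obtain J where J: "\<And>i. i \<in> Basis \<Longrightarrow> has_cont_gradient (\<lambda>x. Y x \<bullet> i) (J i)"
    "\<And>x. d x = (\<Sum>i\<in>Basis. J i x \<bullet> i)"
    using assms(2) unfolding has_cont_divergence_def by auto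
  show ?thesis
    unfolding has_cont_divergence_def
  proof (rule exI[of _ "\<lambda>i x. (Y x \<bullet> i) *\<^sub>R f' x + f x *\<^sub>R J i x"], intro conjI ballI allI)
    fix i :: 'a assume "i \<in> Basis"
    then show "has_cont_gradient (\<lambda>x. f x *\<^sub>R Y x \<bullet> i) (\<lambda>x. (Y x \<bullet> i) *\<^sub>R f' x + f x *\<^sub>R J i x)"
      using has_cont_gradient_mult[OF assms(1) J(1)] by simp
  next
    fix x
    show "f' x \<bullet> Y x + f x * d x =
      (\<Sum>i\<in>Basis. ((Y x \<bullet> i) *\<^sub>R f' x + f x *\<^sub>R J i x) \<bullet> i)"
      by (subst euclidean_inner)
        (simp add: J(2) inner_add_left sum.distrib sum_distrib_left mult.commute)
  qed
qed

lemma has_cont_divergence_cont: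
  assumes "has_cont_divergence Y d"
  shows "continuous_on S Y" "continuous_on S d"
proof -
  obtain J where J: "\<And>i. i \<in> Basis \<Longrightarrow> has_cont_gradient (\<lambda>x. Y x \<bullet> i) (J i)"
    "\<And>x. d x = (\<Sum>i\<in>Basis. J i x \<bullet> i)"
    using assms(1) unfolding has_cont_divergence_def by auto
  have "continuous_on S (\<lambda>x. \<Sum>i\<in>Basis. J i x \<bullet> i)"
    using J by (auto intro!: continuous_intros intro: has_cont_gradient_cont_grad)
  moreover have "d = (\<lambda>x. \<Sum>i\<in>Basis. J i x \<bullet> i)"
    using J by auto
  ultimately show "continuous_on S d" by simp
  have "continuous_on S (\<lambda>x. \<Sum>i\<in>Basis. (Y x \<bullet> i) *\<^sub>R i)"
    by (intro continuous_intros has_cont_gradient_cont[OF J(1)])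
  then show "continuous_on S Y"
    by (simp add: euclidean_representation)
qed

lemma has_cont_gradient_zero_outside:
  assumes "has_cont_gradient f g" "closed K" "\<And>x. x \<notin> K \<Longrightarrow> f x = 0" "x \<notin> K"
  shows "g x = 0"
proof -
  have "(f has_derivative (\<lambda>v. 0)) (at x)"
    by (rule has_derivative_transform_within_open[where f="\<lambda>x. 0" and s="-K"]) (use assms in auto)
  from has_derivative_unique[OF has_cont_gradientD[OF assms(1)] this]
  have "g x \<bullet> g x = 0" by meson
  then show ?thesis by simp
qed

lemma has_cont_divergence_zero_outside:
  assumes "has_cont_divergence Y d" "closed K" "\<And>x. x \<notin> K \<Longrightarrow> Y x = 0" "x \<notin> K"
  shows "d x = 0"
proof -
  obtain J where J: "\<And>i. i \<in> Basis \<Longrightarrow> has_cont_gradient (\<lambda>x. Y x \<bullet> i) (J i)"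
    "\<And>x. d x = (\<Sum>i\<in>Basis. J i x \<bullet> i)"
    using assms(1) unfolding has_cont_divergence_def by auto
  have "J i x = 0" if "i \<in> Basis" for i
    using has_cont_gradient_zero_outside[OF J(1)[OF that] assms(2)] assms(3,4) by auto
  then show ?thesis using J(2) by simp
qed

section \<open>Functions of compact support and the divergence theorem on the whole space\<close>

lemma continuous_borel_measurable_lebesgue:
  "continuous_on UNIV f \<Longrightarrow> f \<in> borel_measurable lebesgue" for f :: "'a::euclidean_space \<Rightarrow> 'b::euclidean_space"
  by (drule borel_measurable_continuous_onI) (auto intro: measurable_completion)

lemma continuous_compact_support_bounded:
  fixes f :: "'a::euclidean_space \<Rightarrow> 'b::euclidean_space"
  assumes "continuous_on UNIV f" "compact K" "\<And>x. x \<notin> K \<Longrightarrow> f x = 0"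
  obtains B where "B \<ge> 0" "\<And>x. norm (f x) \<le> B"
proof -
  have "compact (f ` K)"
    using assms by (meson compact_continuous_image continuous_on_subset top_greatest)
  then obtain B where B: "\<And>y. y \<in> f ` K \<Longrightarrow> norm y \<le> B"
    by (meson bounded_iff compact_imp_bounded)
  show ?thesis
    by (rule that[of "max B 0"]) (use B assms(3) in \<open>fastforce simp: le_max_iff_disj\<close>)+
qed

lemma integrable_bounded_compact_support:
  fixes f :: "'a::euclidean_space \<Rightarrow> 'b::euclidean_space"
  assumes "f \<in> borel_measurable lebesgue" "compact K" "\<And>x. x \<notin> K \<Longrightarrow> f x = 0"
    "\<And>x. norm (f x) \<le> B"
  shows "integrable lebesgue f"
proof (rule Bochner_Integration.integrable_bound)
  show "integrable lebesgue (\<lambda>x. B * indicator K x)"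
    using lmeasurable_compact[OF assms(2)] integrable_real_indicator[of K lebesgue] by (auto simp: fmeasurable_def)
  show "AE x in lebesgue. norm (f x) \<le> norm (B * indicator K x :: real)"
    using assms(3) order_trans[OF assms(4) abs_ge_self[of B]] by (intro AE_I2) (auto simp: indicator_def)
qed (use assms in auto)

lemma integrable_continuous_compact_support:
  fixes f :: "'a::euclidean_space \<Rightarrow> 'b::euclidean_space"
  assumes "continuous_on UNIV f" "compact K" "\<And>x. x \<notin> K \<Longrightarrow> f x = 0"
  shows "integrable lebesgue f"
proof -
  obtain B where "\<And>x. norm (f x) \<le> B"
    using continuous_compact_support_bounded[OF assms] by metis
  then show ?thesis
    using integrable_bounded_compact_support[OF continuous_borel_measurable_lebesgue] assms by blast
qed

lemma compact_UN_differences: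
  fixes S T :: "'a::euclidean_space set"
  assumes "compact S" "compact T"
  shows "compact (\<Union>x\<in>S. \<Union>y\<in>T. {x - y})"
  using compact_differences[OF assms]
  by (auto elim!: back_subst[of compact])

text \<open>By translation invariance of Lebesgue measure every difference quotient in direction
  \<open>i\<close> has integral zero; dominated convergence passes this on to the
  derivative.\<close>

lemma integral_gradient_eq_0:
  fixes f :: "'a::euclidean_space \<Rightarrow> real"
  assumes f: "has_cont_gradient f g" and K: "compact K" "\<And>x. x \<notin> K \<Longrightarrow> f x = 0"
    and i: "i \<in> Basis"
  shows "(LINT x|lebesgue. g x \<bullet> i) = 0"
proof -
  have g0: "g x = 0" if "x \<notin> K" for x
    using has_cont_gradient_zero_outside[OF f compact_imp_closed[OF K(1)] K(2) that] by auto
  obtain B where B: "B \<ge> 0" "\<And>x. norm (g x) \<le> B"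
    using continuous_compact_support_bounded[OF has_cont_gradient_cont_grad[OF f] K(1) g0] by metis
  \<comment> \<open>All steps have length \<open>1 / Suc n \<le> 1\<close>, so this enlargement of
    \<open>K\<close> carries every difference quotient and yields one majorant for all
    \<open>n\<close>.\<close>
  define K' where "K' = (\<Union>x\<in>K. \<Union>y\<in>cball 0 1. {x - y})"
  have K': "compact K'"
    unfolding K'_def by (rule compact_UN_differences[OF K(1)]) simp
  have fint: "integrable lebesgue f"
    using integrable_continuous_compact_support[OF has_cont_gradient_cont[OF f] K] by auto
  define D where "D = (\<lambda>n x. real (Suc n) * (f (x + (1 / real (Suc n)) *\<^sub>R i) - f x))"
  have shift: "integrable lebesgue (\<lambda>x. f (x + v)) \<and> (LINT x|lebesgue. f (x + v)) = integral\<^sup>L lebesgue f" for v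
  proof -
    have bm: "f \<in> borel_measurable borel"
      using borel_measurable_continuous_onI[OF has_cont_gradient_cont[OF f]] by auto
    have fl: "integrable lborel f"
      using fint bm by (simp add: integrable_completion)
    have "integrable lborel (\<lambda>x. f (v + x))"
      using fl integrable_distr_eq[of "\<lambda>x. v + x" lborel borel f] lborel_distr_plus[of v] bm
      by simp
    moreover have "(LINT x|lborel. f (v + x)) = integral\<^sup>L lborel f"
      using integral_distr[of "\<lambda>x. v + x" lborel borel f] lborel_distr_plus[of v] bm
      by simp
    moreover have "(\<lambda>x. f (v + x)) \<in> borel_measurable borel" using bm by measurable
    ultimately show ?thesis
      using bm unfolding add.commute[of _ v] by (simp add: integrable_completion integral_completion)
  qed
  have D0: "integral\<^sup>L lebesgue (D n) = 0" for n
    unfolding D_def using shift[of "(1 / real (Suc n)) *\<^sub>R i"] fint by (simp add: mult.commute)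
  have cD: "continuous_on UNIV (D n)" for n
    unfolding D_def
    by (intro continuous_intros continuous_on_compose2[OF has_cont_gradient_cont[OF f, of UNIV]]
        has_cont_gradient_cont[OF f]) auto
  have lim: "(\<lambda>n. integral\<^sup>L lebesgue (D n)) \<longlonglongrightarrow> (LINT x|lebesgue. g x \<bullet> i)"
  proof (rule integral_dominated_convergence[where w="\<lambda>x. B * indicator K' x"])
    show "(\<lambda>x. g x \<bullet> i) \<in> borel_measurable lebesgue"
      by (intro continuous_borel_measurable_lebesgue continuous_intros has_cont_gradient_cont_grad[OF f])
    show "D n \<in> borel_measurable lebesgue" for n
      by (intro continuous_borel_measurable_lebesgue cD)
    show "integrable lebesgue (\<lambda>x. B * indicator K' x)"
      using lmeasurable_compact[OF K'] integrable_real_indicator[of K' lebesgue] by (auto simp: fmeasurable_def)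
    show "AE x in lebesgue. (\<lambda>n. D n x) \<longlonglongrightarrow> g x \<bullet> i"
    proof (intro AE_I2)
      fix x
      have "((\<lambda>t. f (x + t *\<^sub>R i)) has_derivative (\<lambda>t. g x \<bullet> (t *\<^sub>R i))) (at 0)"
        by (rule has_derivative_compose[of "\<lambda>t. x + t *\<^sub>R i" _ _ _ f])
          (auto intro!: derivative_eq_intros has_cont_gradientD[OF f])
      then have "((\<lambda>t. f (x + t *\<^sub>R i)) has_real_derivative (g x \<bullet> i)) (at 0)"
        by (simp add: has_field_derivative_def mult_commute_abs)
      then have "((\<lambda>t. (f (x + t *\<^sub>R i) - f x) / t) \<longlongrightarrow> g x \<bullet> i) (at 0)"
        by (simp add: DERIV_def)
      moreover have "filterlim (\<lambda>n. 1 / real (Suc n)) (at 0) sequentially"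
        unfolding filterlim_at using lim_1_over_real_power[of 1] LIMSEQ_inverse_real_of_nat
        by (auto simp: inverse_eq_divide)
      ultimately show "(\<lambda>n. D n x) \<longlonglongrightarrow> g x \<bullet> i"
        by (auto dest: filterlim_compose simp: D_def mult.commute)
    qed
    show "AE x in lebesgue. norm (D n x) \<le> B * indicator K' x" for n
    proof (intro AE_I2)
      fix x
      let ?v = "(1 / real (Suc n)) *\<^sub>R i"
      have nv: "norm ?v = 1 / real (Suc n)" using i by simp
      show "norm (D n x) \<le> B * indicator K' x"
      proof (cases "x \<in> K'")
        case True
        have "norm (f (x + ?v) - f x) \<le> B * norm ((x + ?v) - x)"
        proof (rule differentiable_bound[where S=UNIV and f'="\<lambda>x v. g x \<bullet> v"])
          fix y
          show "(f has_derivative (\<lambda>v. g y \<bullet> v)) (at y within UNIV)"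
            using has_cont_gradientD[OF f] by auto
          show "onorm (\<lambda>v. g y \<bullet> v) \<le> B"
            by (rule onorm_bound) (use B in \<open>auto intro!: order_trans[OF Cauchy_Schwarz_ineq2] mult_right_mono\<close>)
        qed auto
        then have "real (Suc n) * norm (f (x + ?v) - f x) \<le> real (Suc n) * (B * (1 / real (Suc n)))"
          unfolding add_diff_cancel_left' nv by (intro mult_left_mono) auto
        then show ?thesis using True by (simp add: D_def abs_mult)
      next
        case False
        have "x \<notin> K"
        proof
          assume "x \<in> K"
          then have "x \<in> K'" unfolding K'_def by (force intro: bexI[of _ x] bexI[of _ 0])
          then show False using False by simp
        qed
        moreover have "x + ?v \<notin> K"
        proof
          assume "x + ?v \<in> K"
          then have "x \<in> K'" unfolding K'_def using nv by (force intro: bexI[of _ "x + ?v"] bexI[of _ ?v])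
          then show False using False by simp
        qed
        ultimately show ?thesis using False K(2) by (simp add: D_def)
      qed
    qed
  qed
  then show ?thesis unfolding D0 using LIMSEQ_unique[OF tendsto_const] by metis
qed

lemma integral_divergence_eq_0:
  fixes Y :: "'a::euclidean_space \<Rightarrow> 'a"
  assumes Y: "has_cont_divergence Y d" and K: "compact K" "\<And>x. x \<notin> K \<Longrightarrow> Y x = 0"
  shows "integral\<^sup>L lebesgue d = 0"
proof -
  obtain J where J: "\<And>i. i \<in> Basis \<Longrightarrow> has_cont_gradient (\<lambda>x. Y x \<bullet> i) (J i)"
    "\<And>x. d x = (\<Sum>i\<in>Basis. J i x \<bullet> i)"
    using assms(1) unfolding has_cont_divergence_def by auto
  have "integrable lebesgue (\<lambda>x. J i x \<bullet> i)" if i: "i \<in> Basis" for i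
    by (rule integrable_continuous_compact_support[OF _ K(1)])
      (use has_cont_gradient_zero_outside[OF J(1)[OF i] compact_imp_closed[OF K(1)]] K(2)
        in \<open>auto intro!: continuous_intros has_cont_gradient_cont_grad[OF J(1)[OF i]]\<close>)
  moreover have "(LINT x|lebesgue. J i x \<bullet> i) = 0" if i: "i \<in> Basis" for i
    using integral_gradient_eq_0[OF J(1)[OF i] K(1) _ i] K(2) by auto
  moreover have "d = (\<lambda>x. \<Sum>i\<in>Basis. J i x \<bullet> i)"
    using J by auto
  ultimately show ?thesis by (simp add: Bochner_Integration.integral_sum)
qed

subsection \<open>A smooth bump function\<close>

text \<open>The functions \<open>t \<mapsto> exp (- 1 / t) / t ^ j\<close>, extended by zero to \<open>t \<le> 0\<close>; the linear span of
  this family is closed under differentiation.\<close>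

definition flat_exp :: "nat \<Rightarrow> real \<Rightarrow> real" where
  "flat_exp j t = (if t > 0 then exp (- 1 / t) / t ^ j else 0)"

lemma flat_exp_tendsto_0: "((flat_exp j) \<longlongrightarrow> 0) (at 0)"
proof -
  have "((\<lambda>t::real. inverse t ^ j / exp (inverse t)) \<longlongrightarrow> 0) (at_right 0)"
    using filterlim_compose[OF tendsto_power_div_exp_0 filterlim_inverse_at_top_right] .
  then have "(flat_exp j \<longlongrightarrow> 0) (at_right 0)"
  proof (rule Lim_transform_eventually)
    show "\<forall>\<^sub>F t in at_right 0. inverse t ^ j / exp (inverse t) = flat_exp j t"
      unfolding eventually_at_filter
      by (rule always_eventually)
        (auto simp: flat_exp_def exp_minus inverse_eq_divide divide_simps)
  qed
  moreover have "(flat_exp j \<longlongrightarrow> 0) (at_left 0)"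
    by (rule Lim_transform_eventually[OF tendsto_const])
      (auto simp: eventually_at_filter flat_exp_def)
  ultimately show ?thesis
    by (simp add: filterlim_at_split)
qed

lemma flat_exp_deriv:
  "(flat_exp j has_real_derivative (flat_exp (j + 2) t - real j * flat_exp (Suc j) t)) (at t)"
proof -
  consider "t > 0" | "t < 0" | "t = 0" by linarith
  then show ?thesis
  proof cases
    case 1
    have "((\<lambda>t. exp (- 1 / t) / t ^ j) has_real_derivative
        (exp (- 1 / t) / t ^ (j + 2) - real j * (exp (- 1 / t) / t ^ Suc j))) (at t)"
    proof -
      have "((\<lambda>t. exp (- 1 / t) * inverse (t ^ j)) has_real_derivative
        (exp (- 1 / t) * (1 / t^2)) * inverse (t ^ j) + exp (- 1 / t) * (- (inverse (t ^ j) * (real j * t ^ (j - 1)) * inverse (t ^ j)))) (at t)"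
        using 1 by (auto intro!: derivative_eq_intros simp: power2_eq_square)
      moreover have "(exp (- 1 / t) * (1 / t^2)) * inverse (t ^ j) + exp (- 1 / t) * (- (inverse (t ^ j) * (real j * t ^ (j - 1)) * inverse (t ^ j))) = exp (- 1 / t) / t ^ (j + 2) - real j * (exp (- 1 / t) / t ^ Suc j)"
        using 1 by (cases j) (auto simp: field_simps power2_eq_square)
      ultimately show ?thesis by (simp add: divide_inverse)
    qed
    then have "(flat_exp j has_real_derivative
        (exp (- 1 / t) / t ^ (j + 2) - real j * (exp (- 1 / t) / t ^ Suc j))) (at t)"
      by (rule has_field_derivative_transform_within_open[of _ _ _ "{0<..}"]) (use 1 in \<open>auto simp: flat_exp_def\<close>)
    then show ?thesis using 1 by (simp add: flat_exp_def)
  next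
    case 2
    have "(flat_exp j has_real_derivative 0) (at t)"
      by (rule has_field_derivative_transform_within_open[of "\<lambda>t. 0" _ _ "{..<0}"]) (use 2 in \<open>auto simp: flat_exp_def\<close>)
    then show ?thesis using 2 by (simp add: flat_exp_def)
  next
    case 3
    \<comment> \<open>At the origin the difference quotient of a member of the family is the next
      member, whose limit is already known.\<close>
    have "((\<lambda>h. (flat_exp j (0 + h) - flat_exp j 0) / h) \<longlongrightarrow> 0) (at 0)"
    proof (rule Lim_transform_eventually[OF flat_exp_tendsto_0[of "Suc j"]])
      show "\<forall>\<^sub>F h in at 0. flat_exp (Suc j) h = (flat_exp j (0 + h) - flat_exp j 0) / h"
        by (rule always_eventually) (auto simp: flat_exp_def)
    qed
    then show ?thesis using 3 by (simp add: DERIV_def flat_exp_def)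
  qed
qed

lemma flat_exp_continuous: "continuous_on S (flat_exp j)"
  by (meson DERIV_isCont continuous_at_imp_continuous_on flat_exp_deriv)

section \<open>Calculus of the classes \<open>C_k\<close>\<close>

lemma partial_deriv_eq: "has_cont_gradient f g \<Longrightarrow> partial_deriv f i x = g x \<bullet> i"
  unfolding partial_deriv_def
  using frechet_derivative_at[OF has_cont_gradientD[of f g x]] by metis

lemma partial_deriv_eq': "has_cont_gradient f g \<Longrightarrow> partial_deriv f i = (\<lambda>x. g x \<bullet> i)"
  using partial_deriv_eq by blast

lemma has_cont_gradient_differentiable: "has_cont_gradient f g \<Longrightarrow> f differentiable (at x)"
  using has_cont_gradientD differentiable_def by blast

lemma C_k_continuous: "C_k k f \<Longrightarrow> continuous_on UNIV f"
  by (cases k) (auto simp: continuous_at_imp_continuous_on differentiable_imp_continuous_within)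

text \<open>\<open>C_k\<close> is phrased with partial derivatives, the integration lemmas with
  gradient vectors; linearity of the Frechet derivative assembles the second from the first.\<close>

lemma C_k_Suc_gradient:
  assumes "C_k (Suc k) f"
  shows "has_cont_gradient f (\<lambda>x. \<Sum>i\<in>Basis. partial_deriv f i x *\<^sub>R i)"
  unfolding has_cont_gradient_def
proof (intro conjI allI)
  fix x
  have "(f has_derivative (frechet_derivative f (at x))) (at x)"
    using assms by (simp add: frechet_derivative_works)
  moreover have "frechet_derivative f (at x) v = (\<Sum>i\<in>Basis. partial_deriv f i x *\<^sub>R i) \<bullet> v" for v
  proof -
    interpret linear "frechet_derivative f (at x)"
      using calculation has_derivative_linear by blast
    have "frechet_derivative f (at x) v = frechet_derivative f (at x) (\<Sum>i\<in>Basis. (v \<bullet> i) *\<^sub>R i)"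
      by (simp add: euclidean_representation)
    also have "\<dots> = (\<Sum>i\<in>Basis. (v \<bullet> i) *\<^sub>R partial_deriv f i x)"
      by (simp add: sum scale partial_deriv_def)
    finally show ?thesis by (simp add: inner_sum_left inner_commute[of v] mult.commute)
  qed
  ultimately show "(f has_derivative (\<bullet>) (\<Sum>i\<in>Basis. partial_deriv f i x *\<^sub>R i)) (at x)"
    by (metis (no_types, lifting) ext)
  show "continuous_on UNIV (\<lambda>x. \<Sum>i\<in>Basis. partial_deriv f i x *\<^sub>R i)"
    using assms by (auto intro!: continuous_intros C_k_continuous)
qed

lemma C_k_Suc_iff:
  assumes "has_cont_gradient f g"
  shows "C_k (Suc k) f \<longleftrightarrow> (\<forall>i\<in>Basis. C_k k (\<lambda>x. g x \<bullet> i))"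
  using assms by (simp add: partial_deriv_eq' has_cont_gradient_differentiable)

lemma C_k_Suc_D: "C_k (Suc k) f \<Longrightarrow> C_k k f"
  by (induction k arbitrary: f)
    (auto simp: continuous_at_imp_continuous_on differentiable_imp_continuous_within)

lemma C_k_add: "C_k k f \<Longrightarrow> C_k k g \<Longrightarrow> C_k k (\<lambda>x. f x + g x)"
proof (induction k arbitrary: f g)
  case 0
  then show ?case by (auto intro: continuous_intros)
next
  case (Suc k)
  note F = C_k_Suc_gradient[OF Suc.prems(1)] and G = C_k_Suc_gradient[OF Suc.prems(2)]
  show ?case
    unfolding C_k_Suc_iff[OF has_cont_gradient_add[OF F G]]
    using Suc.prems unfolding C_k_Suc_iff[OF F] C_k_Suc_iff[OF G] inner_add_left
    by (auto intro: Suc.IH)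
qed

lemma C_k_mult: "C_k k f \<Longrightarrow> C_k k g \<Longrightarrow> C_k k (\<lambda>x. f x * g x)"
proof (induction k arbitrary: f g)
  case 0
  then show ?case by (auto intro: continuous_intros)
next
  case (Suc k)
  note F = C_k_Suc_gradient[OF Suc.prems(1)] and G = C_k_Suc_gradient[OF Suc.prems(2)]
  \<comment> \<open>The product rule leaves one factor of each term undifferentiated; it has to be
    lowered to order \<open>k\<close> before the induction hypothesis applies.\<close>
  show ?case
    unfolding C_k_Suc_iff[OF has_cont_gradient_mult[OF F G]]
    using Suc.prems C_k_Suc_D[OF Suc.prems(1)] C_k_Suc_D[OF Suc.prems(2)] unfolding C_k_Suc_iff[OF F] C_k_Suc_iff[OF G] inner_add_left inner_scaleR_left
    by (auto intro!: Suc.IH C_k_add)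
qed

lemma C_k_const: "C_k k (\<lambda>x. c)"
proof (induction k arbitrary: c)
  case (Suc k)
  then show ?case unfolding C_k_Suc_iff[OF has_cont_gradient_const] by auto
qed auto

lemma C_k_inner: "C_k k (\<lambda>x. (x - z) \<bullet> i)"
proof (cases k)
  case (Suc m)
  have "has_cont_gradient (\<lambda>x. (x - z) \<bullet> i) (\<lambda>x. i)"
    unfolding has_cont_gradient_def
    by (auto intro!: continuous_intros derivative_eq_intros simp: inner_commute)
  from C_k_Suc_iff[OF this, of m] show ?thesis using Suc C_k_const by auto
qed (auto intro!: continuous_intros)

text \<open>The standard bump \<open>exp (- 1 / (1 - A |x - z|^2))\<close>, supported in the ball
  about \<open>z\<close> of radius \<open>1 / sqrt A\<close> when \<open>A > 0\<close>. The centre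
  is a parameter because the mollifier is also tested as a function of the reflected
  variable.\<close>

definition bump :: "real \<Rightarrow> 'a::euclidean_space \<Rightarrow> 'a \<Rightarrow> real" where
  "bump A z x = flat_exp 0 (1 - A * ((x - z) \<bullet> (x - z)))"

lemma flat_exp_ball_gradient:
  "has_cont_gradient (\<lambda>x. flat_exp j (1 - A * ((x - z) \<bullet> (x - z))))
     (\<lambda>x. (flat_exp (j + 2) (1 - A * ((x - z) \<bullet> (x - z)))
            - real j * flat_exp (Suc j) (1 - A * ((x - z) \<bullet> (x - z)))) *\<^sub>R ((- 2 * A) *\<^sub>R (x - z)))"
proof (rule has_cont_gradient_compose)
  show "has_cont_gradient (\<lambda>x. 1 - A * ((x - z) \<bullet> (x - z))) (\<lambda>x. (- 2 * A) *\<^sub>R (x - z))"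
    unfolding has_cont_gradient_def
    by (auto intro!: continuous_intros derivative_eq_intros simp: inner_commute algebra_simps)
qed (use flat_exp_deriv in \<open>auto intro!: continuous_intros flat_exp_continuous\<close>)

text \<open>The index \<open>j\<close> has to vary in the induction, since differentiation raises it
  by one or two.\<close>

lemma C_k_flat_exp_ball: "C_k k (\<lambda>x. flat_exp j (1 - A * ((x - z) \<bullet> (x - z))))"
proof (induction k arbitrary: j)
  case 0
  then show ?case
    by (simp add: has_cont_gradient_cont[OF flat_exp_ball_gradient])
next
  case (Suc k)
  show ?case
    unfolding C_k_Suc_iff[OF flat_exp_ball_gradient]
    unfolding inner_scaleR_left diff_conv_add_uminus[of "flat_exp _ _"] minus_mult_left
    by (intro ballI C_k_mult C_k_add C_k_const Suc.IH C_k_inner)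
qed

lemma test_function_bump:
  assumes "A > 0"
  shows "test_function (\<lambda>x. c * bump A z x)"
  unfolding test_function_def
proof (intro conjI allI)
  show "C_k k (\<lambda>x. c * bump A z x)" for k
    unfolding bump_def by (intro C_k_mult C_k_const C_k_flat_exp_ball)
  have "{x. c * bump A z x \<noteq> 0} \<subseteq> cball z (1 / sqrt A)"
  proof
    fix x assume "x \<in> {x. c * bump A z x \<noteq> 0}"
    then have "A * (norm (x - z))\<^sup>2 < 1"
      by (auto simp: bump_def flat_exp_def dot_square_norm split: if_splits)
    then have "(norm (x - z))\<^sup>2 \<le> (1 / sqrt A)\<^sup>2"
      using assms by (simp add: field_simps power_divide)
    then have "norm (x - z) \<le> 1 / sqrt A"
      by (rule power2_le_imp_le) (use assms in auto)
    then show "x \<in> cball z (1 / sqrt A)"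
      by (simp add: dist_norm norm_minus_commute)
  qed
  then show "compact (closure {x. c * bump A z x \<noteq> 0})"
    by (meson bounded_cball bounded_subset compact_closure)
qed

subsection \<open>Local integrability\<close>

text \<open>Integrability on compact sets gives measurability of restrictions only; exhaustion by
  balls of integer radius gives it globally.\<close>

lemma locally_integrable_measurable:
  fixes f :: "'a::euclidean_space \<Rightarrow> 'b::euclidean_space"
  assumes "locally_integrable lebesgue f"
  shows "f \<in> borel_measurable lebesgue"
proof (rule borel_measurable_LIMSEQ_metric)
  fix i :: nat
  have "set_integrable lebesgue (cball 0 (real i)) f"
    using assms by (simp add: locally_integrable_def)
  then show "(\<lambda>x. indicat_real (cball 0 (real i)) x *\<^sub>R f x) \<in> borel_measurable lebesgue"
    by (simp add: set_integrable_def)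
next
  fix x :: 'a
  obtain n :: nat where n: "norm x \<le> real n" using real_arch_simple by blast
  have "\<forall>\<^sub>F i in sequentially. indicat_real (cball 0 (real i)) x *\<^sub>R f x = f x"
    using eventually_ge_at_top[of n] by eventually_elim (use n in auto)
  then show "(\<lambda>i. indicat_real (cball 0 (real i)) x *\<^sub>R f x) \<longlonglongrightarrow> f x"
    by (rule tendsto_eventually)
qed

lemma locally_integrable_mult_bounded:
  fixes f :: "'a::euclidean_space \<Rightarrow> 'b::euclidean_space" and b :: "'a \<Rightarrow> real"
  assumes "locally_integrable lebesgue f" "b \<in> borel_measurable lebesgue"
    "compact K" "\<And>x. x \<notin> K \<Longrightarrow> b x = 0" "\<And>x. \<bar>b x\<bar> \<le> B"
  shows "integrable lebesgue (\<lambda>x. b x *\<^sub>R f x)"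
proof (rule Bochner_Integration.integrable_bound)
  show "integrable lebesgue (\<lambda>x. B *\<^sub>R (indicator K x *\<^sub>R f x))"
    using assms(1,3) unfolding locally_integrable_def set_integrable_def
    by (intro integrable_scaleR_right) simp
  show "(\<lambda>x. b x *\<^sub>R f x) \<in> borel_measurable lebesgue"
    using assms(2) locally_integrable_measurable[OF assms(1)] by measurable
  show "AE x in lebesgue. norm (b x *\<^sub>R f x) \<le> norm (B *\<^sub>R (indicat_real K x *\<^sub>R f x))"
    using assms(4) order_trans[OF assms(5) abs_ge_self]
    by (intro AE_I2) (auto simp: indicator_def intro!: mult_right_mono)
qed

lemma locally_integrable_mult_bounded_inner:
  fixes f b :: "'a::euclidean_space \<Rightarrow> 'b::euclidean_space"
  assumes "locally_integrable lebesgue f" "b \<in> borel_measurable lebesgue"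
    "compact K" "\<And>x. x \<notin> K \<Longrightarrow> b x = 0" "\<And>x. norm (b x) \<le> B"
  shows "integrable lebesgue (\<lambda>x. b x \<bullet> f x)"
proof (rule Bochner_Integration.integrable_bound)
  show "integrable lebesgue (\<lambda>x. B *\<^sub>R (indicator K x *\<^sub>R f x))"
    using assms(1,3) unfolding locally_integrable_def set_integrable_def
    by (intro integrable_scaleR_right) simp
  show "(\<lambda>x. b x \<bullet> f x) \<in> borel_measurable lebesgue"
    using assms(2) locally_integrable_measurable[OF assms(1)] by measurable
  show "AE x in lebesgue. norm (b x \<bullet> f x) \<le> norm (B *\<^sub>R (indicat_real K x *\<^sub>R f x))"
  proof (rule AE_I2)
    fix x
    have "\<bar>b x \<bullet> f x\<bar> \<le> \<bar>B\<bar> * norm (f x)"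
      using Cauchy_Schwarz_ineq2[of "b x" "f x"] order_trans[OF assms(5) abs_ge_self]
      by (meson mult_right_mono norm_ge_zero order_trans)
    then show "norm (b x \<bullet> f x) \<le> norm (B *\<^sub>R (indicat_real K x *\<^sub>R f x))"
      using assms(4) by (auto simp: indicator_def)
  qed
qed

lemma locally_integrableI_integrable:
  fixes f :: "'a::euclidean_space \<Rightarrow> 'b::euclidean_space"
  assumes "integrable lebesgue f"
  shows "locally_integrable lebesgue f"
  unfolding locally_integrable_def set_integrable_def
  using assms by (auto intro!: integrable_mult_indicator borel_compact)

subsection \<open>Convolution with a smooth kernel\<close>

text \<open>Along a convergent sequence, contained in a ball of radius \<open>r\<close>, all
  integrands live on the ball of radius \<open>r + R\<close>, where \<open>u\<close> is integrable;
  dominated convergence applies.\<close>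

lemma convolution_continuous:
  fixes \<kappa> :: "'a::euclidean_space \<Rightarrow> 'b::euclidean_space" and u :: "'a \<Rightarrow> real"
  assumes u: "locally_integrable lebesgue u"
    and k: "continuous_on UNIV \<kappa>" "\<And>z. norm z > R \<Longrightarrow> \<kappa> z = 0"
  shows "continuous_on UNIV (\<lambda>x. LINT y|lebesgue. u y *\<^sub>R \<kappa> (x - y))"
proof (rule continuous_at_imp_continuous_on, rule ballI, unfold continuous_at_sequentially comp_def, intro allI impI)
  fix x :: 'a and s :: "nat \<Rightarrow> 'a"
  assume s: "s \<longlonglongrightarrow> x"
  obtain r where r: "\<And>n. norm (s n) \<le> r"
    using convergent_imp_Bseq[of s] s by (auto simp: convergent_def Bseq_def)
  obtain B where B: "B \<ge> 0" "\<And>z. norm (\<kappa> z) \<le> B"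
    using continuous_compact_support_bounded[OF k(1) compact_cball[of 0 R]] k(2)
    by (auto simp: not_le)
  have m: "(\<lambda>y. \<kappa> (x - y)) \<in> borel_measurable lebesgue" for x
    by (intro continuous_borel_measurable_lebesgue continuous_on_compose2[OF k(1)] continuous_intros) auto
  show "(\<lambda>n. LINT y|lebesgue. u y *\<^sub>R \<kappa> (s n - y)) \<longlonglongrightarrow> (LINT y|lebesgue. u y *\<^sub>R \<kappa> (x - y))"
  proof (rule integral_dominated_convergence[where w="\<lambda>y. B * norm (indicator (cball 0 (r + R)) y *\<^sub>R u y)"])
    show "integrable lebesgue (\<lambda>y. B * norm (indicat_real (cball 0 (r + R)) y *\<^sub>R u y))"
      using u by (auto simp: locally_integrable_def set_integrable_def)
    show "AE y in lebesgue. (\<lambda>n. u y *\<^sub>R \<kappa> (s n - y)) \<longlonglongrightarrow> u y *\<^sub>R \<kappa> (x - y)"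
    proof (intro AE_I2 tendsto_scaleR tendsto_const)
      fix y
      have "isCont \<kappa> (x - y)" using k(1) by (simp add: continuous_on_eq_continuous_at)
      then show "(\<lambda>n. \<kappa> (s n - y)) \<longlonglongrightarrow> \<kappa> (x - y)"
        by (rule isCont_tendsto_compose) (intro tendsto_intros s)
    qed
    fix n
    show "AE y in lebesgue. norm (u y *\<^sub>R \<kappa> (s n - y)) \<le> B * norm (indicat_real (cball 0 (r + R)) y *\<^sub>R u y)"
    proof (intro AE_I2)
      fix y
      show "norm (u y *\<^sub>R \<kappa> (s n - y)) \<le> B * norm (indicat_real (cball 0 (r + R)) y *\<^sub>R u y)"
      proof (cases "norm y \<le> r + R")
        case True
        then show ?thesis using mult_right_mono[OF B(2)[of "s n - y"] abs_ge_zero[of "u y"]] by (simp add: mult.commute)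
      next
        case False
        then have "norm (s n - y) > R"
          using norm_triangle_ineq2[of y "s n"] r[of n] by (simp add: norm_minus_commute)
        then show ?thesis using k(2) B by simp
      qed
    qed
  qed (use m locally_integrable_measurable[OF u] in auto)
qed

text \<open>Uniform continuity of \<open>g\<close> on a ball makes the first-order remainder of the
  kernel at most \<open>e' |v|\<close>, uniformly in its argument. Integration against
  \<open>|u|\<close> then gives differentiability under the integral, although \<open>u\<close> is
  merely locally integrable.\<close>

lemma convolution_gradient:
  fixes \<kappa> u :: "'a::euclidean_space \<Rightarrow> real"
  assumes u: "locally_integrable lebesgue u"
    and k: "has_cont_gradient \<kappa> g" "\<And>z. norm z > R \<Longrightarrow> \<kappa> z = 0" and R: "R \<ge> 0"
  shows "has_cont_gradient (\<lambda>x. LINT y|lebesgue. u y * \<kappa> (x - y))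
           (\<lambda>x. LINT y|lebesgue. u y *\<^sub>R g (x - y))"
  unfolding has_cont_gradient_def
proof (intro conjI allI)
  have g0: "g z = 0" if "norm z > R" for z
    by (rule has_cont_gradient_zero_outside[OF k(1), of "cball 0 R"]) (use k that in auto)
  note gc = has_cont_gradient_cont_grad[OF k(1)]
  show "continuous_on UNIV (\<lambda>x. LINT y|lebesgue. u y *\<^sub>R g (x - y))"
    by (rule convolution_continuous[OF u gc g0])
  have bnd: "\<exists>B. \<forall>z. norm (\<kappa> z) \<le> B" "\<exists>B. \<forall>z. norm (g z) \<le> B"
    using continuous_compact_support_bounded[OF has_cont_gradient_cont[OF k(1)] compact_cball[of 0 R]]
      continuous_compact_support_bounded[OF gc compact_cball[of 0 R]] k(2) g0
    by (metis mem_cball_0 not_le)+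
  have int: "integrable lebesgue (\<lambda>y. u y * \<kappa> (x - y))" for x
  proof -
    obtain B where B: "\<And>z. norm (\<kappa> z) \<le> B" using bnd by auto
    have "integrable lebesgue (\<lambda>y. \<kappa> (x - y) *\<^sub>R u y)"
    proof (rule locally_integrable_mult_bounded[OF u, of _ "cball x R"])
      show "(\<lambda>y. \<kappa> (x - y)) \<in> borel_measurable lebesgue"
        by (intro continuous_borel_measurable_lebesgue continuous_on_compose2[OF has_cont_gradient_cont[OF k(1), of UNIV]] continuous_intros) auto
    qed (use B k(2) in \<open>auto simp: dist_norm\<close>)
    then show ?thesis by (simp add: mult.commute)
  qed
  obtain B where B: "\<And>z. norm (g z) \<le> B" using bnd by auto
  have intg: "integrable lebesgue (\<lambda>y. u y *\<^sub>R g (x - y))" for x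
  proof (rule Bochner_Integration.integrable_bound)
    show "integrable lebesgue (\<lambda>y. B * norm (indicator (cball x R) y *\<^sub>R u y))"
      using u by (auto simp: locally_integrable_def set_integrable_def)
    have m: "(\<lambda>y. g (x - y)) \<in> borel_measurable lebesgue"
      by (intro continuous_borel_measurable_lebesgue continuous_on_compose2[OF gc[of UNIV]] continuous_intros) auto
    then show "(\<lambda>y. u y *\<^sub>R g (x - y)) \<in> borel_measurable lebesgue"
      using locally_integrable_measurable[OF u] by auto
    show "AE y in lebesgue. norm (u y *\<^sub>R g (x - y)) \<le> norm (B * norm (indicat_real (cball x R) y *\<^sub>R u y))"
    proof (intro AE_I2)
      fix y
      show "norm (u y *\<^sub>R g (x - y)) \<le> norm (B * norm (indicat_real (cball x R) y *\<^sub>R u y))"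
      proof (cases "y \<in> cball x R")
        case True
        have "norm (g (x - y)) * \<bar>u y\<bar> \<le> \<bar>B\<bar> * \<bar>u y\<bar>"
          by (intro mult_right_mono order_trans[OF B abs_ge_self]) auto
        then show ?thesis using True by (simp add: mult.commute abs_mult)
      next
        case False
        then show ?thesis using g0 by (simp add: dist_norm)
      qed
    qed
  qed
  fix x
  show "((\<lambda>x. LINT y|lebesgue. u y * \<kappa> (x - y)) has_derivative
          (\<lambda>v. (LINT y|lebesgue. u y *\<^sub>R g (x - y)) \<bullet> v)) (at x)"
    unfolding has_derivative_at_alt
  proof (intro conjI allI impI)
    show "bounded_linear (\<lambda>v. (LINT y|lebesgue. u y *\<^sub>R g (x - y)) \<bullet> v)"
      by (rule bounded_linear_inner_right)
    fix e :: real assume "e > 0"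
    define m where "m = (LINT y|lebesgue. indicator (cball x (R + 1)) y * \<bar>u y\<bar>)"
    have ui: "integrable lebesgue (\<lambda>y. indicator (cball x (R + 1)) y * \<bar>u y\<bar>)"
    proof -
      have "set_integrable lebesgue (cball x (R + 1)) u"
        using u by (auto simp: locally_integrable_def)
      then have "integrable lebesgue (\<lambda>y. norm (indicator (cball x (R + 1)) y *\<^sub>R u y))"
        unfolding set_integrable_def by (rule integrable_norm)
      then show ?thesis by (simp add: abs_mult)
    qed
    have m: "m \<ge> 0" unfolding m_def by (rule integral_nonneg_AE) auto
    \<comment> \<open>The summand 1 keeps the denominator positive when \<open>u\<close> vanishes
      near \<open>x\<close>.\<close>
    define e' where "e' = e / (m + 1)"
    have e': "e' > 0" "e' * m \<le> e" using \<open>e > 0\<close> m by (auto simp: e'_def field_simps)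
    \<comment> \<open>Arguments beyond \<open>R + 1\<close> contribute nothing for increments
      shorter than 1; from within \<open>R + 1\<close> the segment to the shifted point stays in
      radius \<open>R + 2\<close>.\<close>
    have "uniformly_continuous_on (cball 0 (R + 2)) g"
      by (intro compact_uniformly_continuous gc compact_cball)
    then obtain d where d: "d > 0" "\<And>z w. z \<in> cball 0 (R + 2) \<Longrightarrow> w \<in> cball 0 (R + 2) \<Longrightarrow> dist w z < d \<Longrightarrow> dist (g w) (g z) < e'"
      unfolding uniformly_continuous_on_def using e'(1) by metis
    have key: "norm (\<kappa> (z + v) - \<kappa> z - g z \<bullet> v) \<le> indicator (cball 0 (R + 1)) z * (norm v * e')"
      if v: "norm v < min d 1" for z v
    proof (cases "norm z \<le> R + 1")
      case True
      define S where "S = closed_segment z (z + v)"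
      have S: "norm (w - z) \<le> norm v" if "w \<in> S" for w
      proof -
        have "dist w z \<le> dist (z + v) z"
          using that dist_in_closed_segment[of w z "z + v"] by (simp add: S_def dist_commute)
        then show ?thesis by (simp add: dist_norm)
      qed
      have "norm (\<kappa> (z + v) - \<kappa> z - g z \<bullet> ((z + v) - z)) \<le> norm ((z + v) - z) * e'"
      proof (rule differentiable_bound_linearization[where S = S and f' = "\<lambda>w v. g w \<bullet> v"])
        show "z + t *\<^sub>R (z + v - z) \<in> S" if "t \<in> {0..1}" for t
          using that unfolding S_def in_segment by (auto intro!: exI[of _ t] simp: algebra_simps)
        show "(\<kappa> has_derivative (\<bullet>) (g w)) (at w within S)" for w
          using has_cont_gradientD[OF k(1)] has_derivative_at_withinI by blast
        show "z \<in> S" by (simp add: S_def)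
        show "onorm ((\<bullet>) (g w) - (\<bullet>) (g z)) \<le> e'" if w: "w \<in> S" for w
        proof (rule onorm_bound)
          have "norm w \<le> norm (w - z) + norm z" by (metis diff_add_cancel norm_triangle_ineq)
          then have "norm w \<le> R + 2" using S[OF w] v True by auto
          then have "dist (g w) (g z) < e'"
            using True S[OF w] v by (intro d) (auto simp: dist_norm)
          then show "norm (((\<bullet>) (g w) - (\<bullet>) (g z)) y) \<le> e' * norm y" for y
            using order_trans[OF Cauchy_Schwarz_ineq2[of "g w - g z" y] mult_right_mono[of "norm (g w - g z)" e' "norm y"]]
            by (auto simp: inner_diff_left dist_norm)
        qed (use e' in auto)
      qed
      then show ?thesis using True by simp
    next
      case False
      then have "norm (z + v) > R" using norm_triangle_ineq2[of z "-v"] v by auto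
      then show ?thesis using False k(2) g0 by auto
    qed
    show "\<exists>d>0. \<forall>x'. norm (x' - x) < d \<longrightarrow> norm ((LINT y|lebesgue. u y * \<kappa> (x' - y)) -
      (LINT y|lebesgue. u y * \<kappa> (x - y)) - (LINT y|lebesgue. u y *\<^sub>R g (x - y)) \<bullet> (x' - x)) \<le> e * norm (x' - x)"
    proof (intro exI[of _ "min d 1"] conjI allI impI)
      fix x' assume v: "norm (x' - x) < min d 1"
      define v where "v = x' - x"
      have eq: "(LINT y|lebesgue. u y * \<kappa> (x' - y)) -
      (LINT y|lebesgue. u y * \<kappa> (x - y)) - (LINT y|lebesgue. u y *\<^sub>R g (x - y)) \<bullet> (x' - x)
        = (LINT y|lebesgue. u y * (\<kappa> ((x - y) + v) - \<kappa> (x - y) - g (x - y) \<bullet> v))"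
      proof -
        have "(LINT y|lebesgue. u y *\<^sub>R g (x - y)) \<bullet> v = (LINT y|lebesgue. (u y *\<^sub>R g (x - y)) \<bullet> v)"
          by (rule integral_inner_left[symmetric]) (use intg in auto)
        moreover have "integrable lebesgue (\<lambda>y. (u y *\<^sub>R g (x - y)) \<bullet> v)"
          by (rule integrable_inner_left[OF intg])
        moreover have "u y * (\<kappa> ((x - y) + v) - \<kappa> (x - y) - g (x - y) \<bullet> v)
            = u y * \<kappa> (x' - y) - u y * \<kappa> (x - y) - (u y *\<^sub>R g (x - y)) \<bullet> v" for y
          by (simp add: v_def right_diff_distrib)
        ultimately show ?thesis
          unfolding v_def[symmetric]
          by (simp only: Bochner_Integration.integral_diff Bochner_Integration.integrable_diff int)
      qed
      have "norm (LINT y|lebesgue. u y * (\<kappa> ((x - y) + v) - \<kappa> (x - y) - g (x - y) \<bullet> v))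
        \<le> (LINT y|lebesgue. (norm v * e') * (indicator (cball x (R + 1)) y * \<bar>u y\<bar>))"
      proof (rule Bochner_Integration.integral_norm_bound_integral)
        have "integrable lebesgue (\<lambda>y. u y * \<kappa> (x' - y) - u y * \<kappa> (x - y) - (u y *\<^sub>R g (x - y)) \<bullet> v)"
          by (intro Bochner_Integration.integrable_diff int integrable_inner_left intg)
        then show "integrable lebesgue (\<lambda>y. u y * (\<kappa> ((x - y) + v) - \<kappa> (x - y) - g (x - y) \<bullet> v))"
          by (simp add: v_def algebra_simps)
        show "integrable lebesgue (\<lambda>y. (norm v * e') * (indicator (cball x (R + 1)) y * \<bar>u y\<bar>))"
          using ui by simp
        fix y
        have "\<bar>u y\<bar> * norm (\<kappa> ((x - y) + v) - \<kappa> (x - y) - g (x - y) \<bullet> v)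
          \<le> \<bar>u y\<bar> * (indicator (cball 0 (R + 1)) (x - y) * (norm v * e'))"
          by (intro mult_left_mono key) (use v in \<open>auto simp: v_def\<close>)
        then show "norm (u y * (\<kappa> ((x - y) + v) - \<kappa> (x - y) - g (x - y) \<bullet> v))
          \<le> (norm v * e') * (indicator (cball x (R + 1)) y * \<bar>u y\<bar>)"
          by (simp add: abs_mult indicator_def dist_norm mult_ac norm_minus_commute[of y x] split: if_splits)
      qed
      also have "\<dots> = norm v * (e' * m)" by (simp add: m_def)
      also have "\<dots> \<le> norm v * e" using e' by (intro mult_left_mono) auto
      finally show "norm ((LINT y|lebesgue. u y * \<kappa> (x' - y)) -
      (LINT y|lebesgue. u y * \<kappa> (x - y)) - (LINT y|lebesgue. u y *\<^sub>R g (x - y)) \<bullet> (x' - x)) \<le> e * norm (x' - x)"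
        unfolding eq by (simp add: v_def mult.commute)
    qed (use d in auto)
  qed
qed

subsection \<open>The standard mollifier\<close>

text \<open>The mass depends on the space through its type alone, hence the type token.\<close>

definition bump_mass :: "'a::euclidean_space itself \<Rightarrow> nat \<Rightarrow> real" where
  "bump_mass _ n = (LINT x|lebesgue. bump ((real (Suc n))\<^sup>2) (0::'a) x)"

definition mollifier :: "nat \<Rightarrow> 'a::euclidean_space \<Rightarrow> real" where
  "mollifier n z = bump ((real (Suc n))\<^sup>2) 0 z / bump_mass TYPE('a) n"

text \<open>Values in any Euclidean space are allowed, so that weights, gradients and Laplacians are
  mollified by one and the same operator.\<close>

definition mollify ::
    "nat \<Rightarrow> ('a::euclidean_space \<Rightarrow> 'b::euclidean_space) \<Rightarrow> 'a \<Rightarrow> 'b" where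
  "mollify n f x = (LINT y|lebesgue. mollifier n (x - y) *\<^sub>R f y)"

lemma bump_nonneg: "bump A z x \<ge> 0"
  by (simp add: bump_def flat_exp_def)

lemma bump_continuous: "continuous_on UNIV (bump A z)"
  unfolding bump_def[abs_def] using C_k_continuous[OF C_k_flat_exp_ball] .

lemma bump_eq_0:
  assumes "norm z \<ge> 1 / real (Suc n)"
  shows "bump ((real (Suc n))\<^sup>2) 0 z = 0"
proof -
  have "1 \<le> real (Suc n) * norm z" using assms by (simp add: field_simps)
  then have "1\<^sup>2 \<le> (real (Suc n) * norm z)\<^sup>2" by (rule power_mono) auto
  then have "1 \<le> (real (Suc n))\<^sup>2 * (z \<bullet> z)"
    by (simp add: power_mult_distrib dot_square_norm)
  then show ?thesis by (simp add: bump_def flat_exp_def)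
qed

lemma bump_integrable: "integrable lebesgue (bump ((real (Suc n))\<^sup>2) (0::'a::euclidean_space))"
proof (rule integrable_continuous_compact_support[OF bump_continuous compact_cball[of 0 1]])
  fix x :: 'a assume "x \<notin> cball 0 1"
  then have "1 / real (Suc n) \<le> norm x"
    using order_trans[of "1 / real (Suc n)" 1 "norm x"] by simp
  then show "bump ((real (Suc n))\<^sup>2) (0::'a) x = 0" by (rule bump_eq_0)
qed

text \<open>A nonnegative function with vanishing integral is zero almost everywhere, yet the bump
  is positive on a ball.\<close>

lemma bump_mass_pos: "bump_mass TYPE('a::euclidean_space) n > 0"
proof -
  let ?b = "bump ((real (Suc n))\<^sup>2) (0::'a)"
  have "bump_mass TYPE('a) n \<noteq> 0"
  proof
    assume "bump_mass TYPE('a) n = 0"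
    then have "AE x in lebesgue. ?b x = 0"
      using integral_nonneg_eq_0_iff_AE[OF bump_integrable[where 'a='a and n=n]] bump_nonneg by (auto simp: bump_mass_def)
    moreover have "?b x > 0" if "x \<in> ball 0 (1 / real (Suc n))" for x
    proof -
      have "real (Suc n) * norm x < 1" using that by (simp add: field_simps)
      then have "(real (Suc n) * norm x)\<^sup>2 < 1\<^sup>2" by (intro power_strict_mono) auto
      then have "(real (Suc n))\<^sup>2 * (x \<bullet> x) < 1"
        by (simp add: power_mult_distrib dot_square_norm)
      then show ?thesis by (simp add: bump_def flat_exp_def)
    qed
    ultimately have "AE x in lebesgue. x \<notin> ball (0::'a) (1 / real (Suc n))"
      by (elim eventually_mono) (metis less_irrefl)
    then have "ball (0::'a) (1 / real (Suc n)) \<in> null_sets lebesgue"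
      by (simp add: AE_iff_null_sets)
    then have "negligible (ball (0::'a) (1 / real (Suc n)))"
      by (simp add: negligible_iff_null_sets)
    then show False using open_not_negligible[OF open_ball, of "0::'a" "1 / real (Suc n)"] by (simp add: ball_eq_empty)
  qed
  moreover have "bump_mass TYPE('a) n \<ge> 0"
    unfolding bump_mass_def by (rule integral_nonneg_AE) (simp add: bump_nonneg)
  ultimately show ?thesis by simp
qed

lemma mollifier_nonneg: "mollifier n z \<ge> 0"
  by (simp add: mollifier_def bump_nonneg bump_mass_pos less_imp_le)

lemma mollifier_eq_0: "norm z \<ge> 1 / real (Suc n) \<Longrightarrow> mollifier n z = 0"
  by (simp only: mollifier_def bump_eq_0 div_0)

lemma mollifier_eq_0': "norm z > 1 \<Longrightarrow> mollifier n z = 0"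
  using order_trans[of "1 / real (Suc n)" 1 "norm z"] by (intro mollifier_eq_0) simp

lemma mollifier_shift: "mollifier n (x - y) = (1 / bump_mass TYPE('a) n) * bump ((real (Suc n))\<^sup>2) x (y::'a::euclidean_space)"
  by (simp add: mollifier_def bump_def inner_diff_left inner_diff_right algebra_simps inner_commute)

lemma mollifier_minus: "mollifier n (x - y) = mollifier n (y - x)"
  by (simp add: mollifier_def bump_def inner_diff_left inner_diff_right algebra_simps inner_commute)

lemma test_function_mollifier: "test_function (\<lambda>y. mollifier n (x - y))"
  unfolding mollifier_shift by (rule test_function_bump) simp

lemma C_k_mollifier: "C_k k (mollifier n)"
  using test_function_bump[of "(real (Suc n))\<^sup>2" "1 / bump_mass TYPE('a) n" "0::'a"]
  unfolding mollifier_def[abs_def] by (simp add: test_function_def)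

lemma mollifier_continuous: "continuous_on S (mollifier n)"
  using C_k_continuous[OF C_k_mollifier] continuous_on_subset by blast

lemma integrable_mollifier: "integrable lebesgue (mollifier n)"
  unfolding mollifier_def[abs_def] using bump_integrable by auto

lemma integral_mollifier: "integral\<^sup>L lebesgue (mollifier n :: 'a::euclidean_space \<Rightarrow> real) = 1"
  unfolding mollifier_def[abs_def]
  using bump_mass_pos[where 'a='a, of n] by (simp add: bump_mass_def)

lemma nn_integral_mollifier_shift:
  "(\<integral>\<^sup>+ x. ennreal (mollifier n (x - y :: 'a::euclidean_space)) \<partial>lborel) = 1"
proof -
  have m: "(\<lambda>x. ennreal (mollifier n (x::'a))) \<in> borel_measurable borel"
    by (intro measurable_compose[OF _ measurable_ennreal] borel_measurable_continuous_onI mollifier_continuous)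
  have "(\<integral>\<^sup>+ x. ennreal (mollifier n (- y + x)) \<partial>lborel) = (\<integral>\<^sup>+ x. ennreal (mollifier n (x::'a)) \<partial>distr lborel borel ((+) (- y)))"
    using m by (subst nn_integral_distr) auto
  also have "\<dots> = (\<integral>\<^sup>+ x. ennreal (mollifier n (x::'a)) \<partial>lborel)"
    by (simp only: lborel_distr_plus)
  also have "\<dots> = (\<integral>\<^sup>+ x. ennreal (mollifier n (x::'a)) \<partial>lebesgue)"
    by (simp add: nn_integral_completion)
  also have "\<dots> = 1"
    by (subst nn_integral_eq_integral[OF integrable_mollifier]) (auto simp: mollifier_nonneg integral_mollifier)
  finally show ?thesis by simp
qed

text \<open>Tonelli's theorem, together with the fact that the kernel has mass one in
  \<open>x\<close> for each fixed \<open>y\<close>.\<close>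

lemma nn_integral_mollifier_convolution:
  fixes f :: "'a::euclidean_space \<Rightarrow> ennreal"
  assumes "f \<in> borel_measurable lebesgue"
  shows "(\<integral>\<^sup>+ x. (\<integral>\<^sup>+ y. ennreal (mollifier n (x - y)) * f y \<partial>lebesgue) \<partial>lebesgue) = (\<integral>\<^sup>+ x. f x \<partial>lebesgue)"
proof -
  \<comment> \<open>Tonelli's theorem is available for Borel functions on the product, so the
    Lebesgue measurable \<open>f\<close> is replaced by a Borel function equal to it almost
    everywhere.\<close>
  obtain f' where f': "f' \<in> borel_measurable borel" "AE x in lborel. f x = f' x"
    using completion_ex_borel_measurable[OF assms] by auto
  have m: "(\<lambda>(x, y). ennreal (mollifier n (x - y :: 'a)) * f' y) \<in> borel_measurable (lborel \<Otimes>\<^sub>M lborel)"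
  proof -
    have "continuous_on UNIV (\<lambda>p::'a\<times>'a. mollifier n (fst p - snd p))"
      by (intro continuous_on_compose2[OF mollifier_continuous[of UNIV]] continuous_intros) auto
    then have "(\<lambda>p::'a\<times>'a. mollifier n (fst p - snd p)) \<in> borel_measurable (borel \<Otimes>\<^sub>M borel)"
      unfolding borel_prod by (rule borel_measurable_continuous_onI)
    then show ?thesis using f'(1) by (simp add: case_prod_beta')
  qed
  have "(\<integral>\<^sup>+ x. (\<integral>\<^sup>+ y. ennreal (mollifier n (x - y)) * f y \<partial>lebesgue) \<partial>lebesgue)
    = (\<integral>\<^sup>+ x. (\<integral>\<^sup>+ y. ennreal (mollifier n (x - y)) * f' y \<partial>lborel) \<partial>lborel)"
    unfolding nn_integral_completion
    by (intro nn_integral_cong nn_integral_cong_AE) (use f'(2) in auto)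
  also have "\<dots> = (\<integral>\<^sup>+ y. (\<integral>\<^sup>+ x. ennreal (mollifier n (x - y)) * f' y \<partial>lborel) \<partial>lborel)"
    using lborel_pair.Fubini'[OF m] by simp
  also have "\<dots> = (\<integral>\<^sup>+ y. (\<integral>\<^sup>+ x. ennreal (mollifier n (x - y)) \<partial>lborel) * f' y \<partial>lborel)"
    by (intro nn_integral_cong nn_integral_multc measurable_compose[OF _ measurable_ennreal] )
      (simp, intro borel_measurable_continuous_onI continuous_on_compose2[OF mollifier_continuous[of UNIV]] continuous_intros, auto)
  also have "\<dots> = (\<integral>\<^sup>+ x. f x \<partial>lebesgue)"
    unfolding nn_integral_mollifier_shift nn_integral_completion using f'(2)
    by (intro nn_integral_cong_AE) auto
  finally show ?thesis .
qed

lemma integrable_mollifier_mult: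
  fixes f :: "'a::euclidean_space \<Rightarrow> 'b::euclidean_space"
  assumes "locally_integrable lebesgue f"
  shows "integrable lebesgue (\<lambda>y. mollifier n (x - y) *\<^sub>R f y)"
proof -
  obtain B where B: "\<And>z::'a. norm (mollifier n z) \<le> B"
    using continuous_compact_support_bounded[OF mollifier_continuous compact_cball[of 0 1]] mollifier_eq_0'
    by (metis mem_cball_0 not_le)
  show ?thesis
  proof (rule locally_integrable_mult_bounded[OF assms, of _ "cball x 1"])
    show "(\<lambda>y. mollifier n (x - y)) \<in> borel_measurable lebesgue"
      by (intro continuous_borel_measurable_lebesgue continuous_on_compose2[OF mollifier_continuous[of UNIV]] continuous_intros) auto
  qed (use B mollifier_eq_0' in \<open>auto simp: dist_norm not_le\<close>)
qed

lemma mollify_nonneg: "(\<And>y. f y \<ge> 0) \<Longrightarrow> mollify n f x \<ge> (0::real)"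
  unfolding mollify_def by (rule integral_nonneg_AE) (simp add: mollifier_nonneg)

lemma mollify_inner:
  assumes "locally_integrable lebesgue f"
  shows "mollify n f x \<bullet> v = mollify n (\<lambda>y. f y \<bullet> v) x"
  unfolding mollify_def
  using integral_inner_left[of v lebesgue "\<lambda>y. mollifier n (x - y) *\<^sub>R f y"] integrable_mollifier_mult[OF assms]
  by auto

lemma locally_integrable_inner:
  fixes f :: "'a::euclidean_space \<Rightarrow> 'b::euclidean_space"
  assumes "locally_integrable lebesgue f"
  shows "locally_integrable lebesgue (\<lambda>x. f x \<bullet> v)"
  unfolding locally_integrable_def
proof (intro allI impI)
  fix K :: "'a set" assume "compact K"
  then have "integrable lebesgue (\<lambda>x. indicator K x *\<^sub>R f x)"
    using assms by (auto simp: locally_integrable_def set_integrable_def)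
  then have "integrable lebesgue (\<lambda>x. (indicator K x *\<^sub>R f x) \<bullet> v)" by (intro integrable_inner_left)
  then show "set_integrable lebesgue K (\<lambda>x. f x \<bullet> v)" by (simp add: set_integrable_def)
qed

lemma mollify_diff:
  assumes "locally_integrable lebesgue f" "locally_integrable lebesgue g"
  shows "mollify n (\<lambda>x. f x - g x) x = mollify n f x - mollify n g x"
  unfolding mollify_def
  using integrable_mollifier_mult[OF assms(1)] integrable_mollifier_mult[OF assms(2)]
  by (simp add: scaleR_diff_right)

lemma mollify_add:
  assumes "locally_integrable lebesgue f" "locally_integrable lebesgue g"
  shows "mollify n (\<lambda>x. f x + g x) x = mollify n f x + mollify n g x"
  unfolding mollify_def
  using integrable_mollifier_mult[OF assms(1)] integrable_mollifier_mult[OF assms(2)]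
  by (simp add: scaleR_add_right)

text \<open>\<open>convolution_continuous\<close> takes a scalar \<open>u\<close>, so vector-valued
  functions are treated coordinatewise.\<close>

lemma mollify_continuous:
  fixes f :: "'a::euclidean_space \<Rightarrow> 'b::euclidean_space"
  assumes "locally_integrable lebesgue f"
  shows "continuous_on S (mollify n f)"
proof -
  have "continuous_on UNIV (\<lambda>x. mollify n f x \<bullet> i)" for i
    using convolution_continuous[OF locally_integrable_inner[OF assms, of i] mollifier_continuous[of UNIV n] mollifier_eq_0'[of _ n]]
    unfolding mollify_inner[OF assms] unfolding mollify_def by (simp add: mult.commute)
  then have "continuous_on UNIV (\<lambda>x. \<Sum>i\<in>Basis. (mollify n f x \<bullet> i) *\<^sub>R i)"
    by (intro continuous_on_sum continuous_on_scaleR continuous_on_const)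
  then have "continuous_on UNIV (mollify n f)"
    by (simp only: euclidean_representation)
  then show ?thesis
    using continuous_on_subset by blast
qed

lemma mollify_measurable:
  fixes f :: "'a::euclidean_space \<Rightarrow> 'b::euclidean_space"
  assumes "locally_integrable lebesgue f"
  shows "mollify n f \<in> borel_measurable lebesgue"
  by (rule continuous_borel_measurable_lebesgue[OF mollify_continuous[OF assms]])

section \<open>Contraction and convergence of mollification in \<open>L^1\<close>\<close>

lemma nn_integral_mollify_le:
  fixes f :: "'a::euclidean_space \<Rightarrow> 'b::euclidean_space"
  assumes f: "integrable lebesgue f"
  shows "(\<integral>\<^sup>+ x. ennreal (norm (mollify n f x)) \<partial>lebesgue) \<le> (\<integral>\<^sup>+ x. ennreal (norm (f x)) \<partial>lebesgue)"
proof -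
  have "ennreal (norm (mollify n f x)) \<le> (\<integral>\<^sup>+ y. ennreal (mollifier n (x - y)) * ennreal (norm (f y)) \<partial>lebesgue)" for x
  proof -
    have i: "integrable lebesgue (\<lambda>y. mollifier n (x - y) *\<^sub>R f y)"
      by (rule integrable_mollifier_mult[OF locally_integrableI_integrable[OF f]])
    have "ennreal (norm (mollify n f x)) \<le> (\<integral>\<^sup>+ y. ennreal (norm (mollifier n (x - y) *\<^sub>R f y)) \<partial>lebesgue)"
      unfolding mollify_def by (rule integral_norm_bound_ennreal[OF i])
    then show ?thesis
      by (simp add: ennreal_mult' mollifier_nonneg)
  qed
  then have "(\<integral>\<^sup>+ x. ennreal (norm (mollify n f x)) \<partial>lebesgue) \<le>
    (\<integral>\<^sup>+ x. (\<integral>\<^sup>+ y. ennreal (mollifier n (x - y)) * ennreal (norm (f y)) \<partial>lebesgue) \<partial>lebesgue)"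
    by (intro nn_integral_mono) auto
  also have "\<dots> = (\<integral>\<^sup>+ x. ennreal (norm (f x)) \<partial>lebesgue)"
    by (rule nn_integral_mollifier_convolution) (use f in auto)
  finally show ?thesis .
qed

lemma mollify_integrable:
  fixes f :: "'a::euclidean_space \<Rightarrow> 'b::euclidean_space"
  assumes f: "integrable lebesgue f"
  shows "integrable lebesgue (mollify n f)"
  using mollify_measurable[OF locally_integrableI_integrable[OF f]] nn_integral_mollify_le[OF f, of n] f
  unfolding integrable_iff_bounded by (auto intro: le_less_trans)

lemma integral_norm_mollify_le:
  fixes f :: "'a::euclidean_space \<Rightarrow> 'b::euclidean_space"
  assumes f: "integrable lebesgue f"
  shows "(LINT x|lebesgue. norm (mollify n f x)) \<le> (LINT x|lebesgue. norm (f x))"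
proof -
  have "ennreal (LINT x|lebesgue. norm (mollify n f x)) \<le> ennreal (LINT x|lebesgue. norm (f x))"
    using nn_integral_mollify_le[OF f, of n] f mollify_integrable[OF f]
    by (simp add: nn_integral_eq_integral)
  then show ?thesis
    by (subst (asm) ennreal_le_iff) (auto intro: integral_nonneg_AE)
qed

text \<open>At each point of an open set the mollified indicator \<open>w n\<close> is eventually
  equal to 1, and mollification preserves total mass; the mass leaking out of \<open>U\<close> is
  therefore exactly the deficit inside, and the deficit tends to zero.\<close>

lemma mollify_tendsto_open:
  assumes U: "open U" "emeasure lebesgue (U :: 'a::euclidean_space set) < \<infinity>"
  shows "(\<lambda>n. LINT x|lebesgue. norm (mollify n (\<lambda>y. indicat_real U y *\<^sub>R (c::'b::euclidean_space)) x - indicator U x *\<^sub>R c)) \<longlonglongrightarrow> 0"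
proof -
  have Us: "U \<in> sets lebesgue" using U by auto
  have Ui: "integrable lebesgue (indicat_real U)"
    using U(2) Us integrable_real_indicator by blast
  define w where "w = (\<lambda>n. mollify n (indicat_real U))"
  have eq: "mollify n (\<lambda>y. indicat_real U y *\<^sub>R c) x = w n x *\<^sub>R c" for n x
    unfolding w_def mollify_def using integral_scaleR_left[of c lebesgue "\<lambda>y. mollifier n (x - y) * indicator U y"]
      integrable_mollifier_mult[OF locally_integrableI_integrable[OF Ui], of n x] by auto
  have wi: "integrable lebesgue (w n)" for n
    unfolding w_def by (rule mollify_integrable[OF Ui])
  have w0: "w n x \<ge> 0" for n x
    unfolding w_def by (rule mollify_nonneg) simp
  have int1: "(LINT y|lebesgue. mollifier n (x - y)) = 1" for n and x :: 'a
  proof -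
    have "(\<integral>\<^sup>+ y. ennreal (mollifier n (x - y)) \<partial>lebesgue) = 1"
      unfolding nn_integral_completion mollifier_minus[of n x] by (rule nn_integral_mollifier_shift)
    then show ?thesis
      by (intro integral_eq_nn_integral[THEN trans])
        (auto simp: mollifier_nonneg intro!: continuous_borel_measurable_lebesgue continuous_on_compose2[OF mollifier_continuous[of UNIV]] continuous_intros)
  qed
  have ki: "integrable lebesgue (\<lambda>y. mollifier n (x - y))" for n and x :: 'a
    using int1[of n x] not_integrable_integral_eq by fastforce
  have w1: "w n x \<le> 1" for n x
  proof -
    have "w n x \<le> (LINT y|lebesgue. mollifier n (x - y))"
      unfolding w_def mollify_def
      by (rule Bochner_Integration.integral_mono[OF integrable_mollifier_mult[OF locally_integrableI_integrable[OF Ui]] ki])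
        (auto simp: indicator_def mollifier_nonneg)
    then show ?thesis by (simp add: int1)
  qed
  have wint: "integral\<^sup>L lebesgue (w n) = integral\<^sup>L lebesgue (indicator U)" for n
  proof -
    have e: "ennreal (w n x) = (\<integral>\<^sup>+ y. ennreal (mollifier n (x - y)) * ennreal (indicator U y) \<partial>lebesgue)" for x
      unfolding w_def mollify_def
      using nn_integral_eq_integral[OF integrable_mollifier_mult[OF locally_integrableI_integrable[OF Ui], of n x]]
      by (simp add: mollifier_nonneg ennreal_mult')
    have "(\<integral>\<^sup>+ x. ennreal (w n x) \<partial>lebesgue) = (\<integral>\<^sup>+ x. ennreal (indicator U x) \<partial>lebesgue)"
      unfolding e by (rule nn_integral_mollifier_convolution) (use Ui in auto)
    then show ?thesis
      using nn_integral_eq_integral[OF wi[of n]] nn_integral_eq_integral[OF Ui] w0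
      by (simp add: integral_nonneg_AE)
  qed
  have "(\<lambda>n. LINT x|lebesgue. indicator U x * (1 - w n x)) \<longlonglongrightarrow> integral\<^sup>L lebesgue (\<lambda>x::'a. 0 :: real)"
  proof (rule integral_dominated_convergence[where w="indicator U"])
    show "AE x in lebesgue. (\<lambda>n. indicat_real U x * (1 - w n x)) \<longlonglongrightarrow> 0"
    proof (intro AE_I2)
      fix x
      show "(\<lambda>n. indicat_real U x * (1 - w n x)) \<longlonglongrightarrow> 0"
      proof (cases "x \<in> U")
        case True
        then obtain e where e: "e > 0" "ball x e \<subseteq> U"
          using U(1) open_contains_ball by blast
        obtain m where m: "1 / real (Suc m) < e" using e(1) nat_approx_posE by blast
        have "w n x = 1" if "n \<ge> m" for n
        proof -
          have "mollifier n (x - y) *\<^sub>R indicat_real U y = mollifier n (x - y)" for y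
          proof (cases "norm (x - y) < 1 / real (Suc n)")
            case True
            also have "1 / real (Suc n) \<le> 1 / real (Suc m)" using that by (simp add: field_simps)
            also note m
            finally have "y \<in> U" using e by (auto simp: dist_norm)
            then show ?thesis by simp
          next
            case False
            then show ?thesis using mollifier_eq_0[of n "x - y"] by simp
          qed
          then show ?thesis unfolding w_def mollify_def by (simp only: int1)
        qed
        then have "\<forall>\<^sub>F n in sequentially. indicat_real U x * (1 - w n x) = 0"
          unfolding eventually_sequentially by auto
        then show ?thesis by (rule tendsto_eventually)
      qed simp
    qed
    show "AE x in lebesgue. norm (indicat_real U x * (1 - w n x)) \<le> indicat_real U x" for n
      using w0[of n] w1[of n] by (auto simp: indicator_def)
  qed (use Ui wi in auto)
  then have lim: "(\<lambda>n. LINT x|lebesgue. indicator U x * (1 - w n x)) \<longlonglongrightarrow> 0" by simp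
  have "(LINT x|lebesgue. \<bar>w n x - indicator U x\<bar>) = 2 * (LINT x|lebesgue. indicator U x * (1 - w n x))" for n
  proof -
    have i: "integrable lebesgue (\<lambda>x. indicator U x * (1 - w n x))"
    proof (rule Bochner_Integration.integrable_bound[OF Ui])
      show "(\<lambda>x. indicator U x * (1 - w n x)) \<in> borel_measurable lebesgue"
        using Ui wi[of n] by (intro borel_measurable_times borel_measurable_diff) auto
    qed (use w0[of n] w1[of n] in \<open>auto simp: indicator_def\<close>)
    \<comment> \<open>Valid because \<open>0 \<le> w n \<le> 1\<close>. The first bracket on the
      right integrates to zero by \<open>wint\<close>, which leaves twice the deficit inside
      \<open>U\<close>.\<close>
    have "(LINT x|lebesgue. \<bar>w n x - indicator U x\<bar>) = (LINT x|lebesgue. (w n x - indicator U x) + 2 * (indicator U x * (1 - w n x)))"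
      using w0[of n] w1[of n] by (intro Bochner_Integration.integral_cong) (auto simp: indicator_def)
    also have "\<dots> = 2 * (LINT x|lebesgue. indicator U x * (1 - w n x))"
      using wi[of n] Ui i wint[of n] by simp
    finally show ?thesis .
  qed
  then have "(\<lambda>n. LINT x|lebesgue. \<bar>w n x - indicator U x\<bar>) \<longlonglongrightarrow> 0"
    using tendsto_mult_left[OF lim, of 2] by simp
  from tendsto_mult_left[OF this, of "norm c"]
  show ?thesis
    unfolding eq scaleR_diff_left[symmetric] norm_scaleR by (simp add: mult.commute)
qed

text \<open>Three-epsilon argument: since mollification does not increase the \<open>L^1\<close>
  norm, the functions with the asserted convergence form a closed subset of
  \<open>L^1\<close>.\<close>

lemma mollify_tendsto_L1_approx:
  fixes f :: "'a::euclidean_space \<Rightarrow> 'b::euclidean_space"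
  assumes f: "integrable lebesgue f"
    and approx: "\<And>e. e > 0 \<Longrightarrow> \<exists>g. integrable lebesgue g \<and>
      (\<lambda>n. LINT x|lebesgue. norm (mollify n g x - g x)) \<longlonglongrightarrow> 0 \<and> (LINT x|lebesgue. norm (f x - g x)) < e"
  shows "(\<lambda>n. LINT x|lebesgue. norm (mollify n f x - f x)) \<longlonglongrightarrow> 0"
proof (rule tendstoI)
  fix e :: real assume "e > 0"
  then obtain g where g: "integrable lebesgue g"
      "(\<lambda>n. LINT x|lebesgue. norm (mollify n g x - g x)) \<longlonglongrightarrow> 0" "(LINT x|lebesgue. norm (f x - g x)) < e / 3"
    using approx[of "e / 3"] by auto
  have fg: "integrable lebesgue (\<lambda>x. f x - g x)" using f g by auto
  have "\<forall>\<^sub>F n in sequentially. dist (LINT x|lebesgue. norm (mollify n g x - g x)) 0 < e / 3"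
    using tendstoD[OF g(2), of "e / 3"] \<open>e > 0\<close> by auto
  then show "\<forall>\<^sub>F n in sequentially. dist (LINT x|lebesgue. norm (mollify n f x - f x)) 0 < e"
  proof eventually_elim
    fix n
    assume "dist (LINT x|lebesgue. norm (mollify n g x - g x)) 0 < e / 3"
    then have a: "(LINT x|lebesgue. norm (mollify n g x - g x)) < e / 3" by (auto simp: dist_norm)
    have "(LINT x|lebesgue. norm (mollify n f x - f x)) \<le>
      (LINT x|lebesgue. norm (mollify n (\<lambda>x. f x - g x) x) + norm (mollify n g x - g x) + norm (f x - g x))"
    proof (rule Bochner_Integration.integral_mono)
      show "integrable lebesgue (\<lambda>x. norm (mollify n f x - f x))"
        using f mollify_integrable[OF f] by auto
      show "integrable lebesgue (\<lambda>x. norm (mollify n (\<lambda>x. f x - g x) x) + norm (mollify n g x - g x) + norm (f x - g x))"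
        using f g(1) mollify_integrable[OF g(1)] mollify_integrable[OF fg] by auto
      fix x
      have "mollify n f x - f x = mollify n (\<lambda>x. f x - g x) x + (mollify n g x - g x) + (g x - f x)"
        using mollify_diff[OF locally_integrableI_integrable[OF f] locally_integrableI_integrable[OF g(1)]] by simp
      then show "norm (mollify n f x - f x) \<le> norm (mollify n (\<lambda>x. f x - g x) x) + norm (mollify n g x - g x) + norm (f x - g x)"
        using norm_triangle_ineq[of "mollify n (\<lambda>x. f x - g x) x + (mollify n g x - g x)" "g x - f x"]
          norm_triangle_ineq[of "mollify n (\<lambda>x. f x - g x) x" "mollify n g x - g x"] norm_minus_commute[of "f x" "g x"]
        by simp
    qed
    also have "\<dots> = (LINT x|lebesgue. norm (mollify n (\<lambda>x. f x - g x) x)) + (LINT x|lebesgue. norm (mollify n g x - g x)) + (LINT x|lebesgue. norm (f x - g x))"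
      using f g(1) mollify_integrable[OF g(1)] mollify_integrable[OF fg] by simp
    also have "\<dots> < e" using integral_norm_mollify_le[OF fg, of n] a g(3) by simp
    finally have "(LINT x|lebesgue. norm (mollify n f x - f x)) < e" .
    then show "dist (LINT x|lebesgue. norm (mollify n f x - f x)) 0 < e"
      by (simp add: dist_norm integral_nonneg_AE)
  qed
qed

text \<open>Induction on integrable functions: indicators are approximated from outside by open
  sets, for which the convergence is explicit, and closedness in \<open>L^1\<close> does the
  rest.\<close>

lemma mollify_tendsto_L1:
  fixes f :: "'a::euclidean_space \<Rightarrow> 'b::euclidean_space"
  assumes "integrable lebesgue f"
  shows "(\<lambda>n. LINT x|lebesgue. norm (mollify n f x - f x)) \<longlonglongrightarrow> 0"
  using assms
proof (induction rule: integrable_induct)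
  case (base A c)
  have i: "integrable lebesgue (\<lambda>x. indicat_real A x *\<^sub>R c)" using base by auto
  show ?case
  proof (rule mollify_tendsto_L1_approx[OF i])
    fix e :: real assume "e > 0"
    \<comment> \<open>The error is \<open>norm c\<close> times the measure of \<open>U - A\<close>;
      adding 1 to the denominator covers \<open>c = 0\<close>.\<close>
    define e' where "e' = e / (norm c + 1)"
    have e': "e' > 0" "e' * norm c < e"
    proof -
      show "e' > 0" using \<open>e > 0\<close> unfolding e'_def by (intro divide_pos_pos) (auto intro: add_nonneg_pos)
      have "e' * norm c < e' * (norm c + 1)" using \<open>e' > 0\<close> by simp
      also have "\<dots> = e" unfolding e'_def using norm_ge_zero[of c] by (simp add: add_nonneg_eq_0_iff)
      finally show "e' * norm c < e" .
    qed
    obtain U where U: "open U" "A \<subseteq> U" "U - A \<in> lmeasurable" "emeasure lebesgue (U - A) < ennreal e'"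
      using sets_lebesgue_outer_open[OF base(1) e'(1)] by metis
    have "emeasure lebesgue U = emeasure lebesgue A + emeasure lebesgue (U - A)"
      using plus_emeasure[of A lebesgue "U - A"] base(1) U by (auto simp: Un_absorb1 fmeasurable_def)
    also have "\<dots> < \<infinity>" using base(2) U(3) by (auto simp: fmeasurable_def)
    finally have fU: "emeasure lebesgue U < \<infinity>" .
    have Us: "U \<in> sets lebesgue" using U by auto
    show "\<exists>g. integrable lebesgue g \<and>
      (\<lambda>n. LINT x|lebesgue. norm (mollify n g x - g x)) \<longlonglongrightarrow> 0 \<and>
      (LINT x|lebesgue. norm (indicat_real A x *\<^sub>R c - g x)) < e"
    proof (intro exI conjI)
      show "integrable lebesgue (\<lambda>x. indicat_real U x *\<^sub>R c)" using fU Us by auto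
      show "(\<lambda>n. LINT x|lebesgue. norm (mollify n (\<lambda>x. indicat_real U x *\<^sub>R c) x - indicat_real U x *\<^sub>R c)) \<longlonglongrightarrow> 0"
        by (rule mollify_tendsto_open[OF U(1) fU])
      have "(LINT x|lebesgue. norm (indicat_real A x *\<^sub>R c - indicat_real U x *\<^sub>R c)) = (LINT x|lebesgue. indicat_real (U - A) x * norm c)"
        using U(2) by (intro Bochner_Integration.integral_cong) (auto simp: indicator_def)
      also have "\<dots> = measure lebesgue (U - A) * norm c"
        using U(3) by (simp add: fmeasurableD)
      also have "\<dots> \<le> e' * norm c"
        using U(3,4) e' by (intro mult_right_mono) (auto simp: emeasure_eq_measure2 ennreal_less_iff)
      finally show "(LINT x|lebesgue. norm (indicat_real A x *\<^sub>R c - indicat_real U x *\<^sub>R c)) < e" using e' by simp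
    qed
  qed
next
  case (add f g)
  show ?case
  proof (rule Lim_null_comparison[OF _ tendsto_add_zero[OF add.IH]], intro always_eventually allI)
    fix n
    have "(LINT x|lebesgue. norm (mollify n (\<lambda>x. f x + g x) x - (f x + g x))) \<le>
      (LINT x|lebesgue. norm (mollify n f x - f x) + norm (mollify n g x - g x))"
    proof (rule Bochner_Integration.integral_mono)
      have fg: "integrable lebesgue (\<lambda>x. f x + g x)" using add by auto
      show "integrable lebesgue (\<lambda>x. norm (mollify n (\<lambda>x. f x + g x) x - (f x + g x)))"
        using fg mollify_integrable[OF fg] by auto
      show "integrable lebesgue (\<lambda>x. norm (mollify n f x - f x) + norm (mollify n g x - g x))"
        using add mollify_integrable[OF add(1)] mollify_integrable[OF add(2)] by auto
      fix x
      have "mollify n (\<lambda>x. f x + g x) x - (f x + g x) = (mollify n f x - f x) + (mollify n g x - g x)"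
        using mollify_add[OF locally_integrableI_integrable[OF add(1)] locally_integrableI_integrable[OF add(2)]] by simp
      then show "norm (mollify n (\<lambda>x. f x + g x) x - (f x + g x)) \<le> norm (mollify n f x - f x) + norm (mollify n g x - g x)"
        by (metis norm_triangle_ineq)
    qed
    also have "\<dots> = (LINT x|lebesgue. norm (mollify n f x - f x)) + (LINT x|lebesgue. norm (mollify n g x - g x))"
      using add mollify_integrable[OF add(1)] mollify_integrable[OF add(2)] by simp
    finally show "norm (LINT x|lebesgue. norm (mollify n (\<lambda>x. f x + g x) x - (f x + g x))) \<le>
        (LINT x|lebesgue. norm (mollify n f x - f x)) + (LINT x|lebesgue. norm (mollify n g x - g x))"
      by (simp add: integral_nonneg_AE)
  qed
next
  case (lim f s)
  show ?case
  proof (rule mollify_tendsto_L1_approx[OF lim.hyps(4)])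
    fix e :: real assume "e > 0"
    have "(\<lambda>i. LINT x|lebesgue. norm (f x - s i x)) \<longlonglongrightarrow> integral\<^sup>L lebesgue (\<lambda>x::'a. 0 :: real)"
    \<comment> \<open>The approximants are bounded by \<open>2 * norm (f x)\<close>, hence the
      factor 3.\<close>
    proof (rule integral_dominated_convergence[where w="\<lambda>x. 3 * norm (f x)"])
      show "AE x in lebesgue. (\<lambda>i. norm (f x - s i x)) \<longlonglongrightarrow> 0"
      proof (intro AE_I2 tendsto_norm_zero)
        fix x :: 'a
        show "(\<lambda>i. f x - s i x) \<longlonglongrightarrow> 0"
          using tendsto_diff[OF tendsto_const[of "f x"] lim.hyps(2)[of x]] by simp
      qed
      show "AE x in lebesgue. norm (norm (f x - s i x)) \<le> 3 * norm (f x)" for i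
        using lim.hyps(3)[of _ i] by (intro AE_I2) (smt (verit) norm_triangle_ineq4 UNIV_I norm_ge_zero real_norm_def space_completion space_lborel)
    qed (use lim.hyps in auto)
    then have "\<forall>\<^sub>F i in sequentially. (LINT x|lebesgue. norm (f x - s i x)) < e"
      using order_tendstoD(2)[of _ 0 sequentially e] \<open>e > 0\<close> by auto
    then obtain i where "(LINT x|lebesgue. norm (f x - s i x)) < e"
      by (auto simp: eventually_sequentially)
    then show "\<exists>g. integrable lebesgue g \<and>
      (\<lambda>n. LINT x|lebesgue. norm (mollify n g x - g x)) \<longlonglongrightarrow> 0 \<and> (LINT x|lebesgue. norm (f x - g x)) < e"
      using lim.hyps(1) lim.IH by blast
  qed
qed

text \<open>The kernels have radius at most 1, so on \<open>K\<close> only the restriction of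
  \<open>f\<close> to the unit neighbourhood of \<open>K\<close> matters, and that restriction is
  integrable.\<close>

lemma mollify_tendsto_L1_local:
  fixes f :: "'a::euclidean_space \<Rightarrow> 'b::euclidean_space"
  assumes f: "locally_integrable lebesgue f" and K: "compact K"
  shows "(\<lambda>n. LINT x|lebesgue. norm (indicator K x *\<^sub>R (mollify n f x - f x))) \<longlonglongrightarrow> 0"
proof -
  define K' where "K' = (\<Union>x\<in>K. \<Union>y\<in>cball 0 1. {x - y})"
  have K': "compact K'" unfolding K'_def by (rule compact_UN_differences[OF K]) simp
  have sub: "y \<in> K'" if "x \<in> K" "norm (x - y) \<le> 1" for x y
    unfolding K'_def using that by (force intro: bexI[of _ x] bexI[of _ "x - y"])
  define g where "g = (\<lambda>x. indicator K' x *\<^sub>R f x)"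
  have g: "integrable lebesgue g"
    using f K' by (auto simp: g_def locally_integrable_def set_integrable_def)
  have eq: "mollify n f x = mollify n g x" if "x \<in> K" for n x
    unfolding mollify_def g_def
  proof (rule Bochner_Integration.integral_cong)
    fix y
    show "mollifier n (x - y) *\<^sub>R f y = mollifier n (x - y) *\<^sub>R indicat_real K' y *\<^sub>R f y"
      using sub[OF that, of y] mollifier_eq_0'[of "x - y" n] by (cases "norm (x - y) \<le> 1") auto
  qed simp
  have eq2: "f x = g x" if "x \<in> K" for x
    using sub[OF that, of x] by (simp add: g_def)
  show ?thesis
  proof (rule Lim_null_comparison[OF _ mollify_tendsto_L1[OF g]], intro always_eventually allI)
    fix n
    have i: "integrable lebesgue (\<lambda>x. mollify n g x - g x)" using g mollify_integrable[OF g] by auto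
    have "(LINT x|lebesgue. norm (indicat_real K x *\<^sub>R (mollify n f x - f x)))
      = (LINT x|lebesgue. norm (indicat_real K x *\<^sub>R (mollify n g x - g x)))"
      by (rule Bochner_Integration.integral_cong) (auto simp: indicator_def eq eq2)
    also have "\<dots> \<le> (LINT x|lebesgue. norm (mollify n g x - g x))"
    proof (rule Bochner_Integration.integral_mono)
      show "integrable lebesgue (\<lambda>x. norm (indicat_real K x *\<^sub>R (mollify n g x - g x)))"
        using K by (intro integrable_norm integrable_mult_indicator i fmeasurableD[OF lmeasurable_compact])
    qed (use i in \<open>auto simp: indicator_def\<close>)
    finally show "norm (LINT x|lebesgue. norm (indicat_real K x *\<^sub>R (mollify n f x - f x))) \<le> (LINT x|lebesgue. norm (mollify n g x - g x))"
      by (simp add: integral_nonneg_AE)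
  qed
qed

text \<open>The given sequence \<open>r\<close> lets extractions be nested, so that one subsequence
  can serve several functions.\<close>

lemma mollify_AE_subseq:
  fixes f :: "'a::euclidean_space \<Rightarrow> 'b::euclidean_space"
  assumes f: "locally_integrable lebesgue f" and K: "compact K" and r: "strict_mono (r::nat\<Rightarrow>nat)"
  obtains s where "strict_mono (s::nat\<Rightarrow>nat)" "AE x in lebesgue. x \<in> K \<longrightarrow> (\<lambda>n. mollify (r (s n)) f x) \<longlonglongrightarrow> f x"
proof -
  let ?u = "\<lambda>n x. indicat_real K x *\<^sub>R (mollify (r n) f x - f x)"
  have "integrable lebesgue (?u n)" for n
  proof -
    have "integrable lebesgue (\<lambda>x. indicator K x *\<^sub>R mollify (r n) f x)"
      using borel_integrable_compact[OF K mollify_continuous[OF f], of "r n"]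
      by (auto simp: integrable_completion indicator_scaleR_eq_if)
    moreover have "integrable lebesgue (\<lambda>x. indicator K x *\<^sub>R f x)"
      using f K by (auto simp: locally_integrable_def set_integrable_def)
    ultimately show ?thesis by (simp add: scaleR_diff_right)
  qed
  moreover have "(\<lambda>n. LINT x|lebesgue. norm (?u n x)) \<longlonglongrightarrow> 0"
    using LIMSEQ_subseq_LIMSEQ[OF mollify_tendsto_L1_local[OF f K] r] by (simp add: comp_def)
  ultimately obtain s where s: "strict_mono (s::nat\<Rightarrow>nat)" "AE x in lebesgue. (\<lambda>n. ?u (s n) x) \<longlonglongrightarrow> 0"
    using tendsto_L1_AE_subseq[of lebesgue ?u] by auto
  show ?thesis
  proof (rule that[OF s(1)])
    show "AE x in lebesgue. x \<in> K \<longrightarrow> (\<lambda>n. mollify (r (s n)) f x) \<longlonglongrightarrow> f x"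
      using s(2) by (elim eventually_mono) (auto simp: LIM_zero_iff)
  qed
qed

text \<open>The limit theorem behind the sufficiency part: bounded coefficients that converge almost
  everywhere are paired with mollifications that converge only in local \<open>L^1\<close>. The
  pairing is split into the one with \<open>mollify (r n) f - f\<close>, small in
  \<open>L^1\<close>, and the one with \<open>f\<close>, dominated by \<open>B\<close> times
  \<open>|f|\<close>.\<close>

lemma tendsto_integral_mollify:
  fixes f b :: "'a::euclidean_space \<Rightarrow> 'b::euclidean_space"
  assumes f: "locally_integrable lebesgue f" and K: "compact K" and r: "strict_mono (r::nat\<Rightarrow>nat)"
    and bn: "\<And>n. c n \<in> borel_measurable lebesgue" "\<And>n x. norm (c n x) \<le> B" "\<And>n x. x \<notin> K \<Longrightarrow> c n x = 0"
    and lim: "AE x in lebesgue. (\<lambda>n. c n x) \<longlonglongrightarrow> b x"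
    and b: "b \<in> borel_measurable lebesgue"
  shows "(\<lambda>n. LINT x|lebesgue. c n x \<bullet> mollify (r n) f x) \<longlonglongrightarrow> (LINT x|lebesgue. b x \<bullet> f x)"
proof -
  have B: "B \<ge> 0" using order_trans[OF norm_ge_zero bn(2)] by blast
  have mi: "integrable lebesgue (\<lambda>x. indicator K x *\<^sub>R (mollify n f x - f x))" for n
  proof -
    have "integrable lebesgue (\<lambda>x. indicator K x *\<^sub>R mollify n f x)"
      using borel_integrable_compact[OF K mollify_continuous[OF f], of "n"]
      by (auto simp: integrable_completion indicator_scaleR_eq_if)
    moreover have "integrable lebesgue (\<lambda>x. indicator K x *\<^sub>R f x)"
      using f K by (auto simp: locally_integrable_def set_integrable_def)
    ultimately show ?thesis by (simp add: scaleR_diff_right)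
  qed
  have mB: "integrable lebesgue (\<lambda>x. B * norm (indicator K x *\<^sub>R (mollify n f x - f x)))" for n
    by (intro integrable_mult_right integrable_norm mi)
  have fi: "integrable lebesgue (\<lambda>x. c n x \<bullet> f x)" for n
    by (rule locally_integrable_mult_bounded_inner[OF f bn(1) K bn(3) bn(2)])
  have di: "integrable lebesgue (\<lambda>x. c n x \<bullet> (mollify (r n) f x - f x))"
    and bd: "norm (c n x \<bullet> (mollify (r n) f x - f x)) \<le> B * norm (indicat_real K x *\<^sub>R (mollify (r n) f x - f x))" for n x
  proof -
    show bd: "norm (c n x \<bullet> (mollify (r n) f x - f x)) \<le> B * norm (indicat_real K x *\<^sub>R (mollify (r n) f x - f x))" for x
    proof (cases "x \<in> K")
      case True
      have "norm (c n x \<bullet> (mollify (r n) f x - f x)) \<le> norm (c n x) * norm (mollify (r n) f x - f x)"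
        by (simp add: Cauchy_Schwarz_ineq2)
      also have "\<dots> \<le> B * norm (mollify (r n) f x - f x)" using bn(2) by (intro mult_right_mono) auto
      finally show ?thesis using True by simp
    qed (use bn(3) in auto)
    show "integrable lebesgue (\<lambda>x. c n x \<bullet> (mollify (r n) f x - f x))"
      by (rule Bochner_Integration.integrable_bound[OF mB[of "r n"]])
        (use bd bn(1)[of n] mollify_measurable[OF f, of "r n"] locally_integrable_measurable[OF f] B in \<open>auto simp: abs_mult intro: order_trans\<close>)
  qed
  have 1: "(\<lambda>n. LINT x|lebesgue. c n x \<bullet> (mollify (r n) f x - f x)) \<longlonglongrightarrow> 0"
  proof (rule Lim_null_comparison)
    show "\<forall>\<^sub>F n in sequentially. norm (LINT x|lebesgue. c n x \<bullet> (mollify (r n) f x - f x)) \<le>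
      B * (LINT x|lebesgue. norm (indicat_real K x *\<^sub>R (mollify (r n) f x - f x)))"
    proof (intro always_eventually allI)
      fix n
      have "norm (LINT x|lebesgue. c n x \<bullet> (mollify (r n) f x - f x)) \<le> (LINT x|lebesgue. B * norm (indicat_real K x *\<^sub>R (mollify (r n) f x - f x)))"
        by (rule Bochner_Integration.integral_norm_bound_integral[OF di mB bd])
      then show "norm (LINT x|lebesgue. c n x \<bullet> (mollify (r n) f x - f x)) \<le>
      B * (LINT x|lebesgue. norm (indicat_real K x *\<^sub>R (mollify (r n) f x - f x)))" by simp
    qed
    show "(\<lambda>n. B * (LINT x|lebesgue. norm (indicat_real K x *\<^sub>R (mollify (r n) f x - f x)))) \<longlonglongrightarrow> 0"
      using tendsto_mult_left[OF LIMSEQ_subseq_LIMSEQ[OF mollify_tendsto_L1_local[OF f K] r], of B] by (simp add: comp_def)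
  qed
  have 2: "(\<lambda>n. LINT x|lebesgue. c n x \<bullet> f x) \<longlonglongrightarrow> (LINT x|lebesgue. b x \<bullet> f x)"
  proof (rule integral_dominated_convergence[where w="\<lambda>x. B * norm (indicat_real K x *\<^sub>R f x)"])
    show "AE x in lebesgue. (\<lambda>n. c n x \<bullet> f x) \<longlonglongrightarrow> b x \<bullet> f x"
      using lim by (elim eventually_mono) (intro tendsto_intros)
    show "AE x in lebesgue. norm (c n x \<bullet> f x) \<le> B * norm (indicat_real K x *\<^sub>R f x)" for n
    proof (intro AE_I2)
      fix x
      show "norm (c n x \<bullet> f x) \<le> B * norm (indicat_real K x *\<^sub>R f x)"
      proof (cases "x \<in> K")
        case True
        have "norm (c n x \<bullet> f x) \<le> norm (c n x) * norm (f x)"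
          by (simp add: Cauchy_Schwarz_ineq2)
        also have "\<dots> \<le> B * norm (f x)" using bn(2) by (intro mult_right_mono) auto
        finally show ?thesis using True by simp
      qed (use bn(3) in auto)
    qed
    show "integrable lebesgue (\<lambda>x. B * norm (indicat_real K x *\<^sub>R f x))"
      using f K unfolding locally_integrable_def set_integrable_def
      by (intro integrable_mult_right integrable_norm) simp
  qed (use b bn(1) locally_integrable_measurable[OF f] in auto)
  have "(LINT x|lebesgue. c n x \<bullet> mollify (r n) f x) =
    (LINT x|lebesgue. c n x \<bullet> (mollify (r n) f x - f x)) + (LINT x|lebesgue. c n x \<bullet> f x)" for n
    using Bochner_Integration.integral_add[OF di[of n] fi[of n]] by (simp add: inner_diff_right)
  then show ?thesis using tendsto_add[OF 1 2] by simp
qed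

subsection \<open>Weak gradients\<close>

lemma locally_integrable_bound:
  fixes f :: "'a::euclidean_space \<Rightarrow> 'b::euclidean_space" and g :: "'a \<Rightarrow> real"
  assumes "locally_integrable lebesgue g" "f \<in> borel_measurable lebesgue" "\<And>x. norm (f x) \<le> g x"
  shows "locally_integrable lebesgue f"
  unfolding locally_integrable_def set_integrable_def
proof (intro allI impI)
  fix K :: "'a set" assume K: "compact K"
  show "integrable lebesgue (\<lambda>x. indicat_real K x *\<^sub>R f x)"
  proof (rule Bochner_Integration.integrable_bound)
    show "integrable lebesgue (\<lambda>x. indicat_real K x *\<^sub>R g x)"
      using assms(1) K by (simp add: locally_integrable_def set_integrable_def)
    show "(\<lambda>x. indicat_real K x *\<^sub>R f x) \<in> borel_measurable lebesgue"
      using assms(2) fmeasurableD[OF lmeasurable_compact[OF K]] by measurable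
    show "AE x in lebesgue. norm (indicat_real K x *\<^sub>R f x) \<le> norm (indicat_real K x *\<^sub>R g x)"
      using order_trans[OF assms(3) abs_ge_self] by (intro AE_I2) (auto simp: indicator_def)
  qed
qed

lemma locally_integrable_add:
  fixes f g :: "'a::euclidean_space \<Rightarrow> 'b::euclidean_space"
  assumes "locally_integrable lebesgue f" "locally_integrable lebesgue g"
  shows "locally_integrable lebesgue (\<lambda>x. f x + g x)"
  using assms unfolding locally_integrable_def set_integrable_def
  by (simp add: scaleR_add_right)

lemma locally_integrable_diff:
  fixes f g :: "'a::euclidean_space \<Rightarrow> 'b::euclidean_space"
  assumes "locally_integrable lebesgue f" "locally_integrable lebesgue g"
  shows "locally_integrable lebesgue (\<lambda>x. f x - g x)"
  using assms unfolding locally_integrable_def set_integrable_def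
  by (simp add: scaleR_diff_right)

lemma locally_integrable_continuous:
  fixes f :: "'a::euclidean_space \<Rightarrow> 'b::euclidean_space"
  assumes "continuous_on UNIV f"
  shows "locally_integrable lebesgue f"
  unfolding locally_integrable_def set_integrable_def
proof (intro allI impI)
  fix K :: "'a set" assume K: "compact K"
  obtain B where B: "\<And>x. x \<in> K \<Longrightarrow> norm (f x) \<le> B"
    using compact_imp_bounded[OF compact_continuous_image[OF continuous_on_subset[OF assms] K]]
    by (auto simp: bounded_iff)
  show "integrable lebesgue (\<lambda>x. indicat_real K x *\<^sub>R f x)"
  proof (rule integrable_bounded_compact_support[OF _ K, of _ "max B 0"])
    show "(\<lambda>x. indicat_real K x *\<^sub>R f x) \<in> borel_measurable lebesgue"
      using continuous_borel_measurable_lebesgue[OF assms] fmeasurableD[OF lmeasurable_compact[OF K]] by measurable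
    show "norm (indicat_real K x *\<^sub>R f x) \<le> max B 0" for x
      using B[of x] by (auto simp: indicator_def)
  qed auto
qed

lemma test_functionE:
  assumes "test_function \<eta>"
  obtains g K where "has_cont_gradient \<eta> g" "\<And>i. partial_deriv \<eta> i = (\<lambda>x. g x \<bullet> i)"
    "compact K" "\<And>x. x \<notin> K \<Longrightarrow> \<eta> x = 0"
proof -
  have "C_k (Suc 0) \<eta>" using assms by (simp only: test_function_def)
  note g = C_k_Suc_gradient[OF this]
  show ?thesis
  proof (rule that[OF g partial_deriv_eq'[OF g]])
    show "compact (closure {x. \<eta> x \<noteq> 0})" using assms by (simp only: test_function_def)
    show "\<eta> x = 0" if "x \<notin> closure {x. \<eta> x \<noteq> 0}" for x
      using that subsetD[OF closure_subset[of "{x. \<eta> x \<noteq> 0}"], of x] by auto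
  qed
qed

text \<open>Integration by parts against a test function; it is what places the explicit trial
  functions of the necessity part in the weighted Sobolev space.\<close>

lemma has_weak_gradientI_cont:
  assumes f: "has_cont_gradient f g"
  shows "has_weak_gradient f g"
  unfolding has_weak_gradient_def
proof (intro conjI allI impI ballI)
  show "locally_integrable lebesgue f" "locally_integrable lebesgue g"
    by (auto intro!: locally_integrable_continuous has_cont_gradient_cont[OF f] has_cont_gradient_cont_grad[OF f])
  fix \<eta> :: "'a \<Rightarrow> real" and i :: 'a assume "test_function \<eta>" and i: "i \<in> Basis"
  then obtain e K where e: "has_cont_gradient \<eta> e" "\<And>i. partial_deriv \<eta> i = (\<lambda>x. e x \<bullet> i)"
    and K: "compact K" "\<And>x. x \<notin> K \<Longrightarrow> \<eta> x = 0" using test_functionE[of \<eta>] by metis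
  have e0: "e x = 0" if "x \<notin> K" for x
    using has_cont_gradient_zero_outside[OF e(1) compact_imp_closed[OF K(1)] K(2) that] by auto
  have "(LINT x|lebesgue. (\<eta> x *\<^sub>R g x + f x *\<^sub>R e x) \<bullet> i) = 0"
    by (rule integral_gradient_eq_0[OF has_cont_gradient_mult[OF f e(1)] K(1) _ i]) (use K in auto)
  moreover have "integrable lebesgue (\<lambda>x. g x \<bullet> i * \<eta> x)"
    by (rule integrable_continuous_compact_support[OF _ K(1)])
      (use K in \<open>auto intro!: continuous_intros has_cont_gradient_cont[OF e(1)] has_cont_gradient_cont_grad[OF f]\<close>)
  moreover have "integrable lebesgue (\<lambda>x. f x * (e x \<bullet> i))"
    by (rule integrable_continuous_compact_support[OF _ K(1)])
      (use e0 in \<open>auto intro!: continuous_intros has_cont_gradient_cont_grad[OF e(1)] has_cont_gradient_cont[OF f]\<close>)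
  ultimately show "(LINT x|lebesgue. f x * partial_deriv \<eta> i x) = - (LINT x|lebesgue. g x \<bullet> i * \<eta> x)"
    by (simp add: e(2) inner_add_left mult.commute[of _ "\<eta> _"])
qed

lemma has_cont_gradient_reflect:
  assumes "has_cont_gradient f g"
  shows "has_cont_gradient (\<lambda>y. f (x - y)) (\<lambda>y. - g (x - y))"
  unfolding has_cont_gradient_def
proof (intro conjI allI)
  fix y
  have "((\<lambda>y. x - y) has_derivative (\<lambda>v. - v)) (at y)"
    by (auto intro!: derivative_eq_intros)
  from has_derivative_compose[OF this has_cont_gradientD[OF assms]]
  show "((\<lambda>y. f (x - y)) has_derivative (\<bullet>) (- g (x - y))) (at y)"
    by (rule has_derivative_eq_rhs) (auto simp: inner_minus_left inner_minus_right)
  show "continuous_on UNIV (\<lambda>y. - g (x - y))"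
    by (intro continuous_intros continuous_on_compose2[OF has_cont_gradient_cont_grad[OF assms, of UNIV]]) auto
qed

lemma convolution_integrable:
  fixes \<kappa> :: "'a::euclidean_space \<Rightarrow> 'b::euclidean_space" and u :: "'a \<Rightarrow> real"
  assumes u: "locally_integrable lebesgue u"
    and k: "continuous_on UNIV \<kappa>" "\<And>z. norm z > R \<Longrightarrow> \<kappa> z = 0"
  shows "integrable lebesgue (\<lambda>y. u y *\<^sub>R \<kappa> (x - y))"
proof -
  obtain B where B: "B \<ge> 0" "\<And>z. norm (\<kappa> z) \<le> B"
    using continuous_compact_support_bounded[OF k(1) compact_cball[of 0 R]] k(2)
    by (auto simp: not_le)
  have m: "(\<lambda>y. \<kappa> (x - y)) \<in> borel_measurable lebesgue"
    by (intro continuous_borel_measurable_lebesgue continuous_on_compose2[OF k(1)] continuous_intros) auto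
  show ?thesis
  proof (rule Bochner_Integration.integrable_bound)
    show "integrable lebesgue (\<lambda>y. B * norm (indicat_real (cball x R) y *\<^sub>R u y))"
      using u unfolding locally_integrable_def set_integrable_def
      by (intro integrable_mult_right integrable_norm) simp
    show "AE y in lebesgue. norm (u y *\<^sub>R \<kappa> (x - y)) \<le> norm (B * norm (indicat_real (cball x R) y *\<^sub>R u y))"
    proof (intro AE_I2)
      fix y
      show "norm (u y *\<^sub>R \<kappa> (x - y)) \<le> norm (B * norm (indicat_real (cball x R) y *\<^sub>R u y))"
      proof (cases "y \<in> cball x R")
        case True
        then show ?thesis using mult_right_mono[OF B(2)[of "x - y"] abs_ge_zero[of "u y"]] B(1)
          by (simp add: abs_mult mult.commute)
      qed (use k(2) in \<open>auto simp: dist_norm\<close>)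
    qed
  qed (use m locally_integrable_measurable[OF u] in auto)
qed

section \<open>Mollification of weak derivatives\<close>

definition mollifier_gradient :: "nat \<Rightarrow> 'a::euclidean_space \<Rightarrow> 'a" where
  "mollifier_gradient n z = (\<Sum>i\<in>Basis. partial_deriv (mollifier n) i z *\<^sub>R i)"

lemma mollifier_has_cont_gradient: "has_cont_gradient (mollifier n) (mollifier_gradient n)"
  using C_k_Suc_gradient[OF C_k_mollifier] unfolding mollifier_gradient_def[abs_def] .

lemma mollifier_gradient_eq_0: "norm z > 1 \<Longrightarrow> mollifier_gradient n z = 0"
  by (rule has_cont_gradient_zero_outside[OF mollifier_has_cont_gradient, of "cball 0 1"])
    (auto intro: mollifier_eq_0')

text \<open>The kernel reflected about \<open>x\<close> is itself a test function, and the sign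
  produced by the reflection cancels the one in the definition of the weak gradient.\<close>

lemma mollify_weak_gradient_inner:
  assumes "has_weak_gradient u g" "i \<in> Basis"
  shows "mollify n g x \<bullet> i = (LINT y|lebesgue. u y * (mollifier_gradient n (x - y) \<bullet> i))"
proof -
  have u: "locally_integrable lebesgue u" and g: "locally_integrable lebesgue g"
    using assms by (auto simp: has_weak_gradient_def)
  have pd: "partial_deriv (\<lambda>y. mollifier n (x - y)) i = (\<lambda>y. - (mollifier_gradient n (x - y) \<bullet> i))"
    using partial_deriv_eq'[OF has_cont_gradient_reflect[OF mollifier_has_cont_gradient], of n x i] by simp
  have "(LINT y|lebesgue. u y * partial_deriv (\<lambda>y. mollifier n (x - y)) i y) = - (LINT y|lebesgue. (g y \<bullet> i) * mollifier n (x - y))"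
    using assms test_function_mollifier[of n x] by (simp add: has_weak_gradient_def)
  then show ?thesis
    unfolding pd mollify_inner[OF g] unfolding mollify_def by (simp add: mult.commute)
qed

lemma mollify_has_cont_gradient:
  assumes "has_weak_gradient u g"
  shows "has_cont_gradient (mollify n u) (mollify n g)"
proof -
  have u: "locally_integrable lebesgue u" and g: "locally_integrable lebesgue g"
    using assms by (auto simp: has_weak_gradient_def)
  have "has_cont_gradient (\<lambda>x. LINT y|lebesgue. u y * mollifier n (x - y))
      (\<lambda>x. LINT y|lebesgue. u y *\<^sub>R mollifier_gradient n (x - y))"
    by (rule convolution_gradient[OF u mollifier_has_cont_gradient mollifier_eq_0']) auto
  moreover have "(\<lambda>x. LINT y|lebesgue. u y * mollifier n (x - y)) = mollify n u"
    unfolding mollify_def[abs_def] by (simp add: mult.commute)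
  moreover have "(\<lambda>x. LINT y|lebesgue. u y *\<^sub>R mollifier_gradient n (x - y)) = mollify n g"
  proof (rule ext, rule euclidean_eqI)
    fix x i :: 'a assume i: "i \<in> Basis"
    have "(LINT y|lebesgue. u y *\<^sub>R mollifier_gradient n (x - y)) \<bullet> i = (LINT y|lebesgue. (u y *\<^sub>R mollifier_gradient n (x - y)) \<bullet> i)"
      by (rule integral_inner_left[symmetric], rule convolution_integrable[OF u])
        (auto intro: has_cont_gradient_cont_grad[OF mollifier_has_cont_gradient] mollifier_gradient_eq_0)
    then show "(LINT y|lebesgue. u y *\<^sub>R mollifier_gradient n (x - y)) \<bullet> i = mollify n g x \<bullet> i"
      unfolding mollify_weak_gradient_inner[OF assms i] by simp
  qed
  ultimately show ?thesis by simp
qed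

text \<open>Two derivatives fall on the kernel, so the reflection signs cancel each other. Only the
  sum over all coordinates is rewritten with \<open>l\<close>, since the weak Laplacian carries no
  information on single second derivatives.\<close>

lemma mollify_has_cont_divergence:
  assumes g: "has_weak_gradient u g" and l: "has_weak_laplacian u l"
  shows "has_cont_divergence (mollify n g) (mollify n l)"
proof -
  let ?k = "mollifier n :: 'a \<Rightarrow> real"
  have u: "locally_integrable lebesgue u"
    using assms by (auto simp: has_weak_gradient_def)
  define G where "G = (\<lambda>i z. \<Sum>j\<in>Basis. partial_deriv (partial_deriv ?k i) j z *\<^sub>R j)"
  have pk: "partial_deriv ?k i = (\<lambda>z. mollifier_gradient n z \<bullet> i)" for i
    by (rule partial_deriv_eq'[OF mollifier_has_cont_gradient])
  have G: "has_cont_gradient (\<lambda>z. mollifier_gradient n z \<bullet> i) (G i)" if "i \<in> Basis" for i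
  proof -
    have "C_k (Suc (Suc 0)) ?k" by (rule C_k_mollifier)
    then have "C_k (Suc 0) (partial_deriv ?k i)" using that by simp
    from C_k_Suc_gradient[OF this] show ?thesis unfolding G_def pk[symmetric] .
  qed
  have G0: "G i z = 0" if "i \<in> Basis" "norm z > 1" for i z
    by (rule has_cont_gradient_zero_outside[OF G[OF that(1)], of "cball 0 1"])
      (use that in \<open>auto simp: mollifier_gradient_eq_0\<close>)
  have ig: "integrable lebesgue (\<lambda>y. u y *\<^sub>R G i (x - y))" if "i \<in> Basis" for i x
    by (rule convolution_integrable[OF u has_cont_gradient_cont_grad[OF G[OF that]] G0[OF that]])
  show ?thesis
    unfolding has_cont_divergence_def
  proof (rule exI[of _ "\<lambda>i x. LINT y|lebesgue. u y *\<^sub>R G i (x - y)"], intro conjI ballI allI)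
    fix i :: 'a assume i: "i \<in> Basis"
    show "has_cont_gradient (\<lambda>x. mollify n g x \<bullet> i) (\<lambda>x. LINT y|lebesgue. u y *\<^sub>R G i (x - y))"
      unfolding mollify_weak_gradient_inner[OF g i]
      by (rule convolution_gradient[OF u G[OF i], of 1]) (auto simp: mollifier_gradient_eq_0)
  next
    fix x :: 'a
    have pd: "partial_deriv (partial_deriv (\<lambda>y. ?k (x - y)) i) i y = G i (x - y) \<bullet> i" if "i \<in> Basis" for i y
    proof -
      have "partial_deriv (\<lambda>y. ?k (x - y)) i = (\<lambda>y. - (mollifier_gradient n (x - y) \<bullet> i))"
        using partial_deriv_eq'[OF has_cont_gradient_reflect[OF mollifier_has_cont_gradient], of n x i] by simp
      moreover have "has_cont_gradient (\<lambda>y. - (mollifier_gradient n (x - y) \<bullet> i)) (\<lambda>y. G i (x - y))"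
        using has_cont_gradient_mult[OF has_cont_gradient_const[of "-1"] has_cont_gradient_reflect[OF G[OF that], of x]] by simp
      ultimately show ?thesis using partial_deriv_eq by metis
    qed
    have "(\<Sum>i\<in>Basis. (LINT y|lebesgue. u y *\<^sub>R G i (x - y)) \<bullet> i) = (\<Sum>i\<in>Basis. (LINT y|lebesgue. (u y *\<^sub>R G i (x - y)) \<bullet> i))"
      by (rule sum.cong[OF refl], rule integral_inner_left[symmetric]) (use ig in auto)
    also have "\<dots> = (LINT y|lebesgue. (\<Sum>i\<in>Basis. (u y *\<^sub>R G i (x - y)) \<bullet> i))"
      by (rule Bochner_Integration.integral_sum[symmetric]) (intro integrable_inner_left ig)
    also have "\<dots> = (LINT y|lebesgue. u y * (\<Sum>i\<in>Basis. partial_deriv (partial_deriv (\<lambda>y. ?k (x - y)) i) i y))"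
      by (simp add: pd sum_distrib_left)
    also have "\<dots> = (LINT y|lebesgue. l y * ?k (x - y))"
      using l test_function_mollifier[of n x] by (simp add: has_weak_laplacian_def)
    also have "\<dots> = mollify n l x" by (simp add: mollify_def mult.commute)
    finally show "mollify n l x = (\<Sum>i\<in>Basis. (LINT y|lebesgue. u y *\<^sub>R G i (x - y)) \<bullet> i)" by simp
  qed
qed

text \<open>Both candidates have the same mollification, the classical gradient of the mollified
  \<open>u\<close>; almost everywhere convergence along a subsequence identifies them on each ball.
  This makes the choice in \<open>weak_gradient\<close> harmless.\<close>

lemma has_weak_gradient_unique:
  assumes "has_weak_gradient u g" "has_weak_gradient u h"
  shows "AE x in lebesgue. g x = h x"
proof -
  have g: "locally_integrable lebesgue g" and h: "locally_integrable lebesgue h"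
    using assms by (auto simp: has_weak_gradient_def)
  have m0: "mollify n (\<lambda>x. g x - h x) x = 0" for n x
  proof -
    have "(\<lambda>v. mollify n g x \<bullet> v) = (\<lambda>v. mollify n h x \<bullet> v)"
      by (rule has_derivative_unique) (rule has_cont_gradientD[OF mollify_has_cont_gradient], rule assms)+
    then have "mollify n g x = mollify n h x"
      by (metis vector_eq_rdot)
    then show ?thesis by (simp add: mollify_diff[OF g h])
  qed
  have "AE x in lebesgue. x \<in> cball 0 (real m) \<longrightarrow> g x = h x" for m :: nat
  proof -
    obtain s where s: "AE x in lebesgue. x \<in> cball 0 (real m) \<longrightarrow>
        (\<lambda>n. mollify (id (s n)) (\<lambda>x. g x - h x) x) \<longlonglongrightarrow> g x - h x"
      using mollify_AE_subseq[OF locally_integrable_diff[OF g h] compact_cball[of 0 "real m"] strict_mono_id] by blast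
    show ?thesis
      using s by (elim eventually_mono) (auto simp: m0 LIMSEQ_const_iff)
  qed
  then have "AE x in lebesgue. \<forall>m::nat. x \<in> cball 0 (real m) \<longrightarrow> g x = h x"
    by (simp only: AE_all_countable) simp
  then show ?thesis
  proof (elim eventually_mono)
    fix x assume "\<forall>m::nat. x \<in> cball 0 (real m) \<longrightarrow> g x = h x"
    moreover obtain m :: nat where "norm x \<le> real m" using real_arch_simple by blast
    ultimately show "g x = h x" by auto
  qed
qed

lemma has_weak_gradient_weak_gradient:
  "has_weak_gradient u g \<Longrightarrow> has_weak_gradient u (weak_gradient u)"
  unfolding weak_gradient_def by (rule someI[of "has_weak_gradient u"])

lemma weak_gradient_eq_AE:
  "has_weak_gradient u g \<Longrightarrow> AE x in lebesgue. weak_gradient u x = g x"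
  by (rule has_weak_gradient_unique[OF has_weak_gradient_weak_gradient])

lemma has_weak_laplacian_weak_laplacian:
  "has_weak_laplacian u l \<Longrightarrow> has_weak_laplacian u (weak_laplacian u)"
  unfolding weak_laplacian_def by (rule someI[of "has_weak_laplacian u"])

text \<open>The identity is classical for mollified \<open>u\<close> and \<open>v\<close>, and the
  bounds on \<open>A\<close>, \<open>B\<close> and their derivatives supply the majorants for the
  limit. Fields \<open>Z\<close> of class \<open>C^1\<close> replace test functions because the
  fields used later contain cut-offs of that class only.\<close>

lemma weak_product_chain_rule:
  fixes u v :: "'a::euclidean_space \<Rightarrow> real" and A B A' B' :: "real \<Rightarrow> real"
  assumes u: "has_weak_gradient u gu" and v: "has_weak_gradient v gv"
    and A: "\<And>t. (A has_real_derivative A' t) (at t)" "continuous_on UNIV A'"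
      "\<And>t. \<bar>A t\<bar> \<le> b" "\<And>t. \<bar>A' t\<bar> \<le> b"
    and B: "\<And>t. (B has_real_derivative B' t) (at t)" "continuous_on UNIV B'"
      "\<And>t. \<bar>B t\<bar> \<le> b" "\<And>t. \<bar>B' t\<bar> \<le> b"
    and Z: "has_cont_divergence Z d" "compact K" "\<And>x. x \<notin> K \<Longrightarrow> Z x = 0"
  shows "integrable lebesgue (\<lambda>x. Z x \<bullet> ((A' (u x) * B (v x)) *\<^sub>R gu x + (A (u x) * B' (v x)) *\<^sub>R gv x))"
    and "integrable lebesgue (\<lambda>x. A (u x) * B (v x) * d x)"
    and "(LINT x|lebesgue. Z x \<bullet> ((A' (u x) * B (v x)) *\<^sub>R gu x + (A (u x) * B' (v x)) *\<^sub>R gv x))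
      = - (LINT x|lebesgue. A (u x) * B (v x) * d x)"
proof -
  have lu: "locally_integrable lebesgue u" "locally_integrable lebesgue gu"
    and lv: "locally_integrable lebesgue v" "locally_integrable lebesgue gv"
    using u v by (auto simp: has_weak_gradient_def)
  have b: "b \<ge> 0" using order_trans[OF abs_ge_zero A(3)] by blast
  have cA: "continuous_on UNIV A" and cB: "continuous_on UNIV B"
    using A(1) B(1) by (meson DERIV_isCont continuous_at_imp_continuous_on)+
  have bm: "A \<in> borel_measurable borel" "A' \<in> borel_measurable borel" "B \<in> borel_measurable borel" "B' \<in> borel_measurable borel"
    by (intro borel_measurable_continuous_onI cA cB A(2) B(2))+
  have mu: "u \<in> borel_measurable lebesgue" "v \<in> borel_measurable lebesgue"
    by (intro locally_integrable_measurable lu lv)+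
  have mm: "(\<lambda>x. A (f x)) \<in> borel_measurable lebesgue" "(\<lambda>x. A' (f x)) \<in> borel_measurable lebesgue"
      "(\<lambda>x. B (f x)) \<in> borel_measurable lebesgue" "(\<lambda>x. B' (f x)) \<in> borel_measurable lebesgue"
    if "f \<in> borel_measurable lebesgue" for f :: "'a \<Rightarrow> real"
    using bm that by (auto intro: measurable_compose)
  have mZ: "Z \<in> borel_measurable lebesgue" "d \<in> borel_measurable lebesgue"
    by (intro continuous_borel_measurable_lebesgue has_cont_divergence_cont[OF Z(1)])+
  have d0: "d x = 0" if "x \<notin> K" for x
    using has_cont_divergence_zero_outside[OF Z(1) compact_imp_closed[OF Z(2)] Z(3) that] by auto
  obtain z where z: "z \<ge> 0" "\<And>x. norm (Z x) \<le> z"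
    using continuous_compact_support_bounded[OF has_cont_divergence_cont(1)[OF Z(1)] Z(2,3)] by metis
  have prod: "\<bar>s * t\<bar> \<le> b * b" if "\<bar>s\<bar> \<le> b" "\<bar>t\<bar> \<le> b" for s t
    using that b by (simp add: abs_mult mult_mono)
  have di: "integrable lebesgue (\<lambda>x. (b * b) * norm (d x))"
    by (intro integrable_mult_right integrable_norm integrable_continuous_compact_support[OF has_cont_divergence_cont(2)[OF Z(1)] Z(2) d0])
  have bZ: "norm ((s * t) *\<^sub>R Z x) \<le> b * b * z" if "\<bar>s\<bar> \<le> b" "\<bar>t\<bar> \<le> b" for s t x
    unfolding norm_scaleR by (intro mult_mono prod that z) (use b in auto)
  have i1: "integrable lebesgue (\<lambda>x. ((A' (u x) * B (v x)) *\<^sub>R Z x) \<bullet> gu x)"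
    by (rule locally_integrable_mult_bounded_inner[OF lu(2) _ Z(2), where B="b * b * z"])
      (auto intro!: borel_measurable_scaleR borel_measurable_times mm mu mZ bZ A(3,4) B(3,4) simp: Z(3) simp del: norm_scaleR)
  have i2: "integrable lebesgue (\<lambda>x. ((A (u x) * B' (v x)) *\<^sub>R Z x) \<bullet> gv x)"
    by (rule locally_integrable_mult_bounded_inner[OF lv(2) _ Z(2), where B="b * b * z"])
      (auto intro!: borel_measurable_scaleR borel_measurable_times mm mu mZ bZ A(3,4) B(3,4) simp: Z(3) simp del: norm_scaleR)
  have split: "Z x \<bullet> ((A' (u x) * B (v x)) *\<^sub>R gu x + (A (u x) * B' (v x)) *\<^sub>R gv x) =
    ((A' (u x) * B (v x)) *\<^sub>R Z x) \<bullet> gu x + ((A (u x) * B' (v x)) *\<^sub>R Z x) \<bullet> gv x" for u v gu gv x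
    by (simp add: inner_add_right)
  show "integrable lebesgue (\<lambda>x. Z x \<bullet> ((A' (u x) * B (v x)) *\<^sub>R gu x + (A (u x) * B' (v x)) *\<^sub>R gv x))"
    unfolding split by (intro Bochner_Integration.integrable_add i1 i2)
  have id: "integrable lebesgue (\<lambda>x. A (f x) * B (g x) * d x)"
    and bd: "norm (A (f x) * B (g x) * d x) \<le> (b * b) * norm (d x)"
    if "f \<in> borel_measurable lebesgue" "g \<in> borel_measurable lebesgue" for f g x
  proof -
    show bd: "norm (A (f x) * B (g x) * d x) \<le> (b * b) * norm (d x)" for x
      using mult_right_mono[OF prod[OF A(3) B(3)] abs_ge_zero[of "d x"]] by (simp add: abs_mult)
    show "integrable lebesgue (\<lambda>x. A (f x) * B (g x) * d x)"
      by (rule Bochner_Integration.integrable_bound[OF di])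
        (use mm that mZ bd b in \<open>auto simp: abs_mult\<close>)
  qed
  show "integrable lebesgue (\<lambda>x. A (u x) * B (v x) * d x)"
    by (rule id[OF mu])
  obtain s1 where s1: "strict_mono (s1::nat\<Rightarrow>nat)" "AE x in lebesgue. x \<in> K \<longrightarrow> (\<lambda>n. mollify (id (s1 n)) u x) \<longlonglongrightarrow> u x"
    using mollify_AE_subseq[OF lu(1) Z(2) strict_mono_id] by blast
  \<comment> \<open>Extracted from \<open>s1\<close>, so that along the composition both mollified
    functions converge almost everywhere on \<open>K\<close>; the gradients enter linearly and
    converge in \<open>L^1\<close>.\<close>
  obtain s2 where s2: "strict_mono (s2::nat\<Rightarrow>nat)" "AE x in lebesgue. x \<in> K \<longrightarrow> (\<lambda>n. mollify (s1 (s2 n)) v x) \<longlonglongrightarrow> v x"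
    using mollify_AE_subseq[OF lv(1) Z(2) s1(1)] by blast
  define r where "r = s1 \<circ> s2"
  have r: "strict_mono r" unfolding r_def by (rule strict_mono_o[OF s1(1) s2(1)])
  define un where "un = (\<lambda>n. mollify (r n) u)"
  define vn where "vn = (\<lambda>n. mollify (r n) v)"
  have mun: "un n \<in> borel_measurable lebesgue" "vn n \<in> borel_measurable lebesgue" for n
    unfolding un_def vn_def by (intro mollify_measurable lu lv)+
  have lim: "AE x in lebesgue. x \<in> K \<longrightarrow> (\<lambda>n. un n x) \<longlonglongrightarrow> u x \<and> (\<lambda>n. vn n x) \<longlonglongrightarrow> v x"
    using s1(2) s2(2)
  proof eventually_elim
    case (elim x)
    then show ?case
      using LIMSEQ_subseq_LIMSEQ[of "\<lambda>n. mollify (id (s1 n)) u x" "u x" s2] s2(1)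
      by (auto simp: un_def vn_def r_def comp_def)
  qed
  have ct: "(\<lambda>n. F (w n)) \<longlonglongrightarrow> F y" if "continuous_on UNIV F" "w \<longlonglongrightarrow> y" for F :: "real \<Rightarrow> real" and w y
    using continuous_on_tendsto_compose[OF that] by auto
  have cn: "AE x in lebesgue. (\<lambda>n. (F (un n x) * G (vn n x)) *\<^sub>R Z x) \<longlonglongrightarrow> (F (u x) * G (v x)) *\<^sub>R Z x"
    if "continuous_on UNIV F" "continuous_on UNIV G" for F G :: "real \<Rightarrow> real"
    using lim
  proof (elim eventually_mono)
    fix x assume *: "x \<in> K \<longrightarrow> (\<lambda>n. un n x) \<longlonglongrightarrow> u x \<and> (\<lambda>n. vn n x) \<longlonglongrightarrow> v x"
    show "(\<lambda>n. (F (un n x) * G (vn n x)) *\<^sub>R Z x) \<longlonglongrightarrow> (F (u x) * G (v x)) *\<^sub>R Z x"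
    proof (cases "x \<in> K")
      case True
      then show ?thesis
        using * by (intro tendsto_scaleR tendsto_mult tendsto_const ct[OF that(1)] ct[OF that(2)]) simp_all
    qed (use Z(3) in simp)
  qed
  have l1: "(\<lambda>n. LINT x|lebesgue. ((A' (un n x) * B (vn n x)) *\<^sub>R Z x) \<bullet> mollify (r n) gu x) \<longlonglongrightarrow>
      (LINT x|lebesgue. ((A' (u x) * B (v x)) *\<^sub>R Z x) \<bullet> gu x)"
    by (rule tendsto_integral_mollify[OF lu(2) Z(2) r, where B="b * b * z"])
      (auto intro!: borel_measurable_scaleR borel_measurable_times mm mun mu mZ bZ A(3,4) B(3,4) cn[OF A(2) cB] simp: Z(3) simp del: norm_scaleR)
  have l2: "(\<lambda>n. LINT x|lebesgue. ((A (un n x) * B' (vn n x)) *\<^sub>R Z x) \<bullet> mollify (r n) gv x) \<longlonglongrightarrow>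
      (LINT x|lebesgue. ((A (u x) * B' (v x)) *\<^sub>R Z x) \<bullet> gv x)"
    by (rule tendsto_integral_mollify[OF lv(2) Z(2) r, where B="b * b * z"])
      (auto intro!: borel_measurable_scaleR borel_measurable_times mm mun mu mZ bZ A(3,4) B(3,4) cn[OF cA B(2)] simp: Z(3) simp del: norm_scaleR)
  have l3: "(\<lambda>n. LINT x|lebesgue. A (un n x) * B (vn n x) * d x) \<longlonglongrightarrow> (LINT x|lebesgue. A (u x) * B (v x) * d x)"
  proof (rule integral_dominated_convergence[OF _ _ di])
    show "AE x in lebesgue. (\<lambda>n. A (un n x) * B (vn n x) * d x) \<longlonglongrightarrow> A (u x) * B (v x) * d x"
      using lim
    proof (elim eventually_mono)
      fix x assume *: "x \<in> K \<longrightarrow> (\<lambda>n. un n x) \<longlonglongrightarrow> u x \<and> (\<lambda>n. vn n x) \<longlonglongrightarrow> v x"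
      show "(\<lambda>n. A (un n x) * B (vn n x) * d x) \<longlonglongrightarrow> A (u x) * B (v x) * d x"
      proof (cases "x \<in> K")
        case True
        then show ?thesis
          using * by (intro tendsto_mult tendsto_const ct[OF cA] ct[OF cB]) simp_all
      qed (use d0 in simp)
    qed
    show "AE x in lebesgue. norm (A (un n x) * B (vn n x) * d x) \<le> (b * b) * norm (d x)" for n
      by (intro AE_I2 bd mun)
  qed (use mm mu mun mZ in auto)
  \<comment> \<open>The divergence theorem for the classical field
    \<open>A (un n x) * B (vn n x)\<close> times \<open>Z x\<close>.\<close>
  have eq: "(LINT x|lebesgue. ((A' (un n x) * B (vn n x)) *\<^sub>R Z x) \<bullet> mollify (r n) gu x) +
     (LINT x|lebesgue. ((A (un n x) * B' (vn n x)) *\<^sub>R Z x) \<bullet> mollify (r n) gv x) =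
     - (LINT x|lebesgue. A (un n x) * B (vn n x) * d x)" for n
  proof -
    have gA: "has_cont_gradient (\<lambda>x. A (un n x)) (\<lambda>x. A' (un n x) *\<^sub>R mollify (r n) gu x)"
      unfolding un_def by (rule has_cont_gradient_compose[OF mollify_has_cont_gradient[OF u] A(1) continuous_on_subset[OF A(2)]]) auto
    have gB: "has_cont_gradient (\<lambda>x. B (vn n x)) (\<lambda>x. B' (vn n x) *\<^sub>R mollify (r n) gv x)"
      unfolding vn_def by (rule has_cont_gradient_compose[OF mollify_has_cont_gradient[OF v] B(1) continuous_on_subset[OF B(2)]]) auto
    note D = has_cont_divergence_scaleR[OF has_cont_gradient_mult[OF gA gB] Z(1)]
    have "(LINT x|lebesgue. (B (vn n x) *\<^sub>R (A' (un n x) *\<^sub>R mollify (r n) gu x) + A (un n x) *\<^sub>R (B' (vn n x) *\<^sub>R mollify (r n) gv x)) \<bullet> Z x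
       + A (un n x) * B (vn n x) * d x) = 0"
      by (rule integral_divergence_eq_0[OF D Z(2)]) (simp add: Z(3))
    moreover have "(B (vn n x) *\<^sub>R (A' (un n x) *\<^sub>R mollify (r n) gu x) + A (un n x) *\<^sub>R (B' (vn n x) *\<^sub>R mollify (r n) gv x)) \<bullet> Z x
      = ((A' (un n x) * B (vn n x)) *\<^sub>R Z x) \<bullet> mollify (r n) gu x + ((A (un n x) * B' (vn n x)) *\<^sub>R Z x) \<bullet> mollify (r n) gv x" for x
      by (simp add: inner_add_left inner_commute[of "Z x"] mult_ac)
    moreover have "integrable lebesgue (\<lambda>x. ((A' (un n x) * B (vn n x)) *\<^sub>R Z x) \<bullet> mollify (r n) gu x)"
      by (rule locally_integrable_mult_bounded_inner[OF locally_integrable_continuous[OF mollify_continuous[OF lu(2)]] _ Z(2), where B="b * b * z"])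
        (auto intro!: borel_measurable_scaleR borel_measurable_times mm mun mZ bZ A(3,4) B(3,4) simp: Z(3) simp del: norm_scaleR)
    moreover have "integrable lebesgue (\<lambda>x. ((A (un n x) * B' (vn n x)) *\<^sub>R Z x) \<bullet> mollify (r n) gv x)"
      by (rule locally_integrable_mult_bounded_inner[OF locally_integrable_continuous[OF mollify_continuous[OF lv(2)]] _ Z(2), where B="b * b * z"])
        (auto intro!: borel_measurable_scaleR borel_measurable_times mm mun mZ bZ A(3,4) B(3,4) simp: Z(3) simp del: norm_scaleR)
    moreover note id[OF mun(1)[of n] mun(2)[of n]]
    ultimately show ?thesis
      by (simp only: Bochner_Integration.integral_add Bochner_Integration.integrable_add)
  qed
  have "(LINT x|lebesgue. ((A' (u x) * B (v x)) *\<^sub>R Z x) \<bullet> gu x) + (LINT x|lebesgue. ((A (u x) * B' (v x)) *\<^sub>R Z x) \<bullet> gv x)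
      = - (LINT x|lebesgue. A (u x) * B (v x) * d x)"
    using LIMSEQ_unique[OF tendsto_add[OF l1 l2, unfolded eq] tendsto_minus[OF l3]] .
  then show "(LINT x|lebesgue. Z x \<bullet> ((A' (u x) * B (v x)) *\<^sub>R gu x + (A (u x) * B' (v x)) *\<^sub>R gv x))
      = - (LINT x|lebesgue. A (u x) * B (v x) * d x)"
    unfolding split by (simp only: Bochner_Integration.integral_add[OF i1 i2])
qed

subsection \<open>Truncations\<close>

text \<open>A rational truncation at height \<open>k > 0\<close>, equal to
  \<open>s / (1 + s^2 / k^2)\<close>: it is bounded by \<open>k\<close> and by \<open>|s|\<close>,
  has slope at most 1 in modulus and tends to \<open>s\<close> as \<open>k\<close> grows. Unlike
  \<open>min\<close> and \<open>max\<close> it is continuously differentiable, as the chain rule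
  demands.\<close>

definition squash :: "real \<Rightarrow> real \<Rightarrow> real" where
  "squash k s = s * (k\<^sup>2 / (k\<^sup>2 + s\<^sup>2))"

text \<open>The derivative is written through the ratio \<open>k^2 / (k^2 + s^2)\<close>, which lies
  in \<open>[0, 1]\<close> and tends to 1 as \<open>k\<close> grows; both the bound by 1 and the
  limit 1 can be read off.\<close>

definition squash' :: "real \<Rightarrow> real \<Rightarrow> real" where
  "squash' k s = (k\<^sup>2 / (k\<^sup>2 + s\<^sup>2)) * (2 * (k\<^sup>2 / (k\<^sup>2 + s\<^sup>2)) - 1)"

text \<open>At \<open>t = sqrt \<mu>\<close> this is the factor
  \<open>m \<mu> / (1 + m \<mu>)\<close> of the overview. It is a function of the square root
  because the chain rule is applied to the latter, whose weak gradient is locally square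
  integrable.\<close>

definition cutzero :: "real \<Rightarrow> real \<Rightarrow> real" where
  "cutzero m t = 1 - 1 / (1 + m * t\<^sup>2)"

definition cutzero' :: "real \<Rightarrow> real \<Rightarrow> real" where
  "cutzero' m t = 2 * m * t / (1 + m * t\<^sup>2)\<^sup>2"

lemma squash_ratio:
  fixes k s :: real
  shows "k > 0 \<Longrightarrow> 0 < k\<^sup>2 / (k\<^sup>2 + s\<^sup>2)" and "k\<^sup>2 / (k\<^sup>2 + s\<^sup>2) \<le> 1"
proof -
  show "k > 0 \<Longrightarrow> 0 < k\<^sup>2 / (k\<^sup>2 + s\<^sup>2)"
    by (intro divide_pos_pos add_pos_nonneg) auto
  have "k\<^sup>2 + s\<^sup>2 = 0 \<or> k\<^sup>2 + s\<^sup>2 > 0"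
    using sum_power2_ge_zero[of k s] by linarith
  then show "k\<^sup>2 / (k\<^sup>2 + s\<^sup>2) \<le> 1"
    by (elim disjE) (simp_all only: divide_le_eq_1 div_by_0, simp_all)
qed

lemma squash_deriv:
  assumes "k > 0"
  shows "(squash k has_real_derivative squash' k s) (at s)"
proof -
  define d where "d = k\<^sup>2 + s\<^sup>2"
  have nz: "d \<noteq> 0" using assms by (simp add: d_def sum_power2_eq_zero_iff)
  have "((\<lambda>s. k\<^sup>2 + s\<^sup>2) has_real_derivative 2 * s) (at s)"
    by (auto intro!: derivative_eq_intros)
  from DERIV_mult'[OF DERIV_ident DERIV_divide[OF DERIV_const this]]
  have "((\<lambda>s. s * (k\<^sup>2 / (k\<^sup>2 + s\<^sup>2))) has_real_derivative
      s * ((0 * d - k\<^sup>2 * (2 * s)) / (d * d)) + 1 * (k\<^sup>2 / d)) (at s)"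
    using nz by (simp add: d_def)
  moreover have "s * ((0 * d - k\<^sup>2 * (2 * s)) / (d * d)) + 1 * (k\<^sup>2 / d) = (k\<^sup>2 / d) * (2 * (k\<^sup>2 / d) - 1)"
  proof -
    have "s * s = d - k\<^sup>2" by (simp add: d_def power2_eq_square)
    then have "s * ((0 * d - k\<^sup>2 * (2 * s)) / (d * d)) = - 2 * k\<^sup>2 * (d - k\<^sup>2) / (d * d)"
      by (simp add: mult_ac)
    then show ?thesis using nz by (simp add: field_simps)
  qed
  ultimately show ?thesis unfolding squash_def[abs_def] squash'_def d_def by simp
qed

lemma squash'_continuous: "k > 0 \<Longrightarrow> continuous_on UNIV (squash' k)"
  unfolding squash'_def[abs_def]
  by (intro continuous_intros) (auto simp: sum_power2_eq_zero_iff)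

lemma squash_continuous: "k > 0 \<Longrightarrow> continuous_on UNIV (squash k)"
  unfolding squash_def[abs_def]
  by (intro continuous_intros) (auto simp: sum_power2_eq_zero_iff)

lemma squash'_le: "k > 0 \<Longrightarrow> \<bar>squash' k s\<bar> \<le> 1"
  using squash_ratio[of k s] mult_mono[of "k\<^sup>2 / (k\<^sup>2 + s\<^sup>2)" 1 "\<bar>2 * (k\<^sup>2 / (k\<^sup>2 + s\<^sup>2)) - 1\<bar>" 1]
  unfolding squash'_def abs_mult by auto

lemma squash_le_abs: "\<bar>squash k s\<bar> \<le> \<bar>s\<bar>"
proof -
  have "\<bar>s\<bar> * (k\<^sup>2 / (k\<^sup>2 + s\<^sup>2)) \<le> \<bar>s\<bar> * 1"
    by (intro mult_left_mono squash_ratio) auto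
  then show ?thesis by (simp add: squash_def abs_mult)
qed

lemma squash_le:
  assumes "k > 0" shows "\<bar>squash k s\<bar> \<le> k"
proof -
  have "0 \<le> (k - \<bar>s\<bar>)\<^sup>2" by simp
  then have "2 * (k * \<bar>s\<bar>) \<le> k\<^sup>2 + s\<^sup>2" by (simp add: power2_diff)
  moreover have "0 \<le> k * \<bar>s\<bar>" using assms by simp
  ultimately have "k * \<bar>s\<bar> \<le> k\<^sup>2 + s\<^sup>2" by linarith
  then have "k * (k * \<bar>s\<bar>) \<le> k * (k\<^sup>2 + s\<^sup>2)"
    using assms by (intro mult_left_mono) auto
  moreover have "k\<^sup>2 + s\<^sup>2 > 0" using assms by (simp add: add_pos_nonneg)
  ultimately have "\<bar>s\<bar> * k\<^sup>2 / (k\<^sup>2 + s\<^sup>2) \<le> k"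
    by (simp add: divide_le_eq power2_eq_square mult_ac)
  then show ?thesis by (simp add: squash_def abs_mult)
qed

lemma squash_ratio_tendsto: "(\<lambda>n. (real (Suc n))\<^sup>2 / ((real (Suc n))\<^sup>2 + s\<^sup>2)) \<longlonglongrightarrow> 1"
proof -
  have "(\<lambda>n. 1 / (1 + s\<^sup>2 * (inverse (real (Suc n)))\<^sup>2)) \<longlonglongrightarrow> 1 / (1 + s\<^sup>2 * 0\<^sup>2)"
    by (intro tendsto_intros LIMSEQ_inverse_real_of_nat) auto
  moreover have "1 / (1 + s\<^sup>2 * (inverse (real (Suc n)))\<^sup>2) = (real (Suc n))\<^sup>2 / ((real (Suc n))\<^sup>2 + s\<^sup>2)" for n
  proof -
    define N where "N = real (Suc n)"
    have N: "N > 0" by (simp add: N_def)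
    show ?thesis unfolding N_def[symmetric]
      using N by (simp add: divide_simps sum_power2_eq_zero_iff)
  qed
  ultimately show ?thesis by simp
qed

lemma squash_tendsto: "(\<lambda>n. squash (real (Suc n)) s) \<longlonglongrightarrow> s"
  using tendsto_mult_left[OF squash_ratio_tendsto, of s s] by (simp add: squash_def)

lemma squash'_tendsto: "(\<lambda>n. squash' (real (Suc n)) s) \<longlonglongrightarrow> 1"
proof -
  have "(\<lambda>n. squash' (real (Suc n)) s) \<longlonglongrightarrow> 1 * (2 * 1 - 1)"
    unfolding squash'_def by (intro tendsto_mult tendsto_diff tendsto_const squash_ratio_tendsto)
  then show ?thesis by simp
qed

lemma cutzero_deriv:
  assumes "m > 0"
  shows "(cutzero m has_real_derivative cutzero' m t) (at t)"
proof -
  have nz: "1 + m * t\<^sup>2 \<noteq> 0" using assms by (smt (verit) mult_nonneg_nonneg zero_le_power2)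
  then show ?thesis
    unfolding cutzero_def[abs_def] cutzero'_def
    by (auto intro!: derivative_eq_intros simp: power2_eq_square)
qed

lemma cutzero_denominator: "m > 0 \<Longrightarrow> 1 + m * t\<^sup>2 \<ge> 1" for m t :: real
  by simp

lemma cutzero'_continuous: "m > 0 \<Longrightarrow> continuous_on UNIV (cutzero' m)"
  unfolding cutzero'_def[abs_def]
  by (intro continuous_intros) (smt (verit) cutzero_denominator power2_eq_square mult_eq_0_iff)

lemma cutzero_continuous: "m > 0 \<Longrightarrow> continuous_on UNIV (cutzero m)"
  unfolding cutzero_def[abs_def]
  by (intro continuous_intros) (smt (verit) cutzero_denominator)

lemma cutzero_bounds:
  assumes "m > 0"
  shows "0 \<le> cutzero m t" "cutzero m t \<le> 1"
  using cutzero_denominator[OF assms, of t] by (auto simp: cutzero_def)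

lemma cutzero_0: "cutzero m 0 = 0"
  by (simp add: cutzero_def)

lemma abs_le_one_plus_square: "m \<ge> 1 \<Longrightarrow> 2 * \<bar>t\<bar> \<le> 1 + m * t\<^sup>2" for m t :: real
proof -
  assume "m \<ge> 1"
  have "0 \<le> (1 - \<bar>t\<bar>)\<^sup>2" by simp
  then have "2 * \<bar>t\<bar> \<le> 1 + 1 * t\<^sup>2" by (simp add: power2_diff)
  also have "\<dots> \<le> 1 + m * t\<^sup>2" using \<open>m \<ge> 1\<close> by (intro add_left_mono mult_right_mono) auto
  finally show ?thesis .
qed

text \<open>Linear vanishing at zero is what converts weighted square integrability of the gradient
  of \<open>\<phi>\<close> into unweighted square integrability after the cut-off.\<close>

lemma cutzero_le:
  assumes "m \<ge> 1" shows "cutzero m t \<le> m * \<bar>t\<bar>"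
proof -
  have d: "1 + m * t\<^sup>2 \<ge> 1" using cutzero_denominator[of m t] assms by simp
  have "cutzero m t = m * \<bar>t\<bar> * (\<bar>t\<bar> / (1 + m * t\<^sup>2))"
    using d by (simp add: cutzero_def field_simps power2_eq_square)
  also have "\<dots> \<le> m * \<bar>t\<bar> * 1"
    using assms abs_le_one_plus_square[OF assms, of t] d by (intro mult_left_mono) (auto simp: divide_le_eq)
  finally show ?thesis by simp
qed

lemma cutzero'_le:
  assumes "m \<ge> 1" shows "\<bar>cutzero' m t\<bar> \<le> m"
proof -
  have d: "1 + m * t\<^sup>2 \<ge> 1" using cutzero_denominator[of m t] assms by simp
  have "(1 + m * t\<^sup>2) * 1 \<le> (1 + m * t\<^sup>2) * (1 + m * t\<^sup>2)"
    using d by (intro mult_left_mono) auto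
  then have "2 * \<bar>t\<bar> \<le> (1 + m * t\<^sup>2)\<^sup>2"
    using abs_le_one_plus_square[OF assms, of t] by (simp add: power2_eq_square)
  then have "m * (2 * \<bar>t\<bar>) \<le> m * (1 + m * t\<^sup>2)\<^sup>2"
    using assms by (intro mult_left_mono) auto
  then show ?thesis
    using d assms by (simp add: cutzero'_def abs_mult divide_le_eq)
qed

text \<open>In contrast to \<open>cutzero'_le\<close> this bound is uniform in \<open>m\<close>:
  multiplied by \<open>\<rho>\<close>, the gradient of the cut-off stays below twice the gradient of
  \<open>\<rho>\<close> as \<open>m\<close> tends to infinity.\<close>

lemma mult_cutzero'_le:
  assumes "m > 0" shows "\<bar>t * cutzero' m t\<bar> \<le> 2"
proof -
  have d: "1 + m * t\<^sup>2 \<ge> 1" using cutzero_denominator[OF assms] .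
  have "m * t\<^sup>2 \<le> (1 + m * t\<^sup>2) * 1" by simp
  also have "\<dots> \<le> (1 + m * t\<^sup>2) * (1 + m * t\<^sup>2)"
    using d by (intro mult_left_mono) auto
  finally have "2 * (m * t\<^sup>2) \<le> 2 * (1 + m * t\<^sup>2)\<^sup>2" by (simp add: power2_eq_square)
  then have "\<bar>t * (2 * m * t)\<bar> / (1 + m * t\<^sup>2)\<^sup>2 \<le> 2"
    using d assms by (simp add: divide_le_eq abs_mult power2_eq_square[of t] mult_ac)
  then show ?thesis by (simp add: cutzero'_def abs_mult)
qed

lemma cutzero_aux_tendsto:
  assumes "t \<noteq> (0::real)" shows "(\<lambda>n. 1 / (1 + real (Suc n) * t\<^sup>2)) \<longlonglongrightarrow> 0"
proof (rule Lim_null_comparison)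
  show "(\<lambda>n. inverse (t\<^sup>2) * inverse (real (Suc n))) \<longlonglongrightarrow> 0"
    using tendsto_mult_left[OF LIMSEQ_inverse_real_of_nat, of "inverse (t\<^sup>2)"] by simp
  show "\<forall>\<^sub>F n in sequentially. norm (1 / (1 + real (Suc n) * t\<^sup>2)) \<le> inverse (t\<^sup>2) * inverse (real (Suc n))"
  proof (intro always_eventually allI)
    fix n
    have p: "0 < real (Suc n) * t\<^sup>2" using assms by simp
    then have "inverse (1 + real (Suc n) * t\<^sup>2) \<le> inverse (real (Suc n) * t\<^sup>2)"
      by (intro le_imp_inverse_le) auto
    then show "norm (1 / (1 + real (Suc n) * t\<^sup>2)) \<le> inverse (t\<^sup>2) * inverse (real (Suc n))"
      using p by (simp add: inverse_eq_divide mult.commute abs_of_nonneg)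
  qed
qed

lemma cutzero_tendsto:
  assumes "t \<noteq> (0::real)" shows "(\<lambda>n. cutzero (real (Suc n)) t) \<longlonglongrightarrow> 1"
  unfolding cutzero_def using tendsto_diff[OF tendsto_const cutzero_aux_tendsto[OF assms], of 1] by simp

lemma cutzero'_tendsto:
  assumes "t \<noteq> (0::real)" shows "(\<lambda>n. cutzero' (real (Suc n)) t) \<longlonglongrightarrow> 0"
proof -
  have "(\<lambda>n. (2 / t) * (cutzero (real (Suc n)) t * (1 / (1 + real (Suc n) * t\<^sup>2)))) \<longlonglongrightarrow> (2 / t) * (1 * 0)"
    by (intro tendsto_mult tendsto_const cutzero_tendsto cutzero_aux_tendsto assms)
  moreover have "(2 / t) * (cutzero (real (Suc n)) t * (1 / (1 + real (Suc n) * t\<^sup>2))) = cutzero' (real (Suc n)) t" for n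
  proof -
    define N where "N = real (Suc n)"
    have d: "1 + N * t\<^sup>2 \<ge> 1" by (rule cutzero_denominator) (simp add: N_def)
    have "cutzero N t = N * t\<^sup>2 / (1 + N * t\<^sup>2)" using d by (simp add: cutzero_def field_simps)
    then show ?thesis unfolding N_def[symmetric] cutzero'_def
      using assms by (simp add: power2_eq_square)
  qed
  ultimately show ?thesis by simp
qed

subsection \<open>The square of a Sobolev function\<close>

text \<open>A bounded approximation of \<open>t^2\<close> with bounded derivative, namely
  \<open>t^2 k^2 / (k^2 + t^2)\<close>, to which the chain rule for bounded functions
  applies.\<close>

definition soft_square :: "real \<Rightarrow> real \<Rightarrow> real" where
  "soft_square k t = t * squash k t"

lemma locally_integrable_mult_squares:
  fixes f :: "'a::euclidean_space \<Rightarrow> real" and h :: "'a \<Rightarrow> 'b::euclidean_space"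
  assumes "locally_integrable lebesgue (\<lambda>x. (f x)\<^sup>2)" "locally_integrable lebesgue (\<lambda>x. (norm (h x))\<^sup>2)"
    "f \<in> borel_measurable lebesgue" "h \<in> borel_measurable lebesgue"
  shows "locally_integrable lebesgue (\<lambda>x. (2 * f x) *\<^sub>R h x)"
proof (rule locally_integrable_bound[OF locally_integrable_add[OF assms(1,2)]])
  show "(\<lambda>x. (2 * f x) *\<^sub>R h x) \<in> borel_measurable lebesgue" using assms(3,4) by measurable
  fix x
  have "0 \<le> (\<bar>f x\<bar> - norm (h x))\<^sup>2" by simp
  then show "norm ((2 * f x) *\<^sub>R h x) \<le> (f x)\<^sup>2 + (norm (h x))\<^sup>2"
    by (simp add: power2_diff abs_mult)
qed

text \<open>The chain rule covers bounded functions, so it is applied to \<open>soft_square\<close>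
  and the level is sent to infinity; \<open>f^2\<close> and \<open>2 |f| |h|\<close> give majorants
  independent of the level.\<close>

lemma has_weak_gradient_square:
  assumes f: "has_weak_gradient f h" and f2: "locally_integrable lebesgue (\<lambda>x. (f x)\<^sup>2)"
    and h2: "locally_integrable lebesgue (\<lambda>x. (norm (h x))\<^sup>2)"
  shows "has_weak_gradient (\<lambda>x. (f x)\<^sup>2) (\<lambda>x. (2 * f x) *\<^sub>R h x)"
  unfolding has_weak_gradient_def
proof (intro conjI allI impI ballI)
  have lf: "locally_integrable lebesgue f" "locally_integrable lebesgue h"
    using f by (auto simp: has_weak_gradient_def)
  note mf = lf[THEN locally_integrable_measurable]
  show p: "locally_integrable lebesgue (\<lambda>x. (2 * f x) *\<^sub>R h x)"
    by (rule locally_integrable_mult_squares[OF f2 h2 mf])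
  show "locally_integrable lebesgue (\<lambda>x. (f x)\<^sup>2)" by (rule f2)
  fix \<eta> :: "'a \<Rightarrow> real" and i :: 'a assume "test_function \<eta>" and i: "i \<in> Basis"
  then obtain e K where e: "has_cont_gradient \<eta> e" "\<And>i. partial_deriv \<eta> i = (\<lambda>x. e x \<bullet> i)"
    and K: "compact K" "\<And>x. x \<notin> K \<Longrightarrow> \<eta> x = 0" using test_functionE[of \<eta>] by metis
  have e0: "e x = 0" if "x \<notin> K" for x
    using has_cont_gradient_zero_outside[OF e(1) compact_imp_closed[OF K(1)] K(2) that] by auto
  obtain E where E: "E \<ge> 0" "\<And>x. norm (\<eta> x) \<le> E"
    using continuous_compact_support_bounded[OF has_cont_gradient_cont[OF e(1)] K] by metis
  obtain E' where E': "E' \<ge> 0" "\<And>x. norm (e x) \<le> E'"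
    using continuous_compact_support_bounded[OF has_cont_gradient_cont_grad[OF e(1)] K(1) e0] by metis
  have me: "\<eta> \<in> borel_measurable lebesgue" "e \<in> borel_measurable lebesgue"
    by (intro continuous_borel_measurable_lebesgue has_cont_gradient_cont[OF e(1)] has_cont_gradient_cont_grad[OF e(1)])+
  \<comment> \<open>A test function times a fixed coordinate direction is a vector field whose
    divergence is the partial derivative.\<close>
  have Z: "has_cont_divergence (\<lambda>x. \<eta> x *\<^sub>R i) (\<lambda>x. e x \<bullet> i)"
  proof -
    have "has_cont_divergence (\<lambda>x. i) (\<lambda>x. 0)"
      unfolding has_cont_divergence_def
      by (rule exI[of _ "\<lambda>i x. 0"]) (auto simp: has_cont_gradient_const)
    from has_cont_divergence_scaleR[OF e(1) this] show ?thesis by simp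
  qed
  define B where "B = (\<lambda>k. soft_square (real (Suc k)))"
  define B' where "B' = (\<lambda>k t. squash (real (Suc k)) t + t * squash' (real (Suc k)) t)"
  have D: "(B k has_real_derivative B' k t) (at t)" for k t
    unfolding B_def B'_def soft_square_def[abs_def]
    using DERIV_mult'[OF DERIV_ident squash_deriv[of "real (Suc k)" t]] by (simp add: add.commute)
  have ratio: "t\<^sup>2 * ((real (Suc k))\<^sup>2 / ((real (Suc k))\<^sup>2 + t\<^sup>2)) \<le> (real (Suc k))\<^sup>2" for t k
  proof -
    define N where "N = real (Suc k)"
    have "N > 0" by (simp add: N_def)
    then have "N\<^sup>2 + t\<^sup>2 > 0" by (simp add: add_pos_nonneg)
    then show ?thesis unfolding N_def[symmetric]
      by (simp add: divide_le_eq) (simp add: algebra_simps)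
  qed
  have tsq: "\<bar>t * squash' (real (Suc k)) t\<bar> \<le> real (Suc k)" for t k
  proof -
    let ?r = "(real (Suc k))\<^sup>2 / ((real (Suc k))\<^sup>2 + t\<^sup>2)"
    have "\<bar>t * squash' (real (Suc k)) t\<bar> = \<bar>squash (real (Suc k)) t\<bar> * \<bar>2 * ?r - 1\<bar>"
      by (simp add: squash_def squash'_def abs_mult)
    also have "\<dots> \<le> real (Suc k) * 1"
      using squash_ratio[of "real (Suc k)" t] by (intro mult_mono squash_le) auto
    finally show ?thesis by simp
  qed
  have Bb: "\<bar>B k t\<bar> \<le> 2 * (real (Suc k))\<^sup>2" "\<bar>B' k t\<bar> \<le> 2 * (real (Suc k))\<^sup>2"
    "\<bar>B k t\<bar> \<le> t\<^sup>2" "\<bar>B' k t\<bar> \<le> 2 * \<bar>t\<bar>" for k t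
  proof -
    have eq: "B k t = t\<^sup>2 * ((real (Suc k))\<^sup>2 / ((real (Suc k))\<^sup>2 + t\<^sup>2))"
      by (simp add: B_def soft_square_def squash_def power2_eq_square)
    have nn: "B k t \<ge> 0" unfolding eq by simp
    show "\<bar>B k t\<bar> \<le> 2 * (real (Suc k))\<^sup>2"
      unfolding abs_of_nonneg[OF nn] using ratio[of t k] zero_le_power2[of "real (Suc k)"] unfolding eq by linarith
    show "\<bar>B k t\<bar> \<le> t\<^sup>2"
      unfolding abs_of_nonneg[OF nn] using mult_left_mono[OF squash_ratio(2)[of "real (Suc k)" t], of "t\<^sup>2"] unfolding eq by simp
    have "real (Suc k) * 1 \<le> real (Suc k) * real (Suc k)" by (intro mult_left_mono) auto
    then have N: "real (Suc k) \<le> (real (Suc k))\<^sup>2" by (simp add: power2_eq_square)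
    show "\<bar>B' k t\<bar> \<le> 2 * (real (Suc k))\<^sup>2"
      unfolding B'_def using squash_le[of "real (Suc k)" t] tsq[of t k] N by linarith
    have "\<bar>t * squash' (real (Suc k)) t\<bar> \<le> \<bar>t\<bar> * 1"
      unfolding abs_mult by (intro mult_left_mono squash'_le) auto
    then show "\<bar>B' k t\<bar> \<le> 2 * \<bar>t\<bar>"
      unfolding B'_def using squash_le_abs[of "real (Suc k)" t] by linarith
  qed
  have cB': "continuous_on UNIV (B' k)" and cB: "continuous_on UNIV (B k)" for k
    unfolding B'_def B_def soft_square_def[abs_def]
    by (intro continuous_intros squash_continuous squash'_continuous; simp)+
  \<comment> \<open>The chain rule asks for one constant bounding both factors, and the first factor
    will be the constant 1.\<close>
  have one: "1 \<le> 2 * (real (Suc k))\<^sup>2" for k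
    using one_le_power[of "real (Suc k)" 2] by linarith
  have id: "(LINT x|lebesgue. (\<eta> x *\<^sub>R i) \<bullet> (B' k (f x) *\<^sub>R h x)) = - (LINT x|lebesgue. B k (f x) * (e x \<bullet> i))" for k
    using weak_product_chain_rule(3)[OF f f, where A="\<lambda>_. 1" and A'="\<lambda>_. 0" and b="2 * (real (Suc k))\<^sup>2" and B="B k" and B'="B' k" and Z="\<lambda>x. \<eta> x *\<^sub>R i" and d="\<lambda>x. e x \<bullet> i" and K=K]
      one[of k] Bb[of k] D cB' Z K by auto
  have l1: "(\<lambda>k. LINT x|lebesgue. (\<eta> x *\<^sub>R i) \<bullet> (B' k (f x) *\<^sub>R h x)) \<longlonglongrightarrow> (LINT x|lebesgue. (\<eta> x *\<^sub>R i) \<bullet> ((2 * f x) *\<^sub>R h x))"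
  proof (rule integral_dominated_convergence)
    show "integrable lebesgue (\<lambda>x. E * norm (indicator K x *\<^sub>R ((2 * f x) *\<^sub>R h x)))"
      using p K(1) unfolding locally_integrable_def set_integrable_def
      by (intro integrable_mult_right integrable_norm) simp
    show "AE x in lebesgue. norm ((\<eta> x *\<^sub>R i) \<bullet> (B' k (f x) *\<^sub>R h x)) \<le> E * norm (indicator K x *\<^sub>R ((2 * f x) *\<^sub>R h x))" for k
    proof (intro AE_I2)
      fix x
      show "norm ((\<eta> x *\<^sub>R i) \<bullet> (B' k (f x) *\<^sub>R h x)) \<le> E * norm (indicator K x *\<^sub>R ((2 * f x) *\<^sub>R h x))"
      proof (cases "x \<in> K")
        case True
        have "norm ((\<eta> x *\<^sub>R i) \<bullet> (B' k (f x) *\<^sub>R h x)) \<le> norm (\<eta> x *\<^sub>R i) * norm (B' k (f x) *\<^sub>R h x)"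
          by (metis Cauchy_Schwarz_ineq2 real_norm_def)
        also have "\<dots> = norm (\<eta> x) * (\<bar>B' k (f x)\<bar> * norm (h x))" using i by simp
        also have "\<dots> \<le> E * ((2 * \<bar>f x\<bar>) * norm (h x))"
          by (intro mult_mono E Bb) (auto simp: E)
        finally show ?thesis using True by (simp add: abs_mult)
      qed (use K in simp)
    qed
    show "AE x in lebesgue. (\<lambda>k. (\<eta> x *\<^sub>R i) \<bullet> (B' k (f x) *\<^sub>R h x)) \<longlonglongrightarrow> (\<eta> x *\<^sub>R i) \<bullet> ((2 * f x) *\<^sub>R h x)"
    proof (intro AE_I2 tendsto_inner tendsto_const tendsto_scaleR)
      fix x
      have "(\<lambda>k. B' k (f x)) \<longlonglongrightarrow> f x + f x * 1"
        unfolding B'_def by (intro tendsto_add tendsto_mult tendsto_const squash_tendsto squash'_tendsto)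
      then show "(\<lambda>k. B' k (f x)) \<longlonglongrightarrow> 2 * f x" by simp
    qed
    show "(\<lambda>x. (\<eta> x *\<^sub>R i) \<bullet> (B' k (f x) *\<^sub>R h x)) \<in> borel_measurable lebesgue" for k
      using me mf measurable_compose[OF mf(1) borel_measurable_continuous_onI[OF cB'[of k]]] by measurable
    show "(\<lambda>x. (\<eta> x *\<^sub>R i) \<bullet> ((2 * f x) *\<^sub>R h x)) \<in> borel_measurable lebesgue"
      using me mf by measurable
  qed
  have l2: "(\<lambda>k. LINT x|lebesgue. B k (f x) * (e x \<bullet> i)) \<longlonglongrightarrow> (LINT x|lebesgue. (f x)\<^sup>2 * (e x \<bullet> i))"
  proof (rule integral_dominated_convergence)
    show "integrable lebesgue (\<lambda>x. E' * norm (indicator K x *\<^sub>R (f x)\<^sup>2))"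
      using f2 K(1) unfolding locally_integrable_def set_integrable_def
      by (intro integrable_mult_right integrable_norm) simp
    show "AE x in lebesgue. norm (B k (f x) * (e x \<bullet> i)) \<le> E' * norm (indicator K x *\<^sub>R (f x)\<^sup>2)" for k
    proof (intro AE_I2)
      fix x
      show "norm (B k (f x) * (e x \<bullet> i)) \<le> E' * norm (indicator K x *\<^sub>R (f x)\<^sup>2)"
      proof (cases "x \<in> K")
        case True
        have "norm (B k (f x) * (e x \<bullet> i)) = \<bar>e x \<bullet> i\<bar> * \<bar>B k (f x)\<bar>" by (simp add: abs_mult)
        also have "\<dots> \<le> E' * (f x)\<^sup>2"
          using order_trans[OF Basis_le_norm[OF i] E'(2)] by (intro mult_mono Bb E') auto
        finally show ?thesis using True by simp
      qed (use e0 in simp)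
    qed
    show "AE x in lebesgue. (\<lambda>k. B k (f x) * (e x \<bullet> i)) \<longlonglongrightarrow> (f x)\<^sup>2 * (e x \<bullet> i)"
      unfolding B_def soft_square_def power2_eq_square
      by (intro AE_I2 tendsto_mult tendsto_const squash_tendsto)
    show "(\<lambda>x. B k (f x) * (e x \<bullet> i)) \<in> borel_measurable lebesgue" for k
      using me mf measurable_compose[OF mf(1) borel_measurable_continuous_onI[OF cB[of k]]] by measurable
    show "(\<lambda>x. (f x)\<^sup>2 * (e x \<bullet> i)) \<in> borel_measurable lebesgue"
      using me mf by measurable
  qed
  have "(LINT x|lebesgue. (\<eta> x *\<^sub>R i) \<bullet> ((2 * f x) *\<^sub>R h x)) = - (LINT x|lebesgue. (f x)\<^sup>2 * (e x \<bullet> i))"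
    using LIMSEQ_unique[OF l1[unfolded id] tendsto_minus[OF l2]] .
  then have "(LINT x|lebesgue. (f x)\<^sup>2 * (e x \<bullet> i)) = - (LINT x|lebesgue. (\<eta> x *\<^sub>R i) \<bullet> ((2 * f x) *\<^sub>R h x))" by simp
  also have "(LINT x|lebesgue. (\<eta> x *\<^sub>R i) \<bullet> ((2 * f x) *\<^sub>R h x)) = (LINT x|lebesgue. ((2 * f x) *\<^sub>R h x) \<bullet> i * \<eta> x)"
    by (rule Bochner_Integration.integral_cong) (auto simp: inner_commute mult_ac)
  finally show "(LINT x|lebesgue. (f x)\<^sup>2 * partial_deriv \<eta> i x) = - (LINT x|lebesgue. ((2 * f x) *\<^sub>R h x) \<bullet> i * \<eta> x)"
    by (simp add: e(2))
qed

subsection \<open>The Hardy inequality for bounded functions with compact support\<close>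

text \<open>Completing the square: \<open>M\<close>, \<open>p\<close>, \<open>L\<close>, \<open>H\<close> stand for the mollified density, its gradient, its
  Laplacian and the mollified \<open>|\<nabla>\<surd>\<mu>|\<^sup>2\<close>, and \<open>\<tau> = m / (m + M)\<close> keeps \<open>\<tau> M\<close> bounded.\<close>

lemma completed_square:
  fixes u p X q e Y G :: "'a::real_inner" and M L H m a f \<eta> b dX :: real
  assumes quad: "\<And>v s. 0 \<le> M * (v \<bullet> v) + s * (v \<bullet> p) + s\<^sup>2 * H"
    and M: "M \<ge> 0" and m: "m > 0"
    and b: "b \<le> a * dX - a\<^sup>2 * (X \<bullet> X)" "a\<^sup>2 * (X \<bullet> X) \<le> b"
    and G: "G = (1/2) *\<^sub>R p + (a * M) *\<^sub>R X" and Y: "Y = (m / (m + M)) *\<^sub>R G"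
    and u: "u = \<eta> *\<^sub>R q + f *\<^sub>R e"
  shows "(\<eta> * f)\<^sup>2 * ((m / (m + M)) * (L / 2 - H + M * b)
            - (m / (m + M)) * (M / (m + M)) * (4 * H + b * M))
    \<le> (m / (m + M)) * M * (u \<bullet> u) + ((\<eta>\<^sup>2 *\<^sub>R Y) \<bullet> ((2 * f) *\<^sub>R q)
       + f\<^sup>2 * ((2 * \<eta>) *\<^sub>R e \<bullet> Y + \<eta>\<^sup>2 *
          ((- m / (m + M)\<^sup>2) *\<^sub>R p \<bullet> G + (m / (m + M)) * (L / 2 + (a *\<^sub>R p) \<bullet> X + a * M * dX))))"
proof -
  define \<tau> where "\<tau> = m / (m + M)"
  define \<psi> where "\<psi> = \<eta> * f"
  have \<tau>: "\<tau> \<ge> 0" using m M by (simp add: \<tau>_def)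
  have MM: "m + M > 0" using m M by simp
  have chi': "(- m / (m + M)\<^sup>2) = - (\<tau> / (m + M))"
    using MM by (simp add: \<tau>_def power2_eq_square)
  \<comment> \<open>The discriminant of a nonnegative quadratic form. For \<open>M = 0\<close> the
    form is affine in \<open>v\<close>, which forces \<open>p = 0\<close>.\<close>
  have pp: "p \<bullet> p \<le> 4 * M * H"
  proof (cases "M = 0")
    case True
    have "p \<bullet> p = 0"
    proof (rule ccontr)
      assume "p \<bullet> p \<noteq> 0"
      then have "p \<bullet> p > 0" by simp
      then have "0 \<le> ((- (H + 1) / (p \<bullet> p)) *\<^sub>R p) \<bullet> p + H"
        using quad[of "(- (H + 1) / (p \<bullet> p)) *\<^sub>R p" 1] True by simp
      then show False using \<open>p \<bullet> p > 0\<close> by simp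
    qed
    then show ?thesis using True by simp
  next
    case False
    then have "M > 0" using M by simp
    have "0 \<le> M * (((- 1 / (2 * M)) *\<^sub>R p) \<bullet> ((- 1 / (2 * M)) *\<^sub>R p)) + ((- 1 / (2 * M)) *\<^sub>R p) \<bullet> p + H"
      using quad[of "(- 1 / (2 * M)) *\<^sub>R p" 1] by simp
    also have "\<dots> = H - (p \<bullet> p) / (4 * M)"
      using \<open>M > 0\<close> by (simp add: field_simps)
    finally show ?thesis using \<open>M > 0\<close> by (simp add: field_simps)
  qed
  have H: "H \<ge> 0" using quad[of 0 1] by simp
  \<comment> \<open>Young's inequality for \<open>p\<close> and \<open>a M X\<close>.\<close>
  have pX: "a * M * (p \<bullet> X) \<le> (p \<bullet> p) / 2 + M * (M * b)"
  proof -
    have "0 \<le> (p - (a * M) *\<^sub>R X) \<bullet> (p - (a * M) *\<^sub>R X)" by simp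
    also have "\<dots> = p \<bullet> p - 2 * (a * M * (p \<bullet> X)) + M * (M * (a\<^sup>2 * (X \<bullet> X)))"
      by (simp add: inner_diff_left inner_diff_right inner_commute power2_eq_square algebra_simps)
    finally have "2 * (a * M * (p \<bullet> X)) \<le> p \<bullet> p + M * (M * (a\<^sup>2 * (X \<bullet> X)))" by simp
    also have "M * (M * (a\<^sup>2 * (X \<bullet> X))) \<le> M * (M * b)"
      using M b(2) by (intro mult_left_mono) auto
    finally have *: "2 * (a * M * (p \<bullet> X)) \<le> p \<bullet> p + M * (M * b)" by simp
    have "0 \<le> M * (M * b)" using M b(2) order_trans[of 0 "a\<^sup>2 * (X \<bullet> X)" b] by simp
    then show ?thesis using * by simp
  qed
  \<comment> \<open>The factor \<open>M\<close> in front matters: with the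
    \<open>1 / (m + M)\<close> coming from the derivative of \<open>\<tau>\<close> it forms the
    ratio that vanishes as \<open>m\<close> grows.\<close>
  have pG: "p \<bullet> G \<le> M * (4 * H + b * M)"
  proof -
    have "p \<bullet> G = (p \<bullet> p) / 2 + a * M * (p \<bullet> X)"
      by (simp add: G inner_add_right)
    also have "\<dots> \<le> p \<bullet> p + M * (M * b)" using pX by simp
    also have "\<dots> \<le> M * (4 * H + b * M)" using pp by (simp add: algebra_simps)
    finally show ?thesis .
  qed
  \<comment> \<open>The form at \<open>v = u + a \<psi> X\<close> and \<open>s = \<psi>\<close> is
    the mollified counterpart of \<open>|\<rho> (u + a \<psi> X) + \<psi> \<nabla>\<rho>|^2\<close>,
    that is, the completed square without any division by \<open>M\<close>.\<close>
  have sq: "0 \<le> M * (u \<bullet> u) + 2 * \<psi> * (u \<bullet> G) + \<psi>\<^sup>2 * (a * (p \<bullet> X) + M * (a\<^sup>2 * (X \<bullet> X)) + H)"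
  proof -
    have "0 \<le> M * ((u + (a * \<psi>) *\<^sub>R X) \<bullet> (u + (a * \<psi>) *\<^sub>R X)) + \<psi> * ((u + (a * \<psi>) *\<^sub>R X) \<bullet> p) + \<psi>\<^sup>2 * H"
      by (rule quad)
    also have "\<dots> = M * (u \<bullet> u) + 2 * \<psi> * (u \<bullet> G) + \<psi>\<^sup>2 * (a * (p \<bullet> X) + M * (a\<^sup>2 * (X \<bullet> X)) + H)"
      by (simp add: G inner_add_left inner_add_right inner_commute power2_eq_square algebra_simps)
    finally show ?thesis .
  qed
  have Y': "Y = \<tau> *\<^sub>R G" by (simp add: Y \<tau>_def)
  have cross: "(\<eta>\<^sup>2 *\<^sub>R Y) \<bullet> ((2 * f) *\<^sub>R q) + f\<^sup>2 * ((2 * \<eta>) *\<^sub>R e \<bullet> Y) = \<tau> * (2 * \<psi> * (u \<bullet> G))"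
    by (simp add: Y' u \<psi>_def inner_add_left inner_commute power2_eq_square algebra_simps)
  have rhs: "\<tau> * M * (u \<bullet> u) + ((\<eta>\<^sup>2 *\<^sub>R Y) \<bullet> ((2 * f) *\<^sub>R q)
       + f\<^sup>2 * ((2 * \<eta>) *\<^sub>R e \<bullet> Y + \<eta>\<^sup>2 *
          ((- m / (m + M)\<^sup>2) *\<^sub>R p \<bullet> G + \<tau> * (L / 2 + (a *\<^sub>R p) \<bullet> X + a * M * dX))))
    = \<tau> * (M * (u \<bullet> u)) + \<tau> * (2 * \<psi> * (u \<bullet> G)) +
      \<psi>\<^sup>2 * (\<tau> * (L / 2 + a * (p \<bullet> X) + M * (a * dX)) - (\<tau> / (m + M)) * (p \<bullet> G))"
  proof -
    have "f\<^sup>2 * ((2 * \<eta>) *\<^sub>R e \<bullet> Y + \<eta>\<^sup>2 *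
          ((- m / (m + M)\<^sup>2) *\<^sub>R p \<bullet> G + \<tau> * (L / 2 + (a *\<^sub>R p) \<bullet> X + a * M * dX)))
      = f\<^sup>2 * ((2 * \<eta>) *\<^sub>R e \<bullet> Y) + \<psi>\<^sup>2 * (\<tau> * (L / 2 + a * (p \<bullet> X) + M * (a * dX)) - (\<tau> / (m + M)) * (p \<bullet> G))"
      unfolding chi' by (simp add: \<psi>_def power_mult_distrib algebra_simps)
    then show ?thesis using cross by simp
  qed
  have "(\<tau> / (m + M)) * (p \<bullet> G) \<le> (\<tau> / (m + M)) * (M * (4 * H + b * M))"
    using pG \<tau> MM by (intro mult_left_mono) auto
  then have 1: "(\<tau> / (m + M)) * (p \<bullet> G) \<le> \<tau> * (M / (m + M)) * (4 * H + b * M)" by simp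
  have 2: "M * b \<le> M * (a * dX - a\<^sup>2 * (X \<bullet> X))"
    using M b(1) by (intro mult_left_mono) auto
  have "\<tau> * (L / 2 - H + M * b) \<le> \<tau> * (L / 2 - H + M * (a * dX - a\<^sup>2 * (X \<bullet> X)))"
    using 2 \<tau> by (intro mult_left_mono) auto
  with 1 have "\<psi>\<^sup>2 * (\<tau> * (L / 2 - H + M * b) - \<tau> * (M / (m + M)) * (4 * H + b * M))
    \<le> \<psi>\<^sup>2 * (\<tau> * (L / 2 - H + M * (a * dX - a\<^sup>2 * (X \<bullet> X))) - (\<tau> / (m + M)) * (p \<bullet> G))"
    by (intro mult_left_mono) auto
  also have "\<dots> \<le> \<tau> * (M * (u \<bullet> u)) + \<tau> * (2 * \<psi> * (u \<bullet> G)) +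
      \<psi>\<^sup>2 * (\<tau> * (L / 2 + a * (p \<bullet> X) + M * (a * dX)) - (\<tau> / (m + M)) * (p \<bullet> G))"
    using mult_left_mono[OF sq \<tau>] by (simp add: algebra_simps)
  also note rhs[symmetric]
  finally show ?thesis unfolding \<tau>_def \<psi>_def .
qed

section \<open>The regularised radial field\<close>

lemma radial_field_divergence:
  fixes \<epsilon> :: real
  assumes "\<epsilon> > 0"
  shows "has_cont_divergence (\<lambda>x::'a::euclidean_space. (1 / (x \<bullet> x + \<epsilon>)) *\<^sub>R x)
    (\<lambda>x. real DIM('a) / (x \<bullet> x + \<epsilon>) - 2 * (x \<bullet> x) / (x \<bullet> x + \<epsilon>)\<^sup>2)"
proof -
  have pos: "x \<bullet> x + \<epsilon> > 0" for x :: 'a using assms by (simp add: add_nonneg_pos)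
  have g: "has_cont_gradient (\<lambda>x::'a. 1 / (x \<bullet> x + \<epsilon>)) (\<lambda>x. (- 1 / (x \<bullet> x + \<epsilon>)\<^sup>2) *\<^sub>R (2 *\<^sub>R x))"
  proof (rule has_cont_gradient_compose[OF has_cont_gradient_inner_self, where F="\<lambda>s. 1 / (s + \<epsilon>)" and F'="\<lambda>s. - 1 / (s + \<epsilon>)\<^sup>2"])
    show "((\<lambda>s. 1 / (s + \<epsilon>)) has_real_derivative - 1 / (x \<bullet> x + \<epsilon>)\<^sup>2) (at (x \<bullet> x))" for x :: 'a
      using pos[of x] by (auto intro!: derivative_eq_intros simp: power2_eq_square)
    show "continuous_on (range (\<lambda>x::'a. x \<bullet> x)) (\<lambda>s. - 1 / (s + \<epsilon>)\<^sup>2)"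
      using pos by (intro continuous_intros) (auto simp: less_imp_neq[symmetric] dest: less_imp_neq)
  qed
  have id: "has_cont_divergence (\<lambda>x::'a. x) (\<lambda>x. real DIM('a))"
    unfolding has_cont_divergence_def
    by (rule exI[of _ "\<lambda>i x. i"]) (auto simp: has_cont_gradient_inner_left)
  have "(\<lambda>x::'a. (- 1 / (x \<bullet> x + \<epsilon>)\<^sup>2) *\<^sub>R (2 *\<^sub>R x) \<bullet> x + 1 / (x \<bullet> x + \<epsilon>) * real DIM('a)) =
    (\<lambda>x. real DIM('a) / (x \<bullet> x + \<epsilon>) - 2 * (x \<bullet> x) / (x \<bullet> x + \<epsilon>)\<^sup>2)"
    by (rule ext) simp
  then show ?thesis using has_cont_divergence_scaleR[OF g id] by simp
qed

text \<open>Since \<open>N = 2 a + 2\<close>, the coefficients satisfy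
  \<open>a N - 2 a - a^2 = a^2\<close>. Replacing \<open>s / (s + \<epsilon>)^2\<close> by the
  larger \<open>1 / (s + \<epsilon>)\<close> costs nothing as \<open>\<epsilon>\<close> tends to
  zero.\<close>

lemma radial_field_bounds:
  fixes s \<epsilon> N a :: real
  assumes "\<epsilon> > 0" "s \<ge> 0" "N \<ge> 2" "a = (N - 2) / 2"
  shows "a\<^sup>2 / (s + \<epsilon>) \<le> a * (N / (s + \<epsilon>) - 2 * s / (s + \<epsilon>)\<^sup>2) - a\<^sup>2 * (s / (s + \<epsilon>)\<^sup>2)"
    and "a\<^sup>2 * (s / (s + \<epsilon>)\<^sup>2) \<le> a\<^sup>2 / (s + \<epsilon>)"
proof -
  have d: "s + \<epsilon> > 0" using assms by simp
  have r: "s / (s + \<epsilon>)\<^sup>2 \<le> 1 / (s + \<epsilon>)"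
    using d assms by (simp add: divide_simps power2_eq_square)
  have a: "a \<ge> 0" using assms by simp
  show "a\<^sup>2 * (s / (s + \<epsilon>)\<^sup>2) \<le> a\<^sup>2 / (s + \<epsilon>)"
    using mult_left_mono[OF r, of "a\<^sup>2"] by simp
  have "(2 * a + a\<^sup>2) * (s / (s + \<epsilon>)\<^sup>2) \<le> (2 * a + a\<^sup>2) * (1 / (s + \<epsilon>))"
    using a r by (intro mult_left_mono) auto
  moreover have "a * N * (1 / (s + \<epsilon>)) - (2 * a + a\<^sup>2) * (1 / (s + \<epsilon>)) = a\<^sup>2 * (1 / (s + \<epsilon>))"
  proof -
    have "N = 2 * a + 2" using assms(4) by simp
    then have "a * N - (2 * a + a\<^sup>2) = a\<^sup>2" by (simp add: power2_eq_square algebra_simps)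
    then show ?thesis by (simp only: left_diff_distrib[symmetric])
  qed
  moreover have "a * (N / (s + \<epsilon>) - 2 * s / (s + \<epsilon>)\<^sup>2) - a\<^sup>2 * (s / (s + \<epsilon>)\<^sup>2)
    = a * N * (1 / (s + \<epsilon>)) - (2 * a + a\<^sup>2) * (s / (s + \<epsilon>)\<^sup>2)"
    by (simp add: algebra_simps)
  ultimately show "a\<^sup>2 / (s + \<epsilon>) \<le> a * (N / (s + \<epsilon>) - 2 * s / (s + \<epsilon>)\<^sup>2) - a\<^sup>2 * (s / (s + \<epsilon>)\<^sup>2)"
    by simp
qed

text \<open>The weight is \<open>\<rho>^2\<close>. Taking \<open>\<rho>\<close> and its gradient
  \<open>h\<close> as data lets \<open>|h|^2\<close> stand for
  \<open>|\<nabla>\<mu>|^2 / (4 \<mu>)\<close>, so that nothing is divided by the weight.\<close>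

locale sobolev_weight =
  fixes \<rho> :: "'a::euclidean_space \<Rightarrow> real" and h :: "'a \<Rightarrow> 'a" and l :: "'a \<Rightarrow> real" and a :: real
  assumes dim: "DIM('a) \<ge> 3"
    and a_eq: "a = (real DIM('a) - 2) / 2"
    and grad: "has_weak_gradient \<rho> h"
    and sq: "locally_integrable lebesgue (\<lambda>x. (\<rho> x)\<^sup>2)"
    and gradsq: "locally_integrable lebesgue (\<lambda>x. (norm (h x))\<^sup>2)"
    and lap: "has_weak_laplacian (\<lambda>x. (\<rho> x)\<^sup>2) l"
begin

lemma grad2: "has_weak_gradient (\<lambda>x. (\<rho> x)\<^sup>2) (\<lambda>x. (2 * \<rho> x) *\<^sub>R h x)"
  by (rule has_weak_gradient_square[OF grad sq gradsq])

lemma lint_p: "locally_integrable lebesgue (\<lambda>x. (2 * \<rho> x) *\<^sub>R h x)"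
  using grad2 by (auto simp: has_weak_gradient_def)

lemma lint_l: "locally_integrable lebesgue l"
  using lap by (auto simp: has_weak_laplacian_def)

text \<open>The square \<open>|\<rho> v + s h|^2\<close>, with \<open>v\<close> and \<open>s\<close>
  frozen, is mollified. This is the convexity bound on \<open>|\<nabla>M|^2 / (4 M)\<close> in a
  form that makes sense where \<open>M = 0\<close>.\<close>

lemma mollified_quadratic_form_nonneg:
  "0 \<le> mollify n (\<lambda>x. (\<rho> x)\<^sup>2) x * (v \<bullet> v) + s * (v \<bullet> mollify n (\<lambda>x. (2 * \<rho> x) *\<^sub>R h x) x)
     + s\<^sup>2 * mollify n (\<lambda>x. (norm (h x))\<^sup>2) x"
proof -
  let ?k = "\<lambda>y. mollifier n (x - y)"
  note i1 = integrable_mollifier_mult[OF sq, of n x]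
  note i2 = integrable_mollifier_mult[OF locally_integrable_inner[OF lint_p, of v], of n x]
  note i3 = integrable_mollifier_mult[OF gradsq, of n x]
  have "0 \<le> (LINT y|lebesgue. ?k y * ((\<rho> y *\<^sub>R v + s *\<^sub>R h y) \<bullet> (\<rho> y *\<^sub>R v + s *\<^sub>R h y)))"
    by (rule integral_nonneg_AE) (simp add: mollifier_nonneg)
  also have "\<dots> = (LINT y|lebesgue. (v \<bullet> v) * (?k y *\<^sub>R (\<rho> y)\<^sup>2) + s * (?k y *\<^sub>R (((2 * \<rho> y) *\<^sub>R h y) \<bullet> v)) + s\<^sup>2 * (?k y *\<^sub>R (norm (h y))\<^sup>2))"
    unfolding power2_norm_eq_inner
    by (rule Bochner_Integration.integral_cong)
      (auto simp: inner_add_left inner_add_right inner_commute power2_eq_square algebra_simps)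
  also have "\<dots> = (v \<bullet> v) * (LINT y|lebesgue. ?k y *\<^sub>R (\<rho> y)\<^sup>2) + s * (LINT y|lebesgue. ?k y *\<^sub>R (((2 * \<rho> y) *\<^sub>R h y) \<bullet> v)) + s\<^sup>2 * (LINT y|lebesgue. ?k y *\<^sub>R (norm (h y))\<^sup>2)"
    using i1 i2 i3 by (simp only: Bochner_Integration.integral_add Bochner_Integration.integrable_add integrable_mult_right integral_mult_right_zero)
  also have "\<dots> = mollify n (\<lambda>x. (\<rho> x)\<^sup>2) x * (v \<bullet> v) + s * (v \<bullet> mollify n (\<lambda>x. (2 * \<rho> x) *\<^sub>R h x) x)
     + s\<^sup>2 * mollify n (\<lambda>x. (norm (h x))\<^sup>2) x"
    unfolding inner_commute[of v "mollify n _ x"] mollify_inner[OF lint_p]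
    unfolding mollify_def by (simp add: mult.commute)
  finally show ?thesis .
qed

text \<open>The hypothesis on \<open>f\<close> and \<open>q\<close> is the weak form of \<open>\<nabla>(f\<^sup>2) = 2 f q\<close>.\<close>

lemma inequality_with_cutoff:
  fixes f \<eta> :: "'a \<Rightarrow> real" and q e :: "'a \<Rightarrow> 'a" and m \<epsilon> :: real
  assumes m: "m > 0" and eps: "\<epsilon> > 0"
    and eta: "has_cont_gradient \<eta> e" and K: "compact K" "\<And>x. x \<notin> K \<Longrightarrow> \<eta> x = 0"
    and f: "f \<in> borel_measurable lebesgue" "\<And>x. \<bar>f x\<bar> \<le> F"
    and q: "q \<in> borel_measurable lebesgue" "locally_integrable lebesgue (\<lambda>x. (norm (q x))\<^sup>2)"
    and chain: "\<And>Z d K. has_cont_divergence Z d \<Longrightarrow> compact K \<Longrightarrow> (\<And>x. x \<notin> K \<Longrightarrow> Z x = 0) \<Longrightarrow>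
      integrable lebesgue (\<lambda>x. Z x \<bullet> ((2 * f x) *\<^sub>R q x)) \<and> integrable lebesgue (\<lambda>x. (f x)\<^sup>2 * d x) \<and>
      (LINT x|lebesgue. Z x \<bullet> ((2 * f x) *\<^sub>R q x)) = - (LINT x|lebesgue. (f x)\<^sup>2 * d x)"
  defines "u \<equiv> \<lambda>x. \<eta> x *\<^sub>R q x + f x *\<^sub>R e x"
    and "\<psi> \<equiv> \<lambda>x. \<eta> x * f x"
    and "\<tau> \<equiv> \<lambda>t. m / (m + t)" and "\<theta> \<equiv> \<lambda>t. t / (m + t)"
  shows "(LINT x|lebesgue. (\<psi> x)\<^sup>2 * \<tau> ((\<rho> x)\<^sup>2) / 2 * l x)
      + (LINT x|lebesgue. - (\<psi> x)\<^sup>2 * \<tau> ((\<rho> x)\<^sup>2) * (1 + 4 * \<theta> ((\<rho> x)\<^sup>2)) * (norm (h x))\<^sup>2)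
      + (LINT x|lebesgue. (\<psi> x)\<^sup>2 * \<tau> ((\<rho> x)\<^sup>2) * (1 - \<theta> ((\<rho> x)\<^sup>2)) * (a\<^sup>2 / (x \<bullet> x + \<epsilon>)) * (\<rho> x)\<^sup>2)
      \<le> (LINT x|lebesgue. \<tau> ((\<rho> x)\<^sup>2) * (\<rho> x)\<^sup>2 * (norm (u x))\<^sup>2)" (is "?R1 + ?R2 + ?R3 \<le> ?L")
proof -
  define \<mu> where "\<mu> = (\<lambda>x. (\<rho> x)\<^sup>2)"
  define P where "P = (\<lambda>x. (2 * \<rho> x) *\<^sub>R h x)"
  define H where "H = (\<lambda>x. (norm (h x))\<^sup>2)"
  have lm: "locally_integrable lebesgue \<mu>" and lP: "locally_integrable lebesgue P"
    and lH: "locally_integrable lebesgue H" and gm: "has_weak_gradient \<mu> P" and lapm: "has_weak_laplacian \<mu> l"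
    using sq lint_p gradsq grad2 lap by (simp_all add: \<mu>_def P_def H_def)
  \<comment> \<open>Almost everywhere convergence is extracted for the weight, which enters the
    coefficients nonlinearly; the mollified Laplacian and the mollified \<open>|h|^2\<close> enter
    linearly and converge in local \<open>L^1\<close>.\<close>
  obtain r where r: "strict_mono (r::nat\<Rightarrow>nat)" "AE x in lebesgue. x \<in> K \<longrightarrow> (\<lambda>n. mollify (id (r n)) \<mu> x) \<longlonglongrightarrow> \<mu> x"
    using mollify_AE_subseq[OF lm K(1) strict_mono_id] by blast
  define M where "M = (\<lambda>n. mollify (r n) \<mu>)"
  define p where "p = (\<lambda>n. mollify (r n) P)"
  define Hn where "Hn = (\<lambda>n. mollify (r n) H)"
  define L where "L = (\<lambda>n. mollify (r n) l)"
  have limM: "AE x in lebesgue. x \<in> K \<longrightarrow> (\<lambda>n. M n x) \<longlonglongrightarrow> \<mu> x"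
    using r(2) by (simp add: M_def)
  have M0: "M n x \<ge> 0" for n x unfolding M_def by (rule mollify_nonneg) (simp add: \<mu>_def)
  have mu0: "\<mu> x \<ge> 0" for x by (simp add: \<mu>_def)
  have \<tau>b: "0 \<le> \<tau> t" "\<tau> t \<le> 1" and \<theta>b: "0 \<le> \<theta> t" "\<theta> t \<le> 1" and \<tau>t: "\<tau> t * t \<le> m" if "t \<ge> 0" for t
    using that m by (auto simp: \<tau>_def \<theta>_def divide_le_eq)
  have \<tau>lim: "(\<lambda>n. \<tau> (w n)) \<longlonglongrightarrow> \<tau> y" "(\<lambda>n. \<theta> (w n)) \<longlonglongrightarrow> \<theta> y" if "w \<longlonglongrightarrow> y" "y \<ge> 0" for w y
    unfolding \<tau>_def \<theta>_def using that m by (auto intro!: tendsto_intros)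
  have e0: "e x = 0" if "x \<notin> K" for x
    using has_cont_gradient_zero_outside[OF eta compact_imp_closed[OF K(1)] K(2) that] by auto
  obtain E where E: "E \<ge> 0" "\<And>x. norm (\<eta> x) \<le> E"
    using continuous_compact_support_bounded[OF has_cont_gradient_cont[OF eta] K] by metis
  obtain E' where E': "E' \<ge> 0" "\<And>x. norm (e x) \<le> E'"
    using continuous_compact_support_bounded[OF has_cont_gradient_cont_grad[OF eta] K(1) e0] by metis
  have F0: "F \<ge> 0" using order_trans[OF abs_ge_zero f(2)] by blast
  have me [measurable]: "\<eta> \<in> borel_measurable lebesgue" "e \<in> borel_measurable lebesgue"
    by (intro continuous_borel_measurable_lebesgue has_cont_gradient_cont[OF eta] has_cont_gradient_cont_grad[OF eta])+
  note [measurable] = f(1) q(1)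
  have mmu [measurable]: "\<mu> \<in> borel_measurable lebesgue" "M n \<in> borel_measurable lebesgue" for n
    unfolding M_def by (intro locally_integrable_measurable[OF lm] mollify_measurable[OF lm])+
  have mchi: "(\<lambda>x. \<tau> (w x)) \<in> borel_measurable lebesgue" "(\<lambda>x. \<theta> (w x)) \<in> borel_measurable lebesgue"
    if "w \<in> borel_measurable lebesgue" for w
    unfolding \<tau>_def \<theta>_def using that by measurable
  have mpsi [measurable]: "\<psi> \<in> borel_measurable lebesgue" "u \<in> borel_measurable lebesgue"
    unfolding \<psi>_def u_def by measurable
  have \<psi>b: "(\<psi> x)\<^sup>2 \<le> (E * F)\<^sup>2" and \<psi>0: "x \<notin> K \<Longrightarrow> \<psi> x = 0" for x
  proof -
    have "\<bar>\<psi> x\<bar> \<le> E * F" unfolding \<psi>_def abs_mult using E f(2) by (intro mult_mono) auto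
    then show "(\<psi> x)\<^sup>2 \<le> (E * F)\<^sup>2" by (metis abs_ge_zero power2_abs power_mono)
  qed (use K in \<open>simp add: \<psi>_def\<close>)
  \<comment> \<open>On \<open>K\<close> the factors \<open>\<eta>\<close>, \<open>f\<close> and
    \<open>e\<close> are bounded, so square integrability of \<open>u\<close> comes from that of
    \<open>q\<close>.\<close>
  have ui: "integrable lebesgue (\<lambda>x. (norm (u x))\<^sup>2)"
  proof (rule Bochner_Integration.integrable_bound)
    have "integrable lebesgue (\<lambda>x. indicator K x *\<^sub>R (norm (q x))\<^sup>2)"
      using q(2) K(1) by (simp add: locally_integrable_def set_integrable_def)
    moreover have "integrable lebesgue (\<lambda>x. indicat_real K x)"
      using integrable_real_indicator[of K lebesgue] lmeasurable_compact[OF K(1)] by (auto simp: fmeasurable_def)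
    ultimately show "integrable lebesgue (\<lambda>x. 2 * (E\<^sup>2 * (indicator K x *\<^sub>R (norm (q x))\<^sup>2) + (F * E')\<^sup>2 * indicator K x))"
      by (intro integrable_mult_right Bochner_Integration.integrable_add)
    show "AE x in lebesgue. norm ((norm (u x))\<^sup>2) \<le> norm (2 * (E\<^sup>2 * (indicator K x *\<^sub>R (norm (q x))\<^sup>2) + (F * E')\<^sup>2 * indicator K x))"
    proof (intro AE_I2)
      fix x
      show "norm ((norm (u x))\<^sup>2) \<le> norm (2 * (E\<^sup>2 * (indicator K x *\<^sub>R (norm (q x))\<^sup>2) + (F * E')\<^sup>2 * indicator K x))"
      proof (cases "x \<in> K")
        case True
        have "norm (u x) \<le> norm (\<eta> x *\<^sub>R q x) + norm (f x *\<^sub>R e x)" unfolding u_def by (rule norm_triangle_ineq)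
        also have "\<dots> = \<bar>\<eta> x\<bar> * norm (q x) + \<bar>f x\<bar> * norm (e x)" by simp
        also have "\<dots> \<le> E * norm (q x) + F * E'"
          using E E' f(2) F0 by (intro add_mono mult_mono mult_right_mono) auto
        finally have "(norm (u x))\<^sup>2 \<le> (E * norm (q x) + F * E')\<^sup>2" by (rule power_mono) simp
        also have "\<dots> \<le> 2 * ((E * norm (q x))\<^sup>2 + (F * E')\<^sup>2)"
          using sum_squares_bound[of "E * norm (q x)" "F * E'"] by (simp add: power2_sum)
        finally show ?thesis using True by (simp add: power_mult_distrib)
      qed (use K e0 in \<open>simp add: u_def\<close>)
    qed
  qed measurable
  let ?b = "\<lambda>x::'a. a\<^sup>2 / (x \<bullet> x + \<epsilon>)"
  have bb: "0 \<le> ?b x" "?b x \<le> a\<^sup>2 / \<epsilon>" for x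
    using eps by (auto intro!: divide_left_mono divide_nonneg_nonneg add_nonneg_nonneg mult_pos_pos add_nonneg_pos)
  have mb [measurable]: "?b \<in> borel_measurable lebesgue"
  proof (rule continuous_borel_measurable_lebesgue)
    have "x \<bullet> x + \<epsilon> \<noteq> 0" for x :: 'a using eps inner_ge_zero[of x] by linarith
    then show "continuous_on UNIV ?b" by (intro continuous_intros) auto
  qed
  \<comment> \<open>The coefficients of the mollified Laplacian, of the mollified
    \<open>|h|^2\<close> and of the weight in \<open>completed_square\<close>, written as
    functionals of the weight so that approximants and limit share one formula.\<close>
  define c1 where "c1 = (\<lambda>w x. (\<psi> x)\<^sup>2 * \<tau> (w x) / 2)"
  define c2 where "c2 = (\<lambda>w x. - (\<psi> x)\<^sup>2 * \<tau> (w x) * (1 + 4 * \<theta> (w x)))"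
  define c3 where "c3 = (\<lambda>w x. (\<psi> x)\<^sup>2 * \<tau> (w x) * (1 - \<theta> (w x)) * ?b x)"
  \<comment> \<open>5 bounds \<open>1 + 4 \<theta>\<close>, and \<open>a^2 / \<epsilon>\<close> is
    the maximum of the regularised potential.\<close>
  define C where "C = 5 * (E * F)\<^sup>2 * (1 + a\<^sup>2 / \<epsilon>)"
  have mc: "c1 w \<in> borel_measurable lebesgue" "c2 w \<in> borel_measurable lebesgue" "c3 w \<in> borel_measurable lebesgue"
    if "w \<in> borel_measurable lebesgue" for w
    unfolding c1_def c2_def c3_def using mchi[OF that] by measurable
  have cb: "norm (c1 w x) \<le> C" "norm (c2 w x) \<le> C" "norm (c3 w x) \<le> C" if "w x \<ge> 0" for w x
  proof -
    note t = \<tau>b[OF that] \<theta>b[OF that]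
    have q0: "0 \<le> a\<^sup>2 / \<epsilon>" using eps by simp
    have "(\<psi> x)\<^sup>2 * \<tau> (w x) \<le> (E * F)\<^sup>2 * 1"
      by (intro mult_mono \<psi>b t) auto
    moreover have "0 \<le> (\<psi> x)\<^sup>2 * \<tau> (w x)" using t by simp
    ultimately have pc: "(\<psi> x)\<^sup>2 * \<tau> (w x) \<le> (E * F)\<^sup>2 * 1" "0 \<le> (\<psi> x)\<^sup>2 * \<tau> (w x)" .
    have D: "(E * F)\<^sup>2 * 1 \<le> (E * F)\<^sup>2 * (1 + a\<^sup>2 / \<epsilon>)" using q0 by (intro mult_left_mono) auto
    show "norm (c1 w x) \<le> C" using pc D by (simp add: c1_def C_def)
    have "(\<psi> x)\<^sup>2 * \<tau> (w x) * (1 + 4 * \<theta> (w x)) \<le> (E * F)\<^sup>2 * 1 * 5"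
      by (rule mult_mono[OF pc(1)]) (use t in auto)
    then show "norm (c2 w x) \<le> C" using D pc t by (simp add: c2_def C_def abs_mult)
    have "(\<psi> x)\<^sup>2 * \<tau> (w x) * (1 - \<theta> (w x)) \<le> (E * F)\<^sup>2 * 1 * 1"
      by (rule mult_mono[OF pc(1)]) (use t in auto)
    then have "(\<psi> x)\<^sup>2 * \<tau> (w x) * (1 - \<theta> (w x)) * ?b x \<le> (E * F)\<^sup>2 * 1 * 1 * (a\<^sup>2 / \<epsilon>)"
      by (rule mult_mono) (use bb in auto)
    also have "\<dots> \<le> (E * F)\<^sup>2 * (1 + a\<^sup>2 / \<epsilon>)" by (simp add: algebra_simps)
    also have "\<dots> \<le> C" using q0 by (simp add: C_def)
    finally have "c3 w x \<le> C" unfolding c3_def .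
    moreover have "0 \<le> c3 w x"
      unfolding c3_def by (intro mult_nonneg_nonneg bb(1)) (use t in auto)
    ultimately show "norm (c3 w x) \<le> C" by simp
  qed
  have c0: "c1 w x = 0" "c2 w x = 0" "c3 w x = 0" if "x \<notin> K" for w x
    using \<psi>0[OF that] by (auto simp: c1_def c2_def c3_def)
  have clim: "AE x in lebesgue. (\<lambda>n. c1 (M n) x) \<longlonglongrightarrow> c1 \<mu> x"
    "AE x in lebesgue. (\<lambda>n. c2 (M n) x) \<longlonglongrightarrow> c2 \<mu> x"
    "AE x in lebesgue. (\<lambda>n. c3 (M n) x) \<longlonglongrightarrow> c3 \<mu> x"
  proof -
    have "AE x in lebesgue. (\<lambda>n. c1 (M n) x) \<longlonglongrightarrow> c1 \<mu> x \<and> (\<lambda>n. c2 (M n) x) \<longlonglongrightarrow> c2 \<mu> x \<and> (\<lambda>n. c3 (M n) x) \<longlonglongrightarrow> c3 \<mu> x"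
      using limM
    proof (elim eventually_mono)
      fix x assume *: "x \<in> K \<longrightarrow> (\<lambda>n. M n x) \<longlonglongrightarrow> \<mu> x"
      show "(\<lambda>n. c1 (M n) x) \<longlonglongrightarrow> c1 \<mu> x \<and> (\<lambda>n. c2 (M n) x) \<longlonglongrightarrow> c2 \<mu> x \<and> (\<lambda>n. c3 (M n) x) \<longlonglongrightarrow> c3 \<mu> x"
      proof (cases "x \<in> K")
        case True
        note cl = \<tau>lim[OF *[rule_format, OF True] mu0]
        show ?thesis unfolding c1_def c2_def c3_def
          by (intro conjI tendsto_divide tendsto_mult tendsto_add tendsto_diff tendsto_const cl) simp
      qed (simp add: c0)
    qed
    then show "AE x in lebesgue. (\<lambda>n. c1 (M n) x) \<longlonglongrightarrow> c1 \<mu> x"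
      "AE x in lebesgue. (\<lambda>n. c2 (M n) x) \<longlonglongrightarrow> c2 \<mu> x"
      "AE x in lebesgue. (\<lambda>n. c3 (M n) x) \<longlonglongrightarrow> c3 \<mu> x"
      by (auto elim!: eventually_mono)
  qed
  have R1: "(\<lambda>n. LINT x|lebesgue. c1 (M n) x \<bullet> L n x) \<longlonglongrightarrow> (LINT x|lebesgue. c1 \<mu> x \<bullet> l x)"
    unfolding L_def by (rule tendsto_integral_mollify[OF lint_l K(1) r(1) mc(1) cb(1) c0(1) clim(1) mc(1)]) (simp_all add: mmu M0)
  have R2: "(\<lambda>n. LINT x|lebesgue. c2 (M n) x \<bullet> Hn n x) \<longlonglongrightarrow> (LINT x|lebesgue. c2 \<mu> x \<bullet> H x)"
    unfolding Hn_def by (rule tendsto_integral_mollify[OF lH K(1) r(1) mc(2) cb(2) c0(2) clim(2) mc(2)]) (simp_all add: mmu M0)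
  have R3: "(\<lambda>n. LINT x|lebesgue. c3 (M n) x \<bullet> M n x) \<longlonglongrightarrow> (LINT x|lebesgue. c3 \<mu> x \<bullet> \<mu> x)"
    unfolding M_def by (rule tendsto_integral_mollify[OF lm K(1) r(1) mc(3) cb(3) c0(3) clim(3)[unfolded M_def] mc(3)])
       (simp_all add: mmu(1) mmu(2)[unfolded M_def] M0[unfolded M_def])
  \<comment> \<open>Here \<open>\<tau>\<close> pays off: the weight times the merely integrable
    \<open>|u|^2\<close> acquires a majorant independent of the weight.\<close>
  have chiMb: "norm (\<tau> t * t * (norm (u x))\<^sup>2) \<le> m * (norm (u x))\<^sup>2" if "t \<ge> 0" for t x
    using \<tau>t[OF that] \<tau>b[OF that] that by (simp add: abs_mult mult_right_mono)
  have mui: "integrable lebesgue (\<lambda>x. m * (norm (u x))\<^sup>2)" using ui by (rule integrable_mult_right)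
  have li: "integrable lebesgue (\<lambda>x. \<tau> (w x) * w x * (norm (u x))\<^sup>2)"
    if "w \<in> borel_measurable lebesgue" "\<And>x. w x \<ge> 0" for w
  proof (rule Bochner_Integration.integrable_bound[OF mui])
    show "(\<lambda>x. \<tau> (w x) * w x * (norm (u x))\<^sup>2) \<in> borel_measurable lebesgue"
      using mchi(1)[OF that(1)] that(1) by measurable
    show "AE x in lebesgue. norm (\<tau> (w x) * w x * (norm (u x))\<^sup>2) \<le> norm (m * (norm (u x))\<^sup>2)"
      using chiMb[OF that(2)] m by (intro AE_I2) (simp add: abs_mult)
  qed
  have LL: "(\<lambda>n. LINT x|lebesgue. \<tau> (M n x) * M n x * (norm (u x))\<^sup>2) \<longlonglongrightarrow> (LINT x|lebesgue. \<tau> (\<mu> x) * \<mu> x * (norm (u x))\<^sup>2)"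
  proof (rule integral_dominated_convergence[OF _ _ mui])
    show "AE x in lebesgue. (\<lambda>n. \<tau> (M n x) * M n x * (norm (u x))\<^sup>2) \<longlonglongrightarrow> \<tau> (\<mu> x) * \<mu> x * (norm (u x))\<^sup>2"
      using limM
    proof (elim eventually_mono)
      fix x assume *: "x \<in> K \<longrightarrow> (\<lambda>n. M n x) \<longlonglongrightarrow> \<mu> x"
      show "(\<lambda>n. \<tau> (M n x) * M n x * (norm (u x))\<^sup>2) \<longlonglongrightarrow> \<tau> (\<mu> x) * \<mu> x * (norm (u x))\<^sup>2"
      proof (cases "x \<in> K")
        case True
        note l = *[rule_format, OF True]
        show ?thesis by (intro tendsto_mult tendsto_const l \<tau>lim(1)[OF l mu0])
      qed (use K e0 in \<open>simp add: u_def\<close>)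
    qed
    show "AE x in lebesgue. norm (\<tau> (M n x) * M n x * (norm (u x))\<^sup>2) \<le> m * (norm (u x))\<^sup>2" for n
      by (intro AE_I2 chiMb M0)
  qed (use borel_measurable_integrable[OF li] mmu M0 mu0 in auto)
  have ineq: "(LINT x|lebesgue. c1 (M n) x \<bullet> L n x) + (LINT x|lebesgue. c2 (M n) x \<bullet> Hn n x) + (LINT x|lebesgue. c3 (M n) x \<bullet> M n x)
      \<le> (LINT x|lebesgue. \<tau> (M n x) * M n x * (norm (u x))\<^sup>2)" for n
  proof -
    let ?X = "\<lambda>x::'a. (1 / (x \<bullet> x + \<epsilon>)) *\<^sub>R x"
    let ?dX = "\<lambda>x::'a. real DIM('a) / (x \<bullet> x + \<epsilon>) - 2 * (x \<bullet> x) / (x \<bullet> x + \<epsilon>)\<^sup>2"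
    have gM: "has_cont_gradient (M n) (p n)" unfolding M_def p_def by (rule mollify_has_cont_gradient[OF gm])
    have dp: "has_cont_divergence (p n) (L n)" unfolding p_def L_def by (rule mollify_has_cont_divergence[OF gm lapm])
    have gchi: "has_cont_gradient (\<lambda>x. \<tau> (M n x)) (\<lambda>x. (- m / (m + M n x)\<^sup>2) *\<^sub>R p n x)"
    proof (rule has_cont_gradient_compose[OF gM, where F'="\<lambda>t. - m / (m + t)\<^sup>2"])
      have nz: "m + M n x \<noteq> 0" for x using M0[of n x] m by linarith
      then show "(\<tau> has_real_derivative - m / (m + M n x)\<^sup>2) (at (M n x))" for x
        unfolding \<tau>_def by (auto intro!: derivative_eq_intros simp: power2_eq_square)
      show "continuous_on (range (M n)) (\<lambda>t. - m / (m + t)\<^sup>2)"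
        using nz by (intro continuous_intros) auto
    qed
    \<comment> \<open>\<open>G\<close> is \<open>M\<close> times the vector
      \<open>\<nabla>M / (2 M) + a X\<close> of the overview, expanded so that no quotient
      remains.\<close>
    define G where "G = (\<lambda>x. (1/2) *\<^sub>R p n x + (a * M n x) *\<^sub>R ?X x)"
    define dG where "dG = (\<lambda>x. L n x / 2 + (a *\<^sub>R p n x) \<bullet> ?X x + a * M n x * ?dX x)"
    have DG: "has_cont_divergence G dG"
    proof -
      have "has_cont_divergence (\<lambda>x. (1/2) *\<^sub>R p n x) (\<lambda>x. L n x / 2)"
        using has_cont_divergence_scaleR[OF has_cont_gradient_const[of "1/2"] dp] by simp
      moreover have "has_cont_gradient (\<lambda>x. a * M n x) (\<lambda>x. a *\<^sub>R p n x)"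
        using has_cont_gradient_mult[OF has_cont_gradient_const[of a] gM] by simp
      note has_cont_divergence_scaleR[OF this radial_field_divergence[OF eps]]
      ultimately show ?thesis unfolding G_def dG_def add.assoc by (rule has_cont_divergence_add)
    qed
    define Y where "Y = (\<lambda>x. \<tau> (M n x) *\<^sub>R G x)"
    define dY where "dY = (\<lambda>x. (- m / (m + M n x)\<^sup>2) *\<^sub>R p n x \<bullet> G x + \<tau> (M n x) * dG x)"
    have DY: "has_cont_divergence Y dY" unfolding Y_def dY_def by (rule has_cont_divergence_scaleR[OF gchi DG])
    have ge2: "has_cont_gradient (\<lambda>x. (\<eta> x)\<^sup>2) (\<lambda>x. (2 * \<eta> x) *\<^sub>R e x)"
    proof -
      have "(\<lambda>x. \<eta> x *\<^sub>R e x + \<eta> x *\<^sub>R e x) = (\<lambda>x. (2 * \<eta> x) *\<^sub>R e x)"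
        by (rule ext) (metis scaleR_2 scaleR_scaleR)
      then show ?thesis
        using has_cont_gradient_mult[OF eta eta] by (simp only: power2_eq_square)
    qed
    define dZ where "dZ = (\<lambda>x. (2 * \<eta> x) *\<^sub>R e x \<bullet> Y x + (\<eta> x)\<^sup>2 * dY x)"
    have DZ: "has_cont_divergence (\<lambda>x. (\<eta> x)\<^sup>2 *\<^sub>R Y x) dZ"
      unfolding dZ_def by (rule has_cont_divergence_scaleR[OF ge2 DY])
    have ch: "integrable lebesgue (\<lambda>x. ((\<eta> x)\<^sup>2 *\<^sub>R Y x) \<bullet> ((2 * f x) *\<^sub>R q x))" "integrable lebesgue (\<lambda>x. (f x)\<^sup>2 * dZ x)"
      "(LINT x|lebesgue. ((\<eta> x)\<^sup>2 *\<^sub>R Y x) \<bullet> ((2 * f x) *\<^sub>R q x)) = - (LINT x|lebesgue. (f x)\<^sup>2 * dZ x)"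
      using chain[OF DZ K(1)] K(2) by auto
    have i1: "integrable lebesgue (\<lambda>x. c1 (M n) x \<bullet> L n x)"
      by (rule locally_integrable_mult_bounded_inner[OF locally_integrable_continuous mc(1) K(1) c0(1) cb(1)])
        (auto simp: L_def mmu M0 intro: mollify_continuous lint_l)
    have i2: "integrable lebesgue (\<lambda>x. c2 (M n) x \<bullet> Hn n x)"
      by (rule locally_integrable_mult_bounded_inner[OF locally_integrable_continuous mc(2) K(1) c0(2) cb(2)])
        (auto simp: Hn_def mmu M0 intro: mollify_continuous lH)
    have i3: "integrable lebesgue (\<lambda>x. c3 (M n) x \<bullet> M n x)"
      by (rule locally_integrable_mult_bounded_inner[OF locally_integrable_continuous mc(3) K(1) c0(3) cb(3)])
        (use gM in \<open>auto simp: mmu M0 intro: has_cont_gradient_cont\<close>)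
    have i4: "integrable lebesgue (\<lambda>x. \<tau> (M n x) * M n x * (norm (u x))\<^sup>2)"
      by (rule li) (auto simp: mmu M0)
    \<comment> \<open>The bracket added on the right has integral zero: this is the weak identity
      \<open>ch\<close> for the field \<open>\<eta>^2 Y\<close>.\<close>
    have "(LINT x|lebesgue. c1 (M n) x \<bullet> L n x + c2 (M n) x \<bullet> Hn n x + c3 (M n) x \<bullet> M n x) \<le>
      (LINT x|lebesgue. \<tau> (M n x) * M n x * (norm (u x))\<^sup>2 + (((\<eta> x)\<^sup>2 *\<^sub>R Y x) \<bullet> ((2 * f x) *\<^sub>R q x) + (f x)\<^sup>2 * dZ x))"
    proof (rule Bochner_Integration.integral_mono)
      show "integrable lebesgue (\<lambda>x. c1 (M n) x \<bullet> L n x + c2 (M n) x \<bullet> Hn n x + c3 (M n) x \<bullet> M n x)"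
        by (intro Bochner_Integration.integrable_add i1 i2 i3)
      show "integrable lebesgue (\<lambda>x. \<tau> (M n x) * M n x * (norm (u x))\<^sup>2 + (((\<eta> x)\<^sup>2 *\<^sub>R Y x) \<bullet> ((2 * f x) *\<^sub>R q x) + (f x)\<^sup>2 * dZ x))"
        by (intro Bochner_Integration.integrable_add i4 ch)
      fix x
      have XX: "?X x \<bullet> ?X x = (x \<bullet> x) / (x \<bullet> x + \<epsilon>)\<^sup>2" by (simp add: power2_eq_square)
      have N2: "real DIM('a) \<ge> 2" using dim by simp
      note rb = radial_field_bounds[OF eps inner_ge_zero[of x] N2 a_eq]
      have "(\<eta> x * f x)\<^sup>2 * ((m / (m + M n x)) * (L n x / 2 - Hn n x + M n x * ?b x)
            - (m / (m + M n x)) * (M n x / (m + M n x)) * (4 * Hn n x + ?b x * M n x))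
        \<le> (m / (m + M n x)) * M n x * (u x \<bullet> u x) + (((\<eta> x)\<^sup>2 *\<^sub>R Y x) \<bullet> ((2 * f x) *\<^sub>R q x)
       + (f x)\<^sup>2 * ((2 * \<eta> x) *\<^sub>R e x \<bullet> Y x + (\<eta> x)\<^sup>2 *
          ((- m / (m + M n x)\<^sup>2) *\<^sub>R p n x \<bullet> G x + (m / (m + M n x)) * (L n x / 2 + (a *\<^sub>R p n x) \<bullet> ?X x + a * M n x * ?dX x))))"
      proof (rule completed_square[OF _ M0 m])
        show "0 \<le> M n x * (v \<bullet> v) + s * (v \<bullet> p n x) + s\<^sup>2 * Hn n x" for v s
          using mollified_quadratic_form_nonneg[of "r n" x v s]
          unfolding M_def p_def Hn_def \<mu>_def P_def H_def .
        show "?b x \<le> a * ?dX x - a\<^sup>2 * (?X x \<bullet> ?X x)" unfolding XX by (rule rb)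
        show "a\<^sup>2 * (?X x \<bullet> ?X x) \<le> ?b x" unfolding XX by (rule rb)
      qed (auto simp: G_def Y_def u_def \<tau>_def)
      also have "\<dots> = \<tau> (M n x) * M n x * (norm (u x))\<^sup>2 + (((\<eta> x)\<^sup>2 *\<^sub>R Y x) \<bullet> ((2 * f x) *\<^sub>R q x) + (f x)\<^sup>2 * dZ x)"
        unfolding dZ_def dY_def dG_def \<tau>_def power2_norm_eq_inner by simp
      finally have A: "(\<psi> x)\<^sup>2 * (\<tau> (M n x) * (L n x / 2 - Hn n x + M n x * ?b x)
            - \<tau> (M n x) * \<theta> (M n x) * (4 * Hn n x + ?b x * M n x)) \<le> \<tau> (M n x) * M n x * (norm (u x))\<^sup>2 + (((\<eta> x)\<^sup>2 *\<^sub>R Y x) \<bullet> ((2 * f x) *\<^sub>R q x) + (f x)\<^sup>2 * dZ x)"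
        unfolding \<psi>_def \<tau>_def \<theta>_def .
      have "c1 (M n) x \<bullet> L n x + c2 (M n) x \<bullet> Hn n x + c3 (M n) x \<bullet> M n x = (\<psi> x)\<^sup>2 * (\<tau> (M n x) * (L n x / 2 - Hn n x + M n x * ?b x)
            - \<tau> (M n x) * \<theta> (M n x) * (4 * Hn n x + ?b x * M n x))"
        unfolding c1_def c2_def c3_def inner_real_def by algebra
      then show "c1 (M n) x \<bullet> L n x + c2 (M n) x \<bullet> Hn n x + c3 (M n) x \<bullet> M n x \<le> \<tau> (M n x) * M n x * (norm (u x))\<^sup>2 + (((\<eta> x)\<^sup>2 *\<^sub>R Y x) \<bullet> ((2 * f x) *\<^sub>R q x) + (f x)\<^sup>2 * dZ x)"
        using A by simp
    qed
    also have "\<dots> = (LINT x|lebesgue. \<tau> (M n x) * M n x * (norm (u x))\<^sup>2)"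
      using ch by (simp only: Bochner_Integration.integral_add Bochner_Integration.integrable_add i4)
    also have "(LINT x|lebesgue. c1 (M n) x \<bullet> L n x + c2 (M n) x \<bullet> Hn n x + c3 (M n) x \<bullet> M n x) =
      (LINT x|lebesgue. c1 (M n) x \<bullet> L n x) + (LINT x|lebesgue. c2 (M n) x \<bullet> Hn n x) + (LINT x|lebesgue. c3 (M n) x \<bullet> M n x)"
      by (simp only: Bochner_Integration.integral_add Bochner_Integration.integrable_add i1 i2 i3)
    finally show ?thesis .
  qed
  have "(LINT x|lebesgue. c1 \<mu> x \<bullet> l x) + (LINT x|lebesgue. c2 \<mu> x \<bullet> H x) + (LINT x|lebesgue. c3 \<mu> x \<bullet> \<mu> x)
      \<le> (LINT x|lebesgue. \<tau> (\<mu> x) * \<mu> x * (norm (u x))\<^sup>2)"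
    by (rule LIMSEQ_le[OF tendsto_add[OF tendsto_add[OF R1 R2] R3] LL]) (use ineq in auto)
  then show ?thesis
    unfolding c1_def c2_def c3_def \<mu>_def H_def inner_real_def .
qed

end

lemma locally_integrable_cmult:
  fixes f :: "'a::euclidean_space \<Rightarrow> real"
  assumes "locally_integrable lebesgue f"
  shows "locally_integrable lebesgue (\<lambda>x. c * f x)"
proof -
  have "(\<lambda>x. indicat_real K x *\<^sub>R (c * f x)) = (\<lambda>x. c * (indicator K x *\<^sub>R f x))" for K
    by (simp add: fun_eq_iff)
  then show ?thesis
    using assms unfolding locally_integrable_def set_integrable_def by auto
qed

lemma AE_lebesgue_neq_0: "AE x in lebesgue. x \<noteq> (0::'a::euclidean_space)"
  by (rule AE_completion[OF AE_lborel_singleton])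

lemma ratio_tendsto_1: "(\<lambda>n. real (Suc n) / (real (Suc n) + t)) \<longlonglongrightarrow> 1"
  and ratio_tendsto_0: "(\<lambda>n. t / (real (Suc n) + t)) \<longlonglongrightarrow> 0" if "t \<ge> 0" for t :: real
proof -
  have "(\<lambda>n. 1 / (1 + t * inverse (real (Suc n)))) \<longlonglongrightarrow> 1 / (1 + t * 0)"
    by (intro tendsto_intros LIMSEQ_inverse_real_of_nat) auto
  moreover have "1 / (1 + t * inverse (real (Suc n))) = real (Suc n) / (real (Suc n) + t)" for n
  proof -
    define N where "N = real (Suc n)"
    have N: "N > 0" by (simp add: N_def)
    show ?thesis unfolding N_def[symmetric]
      using N that by (simp add: divide_simps)
  qed
  ultimately show 1: "(\<lambda>n. real (Suc n) / (real (Suc n) + t)) \<longlonglongrightarrow> 1" by simp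
  have "t / (real (Suc n) + t) = 1 - real (Suc n) / (real (Suc n) + t)" for n
  proof -
    define N where "N = real (Suc n)"
    have "N + t \<noteq> 0" using that by (simp add: N_def)
    then show ?thesis unfolding N_def[symmetric] by (simp add: field_simps)
  qed
  then show "(\<lambda>n. t / (real (Suc n) + t)) \<longlonglongrightarrow> 0"
    using tendsto_diff[OF tendsto_const 1, of 1] by simp
qed

lemma integrable_locally_integrable_bound:
  fixes f g :: "'a::euclidean_space \<Rightarrow> real"
  assumes "locally_integrable lebesgue g" "compact K" "f \<in> borel_measurable lebesgue"
    "AE x in lebesgue. \<bar>f x\<bar> \<le> c * (indicator K x * \<bar>g x\<bar>)"
  shows "integrable lebesgue f"
proof (rule Bochner_Integration.integrable_bound[OF _ assms(3)])
  have "integrable lebesgue (\<lambda>x. norm (indicator K x *\<^sub>R g x))"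
    using assms(1,2) unfolding locally_integrable_def set_integrable_def by (intro integrable_norm) simp
  then show "integrable lebesgue (\<lambda>x. c * (indicator K x * \<bar>g x\<bar>))"
    by (simp add: abs_mult)
  show "AE x in lebesgue. norm (f x) \<le> norm (c * (indicat_real K x * \<bar>g x\<bar>))"
    using assms(4) by (elim eventually_mono) (simp add: order_trans[OF _ abs_ge_self])
qed

context sobolev_weight
begin

text \<open>One limit removes \<open>\<tau>\<close>, the regularisation of the radial field and the
  cut-off in \<open>\<rho>\<close>: their parameters are tied to a single index by
  \<open>m = N j\<close> and \<open>\<epsilon> = inverse (N j)\<close>. The truncations by
  \<open>squash k\<close> and \<open>\<eta>\<close> survive.\<close>

lemma hardy_truncated:
  fixes \<phi> \<eta> :: "'a \<Rightarrow> real" and g e :: "'a \<Rightarrow> 'a" and k c C :: real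
  assumes phi: "has_weak_gradient \<phi> g"
    and wg: "integrable lebesgue (\<lambda>x. (\<rho> x)\<^sup>2 * (norm (g x))\<^sup>2)"
    and hardy_int: "locally_integrable lebesgue (\<lambda>x. (\<rho> x)\<^sup>2 / (x \<bullet> x))"
    and lower: "AE x in lebesgue. \<rho> x \<noteq> 0 \<longrightarrow>
      (\<rho> x)\<^sup>2 * (c / (x \<bullet> x) - C) \<le> l x / 2 - (norm (h x))\<^sup>2 + a\<^sup>2 / (x \<bullet> x) * (\<rho> x)\<^sup>2"
    and eta: "has_cont_gradient \<eta> e" and K: "compact K" "\<And>x. x \<notin> K \<Longrightarrow> \<eta> x = 0"
    and k: "k > 0"
  defines "w \<equiv> \<lambda>x. \<eta> x * squash k (\<phi> x)"
    and "W \<equiv> \<lambda>x. (\<eta> x * squash' k (\<phi> x)) *\<^sub>R g x + squash k (\<phi> x) *\<^sub>R e x"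
  shows "integrable lebesgue (\<lambda>x. (w x)\<^sup>2 * ((\<rho> x)\<^sup>2 / (x \<bullet> x)))"
    and "c * (LINT x|lebesgue. (w x)\<^sup>2 * ((\<rho> x)\<^sup>2 / (x \<bullet> x))) \<le>
      (LINT x|lebesgue. (\<rho> x)\<^sup>2 * (norm (W x))\<^sup>2) + C * (LINT x|lebesgue. (\<rho> x)\<^sup>2 * (w x)\<^sup>2)"
proof -
  have lphi: "locally_integrable lebesgue \<phi>" "locally_integrable lebesgue g"
    using phi by (auto simp: has_weak_gradient_def)
  have lrho: "locally_integrable lebesgue \<rho>" "locally_integrable lebesgue h"
    using grad by (auto simp: has_weak_gradient_def)
  note [measurable] = lphi[THEN locally_integrable_measurable] lrho[THEN locally_integrable_measurable]
    locally_integrable_measurable[OF lint_l]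
  have msq [measurable]: "squash k \<in> borel_measurable borel" "squash' k \<in> borel_measurable borel"
    by (intro borel_measurable_continuous_onI squash_continuous squash'_continuous k)+
  have mcz: "cutzero (real (Suc j)) \<in> borel_measurable borel" "cutzero' (real (Suc j)) \<in> borel_measurable borel" for j
    by (intro borel_measurable_continuous_onI cutzero_continuous cutzero'_continuous; simp)+
  have e0: "e x = 0" if "x \<notin> K" for x
    using has_cont_gradient_zero_outside[OF eta compact_imp_closed[OF K(1)] K(2) that] by auto
  obtain E where E: "E \<ge> 0" "\<And>x. norm (\<eta> x) \<le> E"
    using continuous_compact_support_bounded[OF has_cont_gradient_cont[OF eta] K] by metis
  obtain E' where E': "E' \<ge> 0" "\<And>x. norm (e x) \<le> E'"
    using continuous_compact_support_bounded[OF has_cont_gradient_cont_grad[OF eta] K(1) e0] by metis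
  have me [measurable]: "\<eta> \<in> borel_measurable lebesgue" "e \<in> borel_measurable lebesgue"
    by (intro continuous_borel_measurable_lebesgue has_cont_gradient_cont[OF eta] has_cont_gradient_cont_grad[OF eta])+
  have mxx [measurable]: "(\<lambda>x::'a. x \<bullet> x) \<in> borel_measurable lebesgue"
    by (intro continuous_borel_measurable_lebesgue continuous_intros)
  define N where "N = (\<lambda>j::nat. real (Suc j))"
  have N: "N j \<ge> 1" "N j > 0" for j by (auto simp: N_def)
  have mcz' [measurable]: "cutzero (N j) \<in> borel_measurable borel" "cutzero' (N j) \<in> borel_measurable borel" for j
    unfolding N_def by (rule mcz)+
  have czlim: "(\<lambda>j. cutzero (N j) t) \<longlonglongrightarrow> 1" "(\<lambda>j. cutzero' (N j) t) \<longlonglongrightarrow> 0" if "t \<noteq> 0" for t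
    unfolding N_def by (rule cutzero_tendsto[OF that] cutzero'_tendsto[OF that])+
  define f where "f = (\<lambda>j x. squash k (\<phi> x) * cutzero (N j) (\<rho> x))"
  define q where "q = (\<lambda>j x. (squash' k (\<phi> x) * cutzero (N j) (\<rho> x)) *\<^sub>R g x + (squash k (\<phi> x) * cutzero' (N j) (\<rho> x)) *\<^sub>R h x)"
  define u where "u = (\<lambda>j x. \<eta> x *\<^sub>R q j x + f j x *\<^sub>R e x)"
  define \<psi> where "\<psi> = (\<lambda>j x. \<eta> x * f j x)"
  define \<tau> where "\<tau> = (\<lambda>j t. N j / (N j + t))"
  define \<theta> where "\<theta> = (\<lambda>j t. t / (N j + t))"
  define H where "H = (\<lambda>x. (norm (h x))\<^sup>2)"
  have mf [measurable]: "f j \<in> borel_measurable lebesgue" "q j \<in> borel_measurable lebesgue" for j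
    unfolding f_def q_def by measurable
  have mu [measurable]: "u j \<in> borel_measurable lebesgue" "\<psi> j \<in> borel_measurable lebesgue" for j
    unfolding u_def \<psi>_def by measurable
  have mH [measurable]: "H \<in> borel_measurable lebesgue" unfolding H_def by measurable
  have fb: "\<bar>f j x\<bar> \<le> k" for j x
  proof -
    have "\<bar>squash k (\<phi> x)\<bar> * \<bar>cutzero (N j) (\<rho> x)\<bar> \<le> k * 1"
      using cutzero_bounds[OF N(2)] k by (intro mult_mono squash_le) auto
    then show ?thesis by (simp add: f_def abs_mult)
  qed
  \<comment> \<open>For fixed \<open>j\<close> the cut-off is at most
    \<open>N j * |\<rho> x|\<close>, which reduces the first summand of \<open>q j\<close> to the
    integrable \<open>\<rho>^2 |g|^2\<close>; the second is controlled by
    \<open>|h|^2\<close>.\<close>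
  have q2: "locally_integrable lebesgue (\<lambda>x. (norm (q j x))\<^sup>2)" for j
  proof (rule locally_integrable_bound)
    show "locally_integrable lebesgue (\<lambda>x. 2 * ((N j)\<^sup>2 * ((\<rho> x)\<^sup>2 * (norm (g x))\<^sup>2)) + 2 * ((k * N j)\<^sup>2 * (norm (h x))\<^sup>2))"
      by (intro locally_integrable_add locally_integrable_cmult gradsq locally_integrableI_integrable wg)
    fix x
    have "norm (q j x) \<le> norm ((squash' k (\<phi> x) * cutzero (N j) (\<rho> x)) *\<^sub>R g x) + norm ((squash k (\<phi> x) * cutzero' (N j) (\<rho> x)) *\<^sub>R h x)"
      unfolding q_def by (rule norm_triangle_ineq)
    also have "\<dots> = \<bar>squash' k (\<phi> x)\<bar> * \<bar>cutzero (N j) (\<rho> x)\<bar> * norm (g x) + \<bar>squash k (\<phi> x)\<bar> * \<bar>cutzero' (N j) (\<rho> x)\<bar> * norm (h x)"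
      by (simp add: abs_mult)
    also have "\<dots> \<le> 1 * (N j * \<bar>\<rho> x\<bar>) * norm (g x) + k * N j * norm (h x)"
      using cutzero_bounds[OF N(2), of j "\<rho> x"] k N
      by (intro add_mono mult_mono mult_right_mono squash'_le squash_le cutzero'_le) (auto intro: cutzero_le)
    finally have "(norm (q j x))\<^sup>2 \<le> (N j * \<bar>\<rho> x\<bar> * norm (g x) + k * N j * norm (h x))\<^sup>2"
      by (intro power_mono) auto
    also have "\<dots> \<le> 2 * (N j * \<bar>\<rho> x\<bar> * norm (g x))\<^sup>2 + 2 * (k * N j * norm (h x))\<^sup>2"
      using sum_squares_bound[of "N j * \<bar>\<rho> x\<bar> * norm (g x)" "k * N j * norm (h x)"] by (simp add: power2_sum)
    finally show "norm ((norm (q j x))\<^sup>2) \<le> 2 * ((N j)\<^sup>2 * ((\<rho> x)\<^sup>2 * (norm (g x))\<^sup>2)) + 2 * ((k * N j)\<^sup>2 * (norm (h x))\<^sup>2)"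
      by (simp add: power_mult_distrib mult.assoc)
  qed measurable
  have chain: "integrable lebesgue (\<lambda>x. Z x \<bullet> ((2 * f j x) *\<^sub>R q j x)) \<and> integrable lebesgue (\<lambda>x. (f j x)\<^sup>2 * d x) \<and>
      (LINT x|lebesgue. Z x \<bullet> ((2 * f j x) *\<^sub>R q j x)) = - (LINT x|lebesgue. (f j x)\<^sup>2 * d x)"
    if Z: "has_cont_divergence Z d" "compact K'" "\<And>x. x \<notin> K' \<Longrightarrow> Z x = 0" for Z d K' j
  proof -
    define b where "b = k\<^sup>2 + 2 * k + 2 * N j"
    \<comment> \<open>Squares of the two truncations, so that
      \<open>A (\<phi> x) * B (\<rho> x)\<close> is the square of \<open>f j x\<close> and the
      product rule yields twice \<open>f j x\<close> times \<open>q j x\<close>.\<close>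
    define A where "A = (\<lambda>s. (squash k s)\<^sup>2)"
    define A' where "A' = (\<lambda>s. 2 * squash k s * squash' k s)"
    define B where "B = (\<lambda>s. (cutzero (N j) s)\<^sup>2)"
    define B' where "B' = (\<lambda>s. 2 * cutzero (N j) s * cutzero' (N j) s)"
    have dA: "(A has_real_derivative A' t) (at t)" for t
      unfolding A_def A'_def using DERIV_mult'[OF squash_deriv[OF k] squash_deriv[OF k], of t]
      by (simp add: power2_eq_square mult_ac)
    have dB: "(B has_real_derivative B' t) (at t)" for t
      unfolding B_def B'_def using DERIV_mult'[OF cutzero_deriv[OF N(2)[of j]] cutzero_deriv[OF N(2)[of j]], of t]
      by (simp add: power2_eq_square mult_ac)
    have cA: "continuous_on UNIV A'" unfolding A'_def
      by (intro continuous_intros squash_continuous squash'_continuous k)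
    have cB: "continuous_on UNIV B'" unfolding B'_def
      by (intro continuous_intros cutzero_continuous cutzero'_continuous N)
    have kk: "0 \<le> k\<^sup>2" by simp
    have bA: "\<bar>A t\<bar> \<le> b" "\<bar>A' t\<bar> \<le> b" for t
    proof -
      have "\<bar>squash k t\<bar>\<^sup>2 \<le> k\<^sup>2" by (intro power_mono squash_le k) auto
      then show "\<bar>A t\<bar> \<le> b" using k N[of j] by (simp add: A_def b_def)
      have "\<bar>squash k t\<bar> * \<bar>squash' k t\<bar> \<le> k * 1" using k by (intro mult_mono squash_le squash'_le) auto
      moreover have "\<bar>A' t\<bar> = 2 * (\<bar>squash k t\<bar> * \<bar>squash' k t\<bar>)" by (simp add: A'_def abs_mult)
      ultimately show "\<bar>A' t\<bar> \<le> b" using k N[of j] kk unfolding b_def by linarith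
    qed
    have bB: "\<bar>B t\<bar> \<le> b" "\<bar>B' t\<bar> \<le> b" for t
    proof -
      note z = cutzero_bounds[OF N(2), of j t]
      have "(cutzero (N j) t)\<^sup>2 \<le> 1" using z by (simp add: power_le_one)
      moreover have "\<bar>B t\<bar> = (cutzero (N j) t)\<^sup>2" by (simp add: B_def)
      ultimately show "\<bar>B t\<bar> \<le> b" using k N[of j] kk unfolding b_def by linarith
      have "\<bar>cutzero (N j) t\<bar> * \<bar>cutzero' (N j) t\<bar> \<le> 1 * N j" using z by (intro mult_mono cutzero'_le N) auto
      moreover have "\<bar>B' t\<bar> = 2 * (\<bar>cutzero (N j) t\<bar> * \<bar>cutzero' (N j) t\<bar>)" by (simp add: B'_def abs_mult)
      ultimately show "\<bar>B' t\<bar> \<le> b" using k N[of j] kk unfolding b_def by linarith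
    qed
    have e1: "Z x \<bullet> ((A' (\<phi> x) * B (\<rho> x)) *\<^sub>R g x + (A (\<phi> x) * B' (\<rho> x)) *\<^sub>R h x) = Z x \<bullet> ((2 * f j x) *\<^sub>R q j x)" for x
      unfolding A_def A'_def B_def B'_def f_def q_def by (simp add: scaleR_add_right power2_eq_square mult_ac)
    have e2: "A (\<phi> x) * B (\<rho> x) * d x = (f j x)\<^sup>2 * d x" for x
      unfolding A_def B_def f_def by (simp add: power_mult_distrib)
    show ?thesis
      using weak_product_chain_rule[OF phi grad dA cA bA dB cB bB Z] unfolding e1 e2 by blast
  qed
  have ineq: "(LINT x|lebesgue. (\<psi> j x)\<^sup>2 * \<tau> j ((\<rho> x)\<^sup>2) / 2 * l x)
      + (LINT x|lebesgue. - (\<psi> j x)\<^sup>2 * \<tau> j ((\<rho> x)\<^sup>2) * (1 + 4 * \<theta> j ((\<rho> x)\<^sup>2)) * H x)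
      + (LINT x|lebesgue. (\<psi> j x)\<^sup>2 * \<tau> j ((\<rho> x)\<^sup>2) * (1 - \<theta> j ((\<rho> x)\<^sup>2)) * (a\<^sup>2 / (x \<bullet> x + inverse (N j))) * (\<rho> x)\<^sup>2)
      \<le> (LINT x|lebesgue. \<tau> j ((\<rho> x)\<^sup>2) * (\<rho> x)\<^sup>2 * (norm (u j x))\<^sup>2)" for j
    unfolding \<psi>_def \<tau>_def \<theta>_def u_def H_def
    by (rule inequality_with_cutoff[OF N(2) _ eta K mf(1) fb mf(2) q2 chain]) (use N in auto)
  \<comment> \<open>The cut-off tends to 1 where \<open>\<rho>\<close> is nonzero and is 0
    elsewhere, so the limit carries this indicator. It has to be kept with \<open>l\<close> and
    \<open>H\<close>, because \<open>lower\<close> says nothing on the zero set; terms weighted by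
    \<open>\<rho>^2\<close> do not see it.\<close>
  define ind where "ind = (\<lambda>x. if \<rho> x = 0 then 0 else 1 :: real)"
  have mind [measurable]: "ind \<in> borel_measurable lebesgue" unfolding ind_def by measurable
  define w0 where "w0 = (\<lambda>x. \<eta> x * (squash k (\<phi> x) * ind x))"
  have w0: "w0 x = w x * ind x" for x by (simp add: w0_def w_def)
  have ind2: "(w0 x)\<^sup>2 = (w x)\<^sup>2 * ind x" for x by (simp add: w0 power_mult_distrib ind_def)
  have mw [measurable]: "w \<in> borel_measurable lebesgue" "w0 \<in> borel_measurable lebesgue" "W \<in> borel_measurable lebesgue"
    unfolding w_def w0_def W_def by measurable
  have \<psi>lim: "(\<lambda>j. \<psi> j x) \<longlonglongrightarrow> w0 x" for x
  proof -
    have "(\<lambda>j. cutzero (N j) (\<rho> x)) \<longlonglongrightarrow> ind x"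
      using czlim(1)[of "\<rho> x"] by (cases "\<rho> x = 0") (simp_all add: ind_def cutzero_0)
    then show ?thesis unfolding \<psi>_def w0_def f_def by (intro tendsto_intros)
  qed
  have \<tau>lim: "(\<lambda>j. \<tau> j ((\<rho> x)\<^sup>2)) \<longlonglongrightarrow> 1" "(\<lambda>j. \<theta> j ((\<rho> x)\<^sup>2)) \<longlonglongrightarrow> 0" for x
    unfolding \<tau>_def \<theta>_def N_def by (intro ratio_tendsto_1 ratio_tendsto_0; simp)+
  have \<tau>b: "0 \<le> \<tau> j ((\<rho> x)\<^sup>2)" "\<tau> j ((\<rho> x)\<^sup>2) \<le> 1" "0 \<le> \<theta> j ((\<rho> x)\<^sup>2)" "\<theta> j ((\<rho> x)\<^sup>2) \<le> 1" for j x
  proof -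
    have "N j + (\<rho> x)\<^sup>2 > 0" by (intro add_pos_nonneg N(2)) simp
    then show "0 \<le> \<tau> j ((\<rho> x)\<^sup>2)" "\<tau> j ((\<rho> x)\<^sup>2) \<le> 1" "0 \<le> \<theta> j ((\<rho> x)\<^sup>2)" "\<theta> j ((\<rho> x)\<^sup>2) \<le> 1"
      using N[of j] by (simp_all add: \<tau>_def \<theta>_def divide_le_eq)
  qed
  have m\<tau> [measurable]: "(\<lambda>x. \<tau> j ((\<rho> x)\<^sup>2)) \<in> borel_measurable lebesgue" "(\<lambda>x. \<theta> j ((\<rho> x)\<^sup>2)) \<in> borel_measurable lebesgue" for j
    unfolding \<tau>_def \<theta>_def by measurable
  define D where "D = (E * k)\<^sup>2"
  have D0: "D \<ge> 0" by (simp add: D_def)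
  have \<psi>b: "(\<psi> j x)\<^sup>2 \<le> D * indicator K x" for j x
  proof (cases "x \<in> K")
    case True
    have "\<bar>\<eta> x\<bar> * \<bar>f j x\<bar> \<le> E * k" using E fb by (intro mult_mono) auto
    then have "\<bar>\<psi> j x\<bar> \<le> E * k" by (simp add: \<psi>_def abs_mult)
    then have "\<bar>\<psi> j x\<bar>\<^sup>2 \<le> (E * k)\<^sup>2" by (intro power_mono) auto
    then show ?thesis using True by (simp add: D_def)
  qed (use K in \<open>simp add: \<psi>_def\<close>)
  have wb: "(w x)\<^sup>2 \<le> D * indicator K x" for x
  proof (cases "x \<in> K")
    case True
    have "\<bar>\<eta> x\<bar> * \<bar>squash k (\<phi> x)\<bar> \<le> E * k" using E k by (intro mult_mono squash_le) auto
    then have "\<bar>w x\<bar> \<le> E * k" by (simp add: w_def abs_mult)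
    then have "\<bar>w x\<bar>\<^sup>2 \<le> (E * k)\<^sup>2" by (intro power_mono) auto
    then show ?thesis using True by (simp add: D_def)
  qed (use K in \<open>simp add: w_def\<close>)
  have w0b: "(w0 x)\<^sup>2 \<le> D * indicator K x" for x
    using wb[of x] D0 by (simp add: ind2 ind_def)
  have bnd: "\<bar>s * y\<bar> \<le> c' * D * (indicator K x * \<bar>y\<bar>)"
    if "0 \<le> s" "s \<le> c' * (D * indicator K x)" for s c' y :: real and x
    using mult_right_mono[OF that(2) abs_ge_zero[of y]] that(1) by (simp add: abs_mult mult_ac)
  have lintH: "locally_integrable lebesgue H" unfolding H_def by (rule gradsq)
  have dom: "integrable lebesgue (\<lambda>x. c' * (indicator K x * \<bar>y x\<bar>))" if "locally_integrable lebesgue y" for c' and y :: "'a \<Rightarrow> real"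
  proof -
    have "integrable lebesgue (\<lambda>x. norm (indicator K x *\<^sub>R y x))"
      using that K(1) unfolding locally_integrable_def set_integrable_def by (intro integrable_norm) simp
    then show ?thesis by (simp add: abs_mult)
  qed
  have L1: "(\<lambda>j. LINT x|lebesgue. (\<psi> j x)\<^sup>2 * \<tau> j ((\<rho> x)\<^sup>2) / 2 * l x) \<longlonglongrightarrow> (LINT x|lebesgue. (w0 x)\<^sup>2 * 1 / 2 * l x)"
  proof (rule integral_dominated_convergence[OF _ _ dom[OF lint_l, of "1 * D"]])
    show "AE x in lebesgue. (\<lambda>j. (\<psi> j x)\<^sup>2 * \<tau> j ((\<rho> x)\<^sup>2) / 2 * l x) \<longlonglongrightarrow> (w0 x)\<^sup>2 * 1 / 2 * l x"
      by (intro AE_I2 tendsto_intros \<psi>lim \<tau>lim) auto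
    show "AE x in lebesgue. norm ((\<psi> j x)\<^sup>2 * \<tau> j ((\<rho> x)\<^sup>2) / 2 * l x) \<le> 1 * D * (indicator K x * \<bar>l x\<bar>)" for j
    proof (intro AE_I2, unfold real_norm_def, rule bnd)
      fix x
      have "(\<psi> j x)\<^sup>2 * (\<tau> j ((\<rho> x)\<^sup>2) / 2) \<le> (D * indicator K x) * 1"
        by (rule mult_mono[OF \<psi>b]) (use \<tau>b[of j x] D0 in auto)
      then show "(\<psi> j x)\<^sup>2 * \<tau> j ((\<rho> x)\<^sup>2) / 2 \<le> 1 * (D * indicator K x)" by simp
    qed (use \<tau>b in auto)
  qed measurable
  have L2: "(\<lambda>j. LINT x|lebesgue. - (\<psi> j x)\<^sup>2 * \<tau> j ((\<rho> x)\<^sup>2) * (1 + 4 * \<theta> j ((\<rho> x)\<^sup>2)) * H x) \<longlonglongrightarrow> (LINT x|lebesgue. - (w0 x)\<^sup>2 * 1 * (1 + 4 * 0) * H x)"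
  proof (rule integral_dominated_convergence[OF _ _ dom[OF lintH, of "5 * D"]])
    show "AE x in lebesgue. (\<lambda>j. - (\<psi> j x)\<^sup>2 * \<tau> j ((\<rho> x)\<^sup>2) * (1 + 4 * \<theta> j ((\<rho> x)\<^sup>2)) * H x) \<longlonglongrightarrow> - (w0 x)\<^sup>2 * 1 * (1 + 4 * 0) * H x"
      by (intro AE_I2 tendsto_intros \<psi>lim \<tau>lim)
    show "AE x in lebesgue. norm (- (\<psi> j x)\<^sup>2 * \<tau> j ((\<rho> x)\<^sup>2) * (1 + 4 * \<theta> j ((\<rho> x)\<^sup>2)) * H x) \<le> 5 * D * (indicator K x * \<bar>H x\<bar>)" for j
    proof (intro AE_I2)
      fix x
      have "(\<psi> j x)\<^sup>2 * (\<tau> j ((\<rho> x)\<^sup>2) * (1 + 4 * \<theta> j ((\<rho> x)\<^sup>2))) \<le> (D * indicator K x) * (1 * 5)"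
        by (rule mult_mono[OF \<psi>b mult_mono]) (use \<tau>b[of j x] D0 in auto)
      then have "\<bar>((\<psi> j x)\<^sup>2 * \<tau> j ((\<rho> x)\<^sup>2) * (1 + 4 * \<theta> j ((\<rho> x)\<^sup>2))) * H x\<bar> \<le> 5 * D * (indicator K x * \<bar>H x\<bar>)"
        by (intro bnd) (use \<tau>b[of j x] in \<open>auto simp: mult_ac\<close>)
      then show "norm (- (\<psi> j x)\<^sup>2 * \<tau> j ((\<rho> x)\<^sup>2) * (1 + 4 * \<theta> j ((\<rho> x)\<^sup>2)) * H x) \<le> 5 * D * (indicator K x * \<bar>H x\<bar>)"
        by (simp add: abs_mult)
    qed
  qed measurable
  \<comment> \<open>The regularised potential increases to \<open>a^2 / |x|^2\<close>, so local
    integrability of \<open>\<rho>^2 / |x|^2\<close> provides the majorant; the origin is a null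
    set.\<close>
  have L3: "(\<lambda>j. LINT x|lebesgue. (\<psi> j x)\<^sup>2 * \<tau> j ((\<rho> x)\<^sup>2) * (1 - \<theta> j ((\<rho> x)\<^sup>2)) * (a\<^sup>2 / (x \<bullet> x + inverse (N j))) * (\<rho> x)\<^sup>2)
     \<longlonglongrightarrow> (LINT x|lebesgue. (w0 x)\<^sup>2 * 1 * (1 - 0) * (a\<^sup>2 / (x \<bullet> x + 0)) * (\<rho> x)\<^sup>2)"
  proof (rule integral_dominated_convergence[OF _ _ dom[OF hardy_int, of "a\<^sup>2 * D"]])
    show "AE x in lebesgue. (\<lambda>j. (\<psi> j x)\<^sup>2 * \<tau> j ((\<rho> x)\<^sup>2) * (1 - \<theta> j ((\<rho> x)\<^sup>2)) * (a\<^sup>2 / (x \<bullet> x + inverse (N j))) * (\<rho> x)\<^sup>2)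
      \<longlonglongrightarrow> (w0 x)\<^sup>2 * 1 * (1 - 0) * (a\<^sup>2 / (x \<bullet> x + 0)) * (\<rho> x)\<^sup>2"
      using AE_lebesgue_neq_0[where 'a='a]
    proof (elim eventually_mono)
      fix x :: 'a assume "x \<noteq> 0"
      then show "(\<lambda>j. (\<psi> j x)\<^sup>2 * \<tau> j ((\<rho> x)\<^sup>2) * (1 - \<theta> j ((\<rho> x)\<^sup>2)) * (a\<^sup>2 / (x \<bullet> x + inverse (N j))) * (\<rho> x)\<^sup>2)
        \<longlonglongrightarrow> (w0 x)\<^sup>2 * 1 * (1 - 0) * (a\<^sup>2 / (x \<bullet> x + 0)) * (\<rho> x)\<^sup>2"
        unfolding N_def
        by (intro tendsto_intros \<psi>lim \<tau>lim LIMSEQ_inverse_real_of_nat) auto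
    qed
    show "AE x in lebesgue. norm ((\<psi> j x)\<^sup>2 * \<tau> j ((\<rho> x)\<^sup>2) * (1 - \<theta> j ((\<rho> x)\<^sup>2)) * (a\<^sup>2 / (x \<bullet> x + inverse (N j))) * (\<rho> x)\<^sup>2)
      \<le> a\<^sup>2 * D * (indicator K x * \<bar>(\<rho> x)\<^sup>2 / (x \<bullet> x)\<bar>)" for j
      using AE_lebesgue_neq_0[where 'a='a]
    proof (elim eventually_mono)
      fix x :: 'a assume "x \<noteq> 0"
      then have xx: "x \<bullet> x > 0" by simp
      have ip: "inverse (N j) > 0" using N[of j] by simp
      have A1: "(\<psi> j x)\<^sup>2 * (\<tau> j ((\<rho> x)\<^sup>2) * (1 - \<theta> j ((\<rho> x)\<^sup>2))) \<le> (D * indicator K x) * (1 * 1)"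
        by (rule mult_mono[OF \<psi>b mult_mono]) (use \<tau>b[of j x] D0 in auto)
      have A2: "a\<^sup>2 / (x \<bullet> x + inverse (N j)) \<le> a\<^sup>2 / (x \<bullet> x)"
        using xx ip by (intro divide_left_mono mult_pos_pos add_pos_pos) simp_all
      have A3: "0 \<le> a\<^sup>2 / (x \<bullet> x + inverse (N j))"
        using xx ip by (intro divide_nonneg_pos add_pos_pos) simp_all
      have nn: "0 \<le> (\<psi> j x)\<^sup>2 * (\<tau> j ((\<rho> x)\<^sup>2) * (1 - \<theta> j ((\<rho> x)\<^sup>2)))"
        using \<tau>b[of j x] by auto
      have "(\<psi> j x)\<^sup>2 * (\<tau> j ((\<rho> x)\<^sup>2) * (1 - \<theta> j ((\<rho> x)\<^sup>2))) * (a\<^sup>2 / (x \<bullet> x + inverse (N j))) * (\<rho> x)\<^sup>2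
        \<le> ((D * indicator K x) * (1 * 1)) * (a\<^sup>2 / (x \<bullet> x)) * (\<rho> x)\<^sup>2"
        by (intro mult_right_mono mult_mono[OF A1 A2]) (use D0 A3 in auto)
      moreover have "0 \<le> (\<psi> j x)\<^sup>2 * (\<tau> j ((\<rho> x)\<^sup>2) * (1 - \<theta> j ((\<rho> x)\<^sup>2))) * (a\<^sup>2 / (x \<bullet> x + inverse (N j))) * (\<rho> x)\<^sup>2"
        by (intro mult_nonneg_nonneg[OF mult_nonneg_nonneg[OF nn A3]]) simp
      ultimately have "\<bar>(\<psi> j x)\<^sup>2 * (\<tau> j ((\<rho> x)\<^sup>2) * (1 - \<theta> j ((\<rho> x)\<^sup>2))) * (a\<^sup>2 / (x \<bullet> x + inverse (N j))) * (\<rho> x)\<^sup>2\<bar>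
        \<le> ((D * indicator K x) * (1 * 1)) * (a\<^sup>2 / (x \<bullet> x)) * (\<rho> x)\<^sup>2"
        by (simp only: abs_of_nonneg)
      moreover have "((D * indicator K x) * (1 * 1)) * (a\<^sup>2 / (x \<bullet> x)) * (\<rho> x)\<^sup>2 = a\<^sup>2 * D * (indicator K x * \<bar>(\<rho> x)\<^sup>2 / (x \<bullet> x)\<bar>)"
        by simp
      ultimately show "norm ((\<psi> j x)\<^sup>2 * \<tau> j ((\<rho> x)\<^sup>2) * (1 - \<theta> j ((\<rho> x)\<^sup>2)) * (a\<^sup>2 / (x \<bullet> x + inverse (N j))) * (\<rho> x)\<^sup>2)
        \<le> a\<^sup>2 * D * (indicator K x * \<bar>(\<rho> x)\<^sup>2 / (x \<bullet> x)\<bar>)"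
        by (simp only: real_norm_def mult.assoc)
    qed
  qed measurable
  \<comment> \<open>The derivative of the cut-off disappears: it tends to 0 where
    \<open>\<rho>\<close> is nonzero, and the weight removes the zero set.
    \<open>mult_cutzero'_le\<close> gives the factor 2 in the majorant.\<close>
  have L4: "(\<lambda>j. LINT x|lebesgue. \<tau> j ((\<rho> x)\<^sup>2) * (\<rho> x)\<^sup>2 * (norm (u j x))\<^sup>2) \<longlonglongrightarrow> (LINT x|lebesgue. (\<rho> x)\<^sup>2 * (norm (W x))\<^sup>2)"
  proof (rule integral_dominated_convergence)
    let ?y = "\<lambda>x. E\<^sup>2 * ((\<rho> x)\<^sup>2 * (norm (g x))\<^sup>2) + (2 * E * k)\<^sup>2 * H x + (k * E')\<^sup>2 * (\<rho> x)\<^sup>2"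
    have ly: "locally_integrable lebesgue ?y"
      by (intro locally_integrable_add locally_integrable_cmult lintH sq locally_integrableI_integrable wg)
    show "integrable lebesgue (\<lambda>x. 3 * (indicator K x * \<bar>?y x\<bar>))"
      by (rule dom[OF ly])
    show "AE x in lebesgue. (\<lambda>j. \<tau> j ((\<rho> x)\<^sup>2) * (\<rho> x)\<^sup>2 * (norm (u j x))\<^sup>2) \<longlonglongrightarrow> (\<rho> x)\<^sup>2 * (norm (W x))\<^sup>2"
    proof (intro AE_I2)
      fix x
      show "(\<lambda>j. \<tau> j ((\<rho> x)\<^sup>2) * (\<rho> x)\<^sup>2 * (norm (u j x))\<^sup>2) \<longlonglongrightarrow> (\<rho> x)\<^sup>2 * (norm (W x))\<^sup>2"
      proof (cases "\<rho> x = 0")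
        case False
        have "(\<lambda>j. \<tau> j ((\<rho> x)\<^sup>2) * (\<rho> x)\<^sup>2 * (norm (u j x))\<^sup>2) \<longlonglongrightarrow>
          1 * (\<rho> x)\<^sup>2 * (norm (\<eta> x *\<^sub>R ((squash' k (\<phi> x) * 1) *\<^sub>R g x + (squash k (\<phi> x) * 0) *\<^sub>R h x) + (squash k (\<phi> x) * 1) *\<^sub>R e x))\<^sup>2"
          unfolding u_def q_def f_def
          by (intro tendsto_intros \<tau>lim czlim[OF False])
        then show ?thesis by (simp add: W_def)
      qed simp
    qed
    show "AE x in lebesgue. norm (\<tau> j ((\<rho> x)\<^sup>2) * (\<rho> x)\<^sup>2 * (norm (u j x))\<^sup>2) \<le> 3 * (indicator K x * \<bar>?y x\<bar>)" for j
    proof (intro AE_I2)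
      fix x
      show "norm (\<tau> j ((\<rho> x)\<^sup>2) * (\<rho> x)\<^sup>2 * (norm (u j x))\<^sup>2) \<le> 3 * (indicator K x * \<bar>?y x\<bar>)"
      proof (cases "x \<in> K")
        case True
        let ?A = "E * (\<bar>\<rho> x\<bar> * norm (g x))" and ?B = "(2 * E * k) * norm (h x)" and ?C = "(k * E') * \<bar>\<rho> x\<bar>"
        note z = cutzero_bounds[OF N(2), of j "\<rho> x"]
        have tri: "norm (p + q + r) \<le> norm p + norm q + norm r" for p q r :: 'a
          using norm_triangle_ineq[of "p + q" r] norm_triangle_ineq[of p q] by linarith
        have "u j x = (\<eta> x * (squash' k (\<phi> x) * cutzero (N j) (\<rho> x))) *\<^sub>R g x + (\<eta> x * (squash k (\<phi> x) * cutzero' (N j) (\<rho> x))) *\<^sub>R h x + f j x *\<^sub>R e x"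
          by (simp add: u_def q_def scaleR_add_right)
        then have "norm (u j x) \<le> norm ((\<eta> x * (squash' k (\<phi> x) * cutzero (N j) (\<rho> x))) *\<^sub>R g x) + norm ((\<eta> x * (squash k (\<phi> x) * cutzero' (N j) (\<rho> x))) *\<^sub>R h x) + norm (f j x *\<^sub>R e x)"
          by (simp only: tri)
        then have "\<bar>\<rho> x\<bar> * norm (u j x) \<le> \<bar>\<rho> x\<bar> * (norm ((\<eta> x * (squash' k (\<phi> x) * cutzero (N j) (\<rho> x))) *\<^sub>R g x) + norm ((\<eta> x * (squash k (\<phi> x) * cutzero' (N j) (\<rho> x))) *\<^sub>R h x) + norm (f j x *\<^sub>R e x))"
          by (intro mult_left_mono) auto
        also have "\<dots> = \<bar>\<eta> x\<bar> * (\<bar>squash' k (\<phi> x)\<bar> * \<bar>cutzero (N j) (\<rho> x)\<bar> * (\<bar>\<rho> x\<bar> * norm (g x)))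
            + \<bar>\<eta> x\<bar> * \<bar>squash k (\<phi> x)\<bar> * \<bar>\<rho> x * cutzero' (N j) (\<rho> x)\<bar> * norm (h x) + \<bar>f j x\<bar> * norm (e x) * \<bar>\<rho> x\<bar>"
          by (simp add: abs_mult algebra_simps)
        also have "\<dots> \<le> E * (1 * 1 * (\<bar>\<rho> x\<bar> * norm (g x))) + E * k * 2 * norm (h x) + k * E' * \<bar>\<rho> x\<bar>"
          using z E E' k
          by (intro add_mono mult_mono mult_right_mono squash'_le squash_le mult_cutzero'_le fb N) auto
        finally have "\<bar>\<rho> x\<bar> * norm (u j x) \<le> ?A + ?B + ?C" by (simp add: mult_ac)
        then have "(\<bar>\<rho> x\<bar> * norm (u j x))\<^sup>2 \<le> (?A + ?B + ?C)\<^sup>2" by (rule power_mono) simp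
        also have "\<dots> \<le> 3 * (?A\<^sup>2 + ?B\<^sup>2 + ?C\<^sup>2)"
        proof -
          have "(p + q + r)\<^sup>2 \<le> 3 * (p\<^sup>2 + q\<^sup>2 + r\<^sup>2)" for p q r :: real
            using zero_le_power2[of "p - q"] zero_le_power2[of "q - r"] zero_le_power2[of "p - r"]
            by (simp add: power2_eq_square algebra_simps)
          then show ?thesis .
        qed
        also have "\<dots> = 3 * ?y x" by (simp add: H_def power_mult_distrib)
        also have "\<dots> \<le> 3 * (indicator K x * \<bar>?y x\<bar>)"
          unfolding indicator_simps(1)[OF True] mult_1_left by (rule mult_left_mono[OF abs_ge_self]) simp
        finally have 1: "(\<rho> x)\<^sup>2 * (norm (u j x))\<^sup>2 \<le> 3 * (indicator K x * \<bar>?y x\<bar>)" by (simp add: power_mult_distrib)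
        have "\<tau> j ((\<rho> x)\<^sup>2) * ((\<rho> x)\<^sup>2 * (norm (u j x))\<^sup>2) \<le> 1 * ((\<rho> x)\<^sup>2 * (norm (u j x))\<^sup>2)"
          using \<tau>b[of j x] by (intro mult_right_mono) auto
        then have "norm (\<tau> j ((\<rho> x)\<^sup>2) * (\<rho> x)\<^sup>2 * (norm (u j x))\<^sup>2) \<le> (\<rho> x)\<^sup>2 * (norm (u j x))\<^sup>2"
          using \<tau>b(1)[of j x] by (simp add: abs_mult mult_ac)
        then show ?thesis using 1 by (rule order_trans)
      qed (use K e0 in \<open>simp add: u_def\<close>)
    qed
  qed measurable
  have w0h: "(w0 x)\<^sup>2 * 1 / 2 \<le> 1 * (D * indicator K x)" for x
    using w0b[of x] zero_le_power2[of "w0 x"] by linarith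
  have i1: "integrable lebesgue (\<lambda>x. (w0 x)\<^sup>2 * 1 / 2 * l x)"
    by (rule integrable_locally_integrable_bound[OF lint_l K(1), where c="1 * D"], measurable, intro AE_I2 bnd)
      (use w0h in simp_all)
  have i2: "integrable lebesgue (\<lambda>x. (w0 x)\<^sup>2 * H x)"
    by (rule integrable_locally_integrable_bound[OF lintH K(1), where c="1 * D"], measurable, intro AE_I2 bnd)
      (use w0b in auto)
  have i3: "integrable lebesgue (\<lambda>x. (w0 x)\<^sup>2 * ((\<rho> x)\<^sup>2 / (x \<bullet> x)))"
    by (rule integrable_locally_integrable_bound[OF hardy_int K(1), where c="1 * D"], measurable, intro AE_I2 bnd)
      (use w0b in auto)
  have i4: "integrable lebesgue (\<lambda>x. (w0 x)\<^sup>2 * (\<rho> x)\<^sup>2)"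
    by (rule integrable_locally_integrable_bound[OF sq K(1), where c="1 * D"], measurable, intro AE_I2 bnd)
      (use w0b in auto)
  have w0w: "(w0 x)\<^sup>2 * ((\<rho> x)\<^sup>2 / (x \<bullet> x)) = (w x)\<^sup>2 * ((\<rho> x)\<^sup>2 / (x \<bullet> x))" "(w0 x)\<^sup>2 * (\<rho> x)\<^sup>2 = (\<rho> x)\<^sup>2 * (w x)\<^sup>2" for x
    by (simp_all add: ind2 ind_def)
  show "integrable lebesgue (\<lambda>x. (w x)\<^sup>2 * ((\<rho> x)\<^sup>2 / (x \<bullet> x)))"
    using i3 unfolding w0w .
  \<comment> \<open>Only in this limit does \<open>lower\<close> become applicable: for finite
    \<open>j\<close> the factor \<open>1 + 4 \<theta>\<close> spoils the combination
    \<open>l / 2 - |h|^2\<close>.\<close>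
  have "(LINT x|lebesgue. (w0 x)\<^sup>2 * 1 / 2 * l x) + (LINT x|lebesgue. - (w0 x)\<^sup>2 * 1 * (1 + 4 * 0) * H x)
      + (LINT x|lebesgue. (w0 x)\<^sup>2 * 1 * (1 - 0) * (a\<^sup>2 / (x \<bullet> x + 0)) * (\<rho> x)\<^sup>2) \<le> (LINT x|lebesgue. (\<rho> x)\<^sup>2 * (norm (W x))\<^sup>2)"
    by (rule LIMSEQ_le[OF tendsto_add[OF tendsto_add[OF L1 L2] L3] L4]) (use ineq in auto)
  also have "(LINT x|lebesgue. - (w0 x)\<^sup>2 * 1 * (1 + 4 * 0) * H x) = - (LINT x|lebesgue. (w0 x)\<^sup>2 * H x)"
    by simp
  also have "(LINT x|lebesgue. (w0 x)\<^sup>2 * 1 * (1 - 0) * (a\<^sup>2 / (x \<bullet> x + 0)) * (\<rho> x)\<^sup>2) = (LINT x|lebesgue. a\<^sup>2 * ((w0 x)\<^sup>2 * ((\<rho> x)\<^sup>2 / (x \<bullet> x))))"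
    by (rule Bochner_Integration.integral_cong) auto
  finally have up: "(LINT x|lebesgue. (w0 x)\<^sup>2 * 1 / 2 * l x) + - (LINT x|lebesgue. (w0 x)\<^sup>2 * H x) +
      (LINT x|lebesgue. a\<^sup>2 * ((w0 x)\<^sup>2 * ((\<rho> x)\<^sup>2 / (x \<bullet> x)))) \<le> (LINT x|lebesgue. (\<rho> x)\<^sup>2 * (norm (W x))\<^sup>2)" .
  have "(LINT x|lebesgue. c * ((w0 x)\<^sup>2 * ((\<rho> x)\<^sup>2 / (x \<bullet> x))) - C * ((w0 x)\<^sup>2 * (\<rho> x)\<^sup>2)) \<le>
    (LINT x|lebesgue. (w0 x)\<^sup>2 * 1 / 2 * l x - (w0 x)\<^sup>2 * H x + a\<^sup>2 * ((w0 x)\<^sup>2 * ((\<rho> x)\<^sup>2 / (x \<bullet> x))))"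
  proof (rule integral_mono_AE)
    show "integrable lebesgue (\<lambda>x. c * ((w0 x)\<^sup>2 * ((\<rho> x)\<^sup>2 / (x \<bullet> x))) - C * ((w0 x)\<^sup>2 * (\<rho> x)\<^sup>2))"
      by (intro Bochner_Integration.integrable_diff integrable_mult_right i3 i4)
    show "integrable lebesgue (\<lambda>x. (w0 x)\<^sup>2 * 1 / 2 * l x - (w0 x)\<^sup>2 * H x + a\<^sup>2 * ((w0 x)\<^sup>2 * ((\<rho> x)\<^sup>2 / (x \<bullet> x))))"
      by (intro Bochner_Integration.integrable_diff Bochner_Integration.integrable_add integrable_mult_right i1 i2 i3)
    show "AE x in lebesgue. c * ((w0 x)\<^sup>2 * ((\<rho> x)\<^sup>2 / (x \<bullet> x))) - C * ((w0 x)\<^sup>2 * (\<rho> x)\<^sup>2) \<le>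
        (w0 x)\<^sup>2 * 1 / 2 * l x - (w0 x)\<^sup>2 * H x + a\<^sup>2 * ((w0 x)\<^sup>2 * ((\<rho> x)\<^sup>2 / (x \<bullet> x)))"
      using lower
    proof (elim eventually_mono)
      fix x
      assume *: "\<rho> x \<noteq> 0 \<longrightarrow> (\<rho> x)\<^sup>2 * (c / (x \<bullet> x) - C) \<le> l x / 2 - (norm (h x))\<^sup>2 + a\<^sup>2 / (x \<bullet> x) * (\<rho> x)\<^sup>2"
      show "c * ((w0 x)\<^sup>2 * ((\<rho> x)\<^sup>2 / (x \<bullet> x))) - C * ((w0 x)\<^sup>2 * (\<rho> x)\<^sup>2) \<le>
        (w0 x)\<^sup>2 * 1 / 2 * l x - (w0 x)\<^sup>2 * H x + a\<^sup>2 * ((w0 x)\<^sup>2 * ((\<rho> x)\<^sup>2 / (x \<bullet> x)))"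
      proof (cases "\<rho> x = 0")
        case True
        then show ?thesis by (simp add: w0 ind_def)
      next
        case False
        from mult_left_mono[OF *[rule_format, OF False] zero_le_power2[of "w0 x"]]
        show ?thesis by (simp add: H_def algebra_simps)
      qed
    qed
  qed
  also have "\<dots> \<le> (LINT x|lebesgue. (\<rho> x)\<^sup>2 * (norm (W x))\<^sup>2)"
    using up[folded diff_conv_add_uminus] by (simp only: Bochner_Integration.integral_diff Bochner_Integration.integral_add Bochner_Integration.integrable_diff Bochner_Integration.integrable_add integrable_mult_right i1 i2 i3)
  also have "(LINT x|lebesgue. c * ((w0 x)\<^sup>2 * ((\<rho> x)\<^sup>2 / (x \<bullet> x))) - C * ((w0 x)\<^sup>2 * (\<rho> x)\<^sup>2)) =
    c * (LINT x|lebesgue. (w0 x)\<^sup>2 * ((\<rho> x)\<^sup>2 / (x \<bullet> x))) - C * (LINT x|lebesgue. (w0 x)\<^sup>2 * (\<rho> x)\<^sup>2)"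
    by (simp only: Bochner_Integration.integral_diff integrable_mult_right i3 i4 integral_mult_right_zero)
  finally show "c * (LINT x|lebesgue. (w x)\<^sup>2 * ((\<rho> x)\<^sup>2 / (x \<bullet> x))) \<le>
      (LINT x|lebesgue. (\<rho> x)\<^sup>2 * (norm (W x))\<^sup>2) + C * (LINT x|lebesgue. (\<rho> x)\<^sup>2 * (w x)\<^sup>2)"
    unfolding w0w by simp
qed

end

subsection \<open>Removing the truncations\<close>

text \<open>Squaring the positive part makes the cut-off continuously differentiable, which is the
  regularity \<open>hardy_truncated\<close> asks of \<open>\<eta>\<close>. With \<open>R = 1\<close>
  it also truncates the trial functions of the necessity part.\<close>

definition radial_cutoff :: "real \<Rightarrow> 'a::euclidean_space \<Rightarrow> real" where
  "radial_cutoff R x = (max 0 (1 - (x \<bullet> x) / R\<^sup>2))\<^sup>2"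

definition radial_cutoff_gradient :: "real \<Rightarrow> 'a::euclidean_space \<Rightarrow> 'a" where
  "radial_cutoff_gradient R x = (- 4 / R\<^sup>2 * max 0 (1 - (x \<bullet> x) / R\<^sup>2)) *\<^sub>R x"

lemma positive_part_square_deriv: "((\<lambda>t::real. (max 0 t)\<^sup>2) has_real_derivative 2 * max 0 t) (at t)"
proof -
  consider "t > 0" | "t < 0" | "t = 0" by linarith
  then show ?thesis
  proof cases
    case 1
    have "((\<lambda>t::real. t\<^sup>2) has_real_derivative 2 * t) (at t)"
      by (auto intro!: derivative_eq_intros)
    then have "((\<lambda>t::real. (max 0 t)\<^sup>2) has_real_derivative 2 * t) (at t)"
      by (rule has_field_derivative_transform_within_open[where S="{0<..}"]) (use 1 in auto)
    then show ?thesis using 1 by simp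
  next
    case 2
    have "((\<lambda>t::real. (max 0 t)\<^sup>2) has_real_derivative 0) (at t)"
      by (rule has_field_derivative_transform_within_open[where f="\<lambda>t. 0" and S="{..<0}"]) (use 2 in auto)
    then show ?thesis using 2 by simp
  next
    case 3
    have "((\<lambda>h::real. ((max 0 (0 + h))\<^sup>2 - (max 0 0)\<^sup>2) / h) \<longlongrightarrow> 0) (at 0)"
    proof (rule Lim_null_comparison)
      show "\<forall>\<^sub>F h in at (0::real). norm (((max 0 (0 + h))\<^sup>2 - (max 0 0)\<^sup>2) / h) \<le> \<bar>h\<bar>"
        by (rule always_eventually) (auto simp: max_def power2_eq_square abs_mult)
      show "((\<lambda>h::real. \<bar>h\<bar>) \<longlongrightarrow> 0) (at 0)"
        by (rule tendsto_rabs_zero) (rule tendsto_ident_at)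
    qed
    then show ?thesis using 3 by (simp add: DERIV_def)
  qed
qed

lemma radial_cutoff_has_gradient:
  assumes "R > 0"
  shows "has_cont_gradient (radial_cutoff R) (radial_cutoff_gradient R :: 'a::euclidean_space \<Rightarrow> 'a)"
proof -
  have "has_cont_gradient (\<lambda>x::'a. 1 + (- 1 / R\<^sup>2) * (x \<bullet> x)) (\<lambda>x. 0 + ((x \<bullet> x) *\<^sub>R 0 + (- 1 / R\<^sup>2) *\<^sub>R (2 *\<^sub>R x)))"
    by (intro has_cont_gradient_add has_cont_gradient_mult has_cont_gradient_const has_cont_gradient_inner_self)
  then have g: "has_cont_gradient (\<lambda>x::'a. 1 - (x \<bullet> x) / R\<^sup>2) (\<lambda>x. (- 2 / R\<^sup>2) *\<^sub>R x)"
    by simp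
  have "has_cont_gradient (\<lambda>x::'a. (max 0 (1 - (x \<bullet> x) / R\<^sup>2))\<^sup>2) (\<lambda>x. (2 * max 0 (1 - (x \<bullet> x) / R\<^sup>2)) *\<^sub>R ((- 2 / R\<^sup>2) *\<^sub>R x))"
    by (rule has_cont_gradient_compose[OF g positive_part_square_deriv]) (intro continuous_intros)
  then show ?thesis
    unfolding radial_cutoff_def[abs_def] radial_cutoff_gradient_def[abs_def] by (simp add: mult.commute)
qed

lemma radial_cutoff_eq_0:
  assumes "R > 0" "x \<notin> cball 0 R"
  shows "radial_cutoff R x = 0" "radial_cutoff_gradient R x = 0"
proof -
  have "R\<^sup>2 < (norm x)\<^sup>2" using assms by (intro power_strict_mono) auto
  then have "1 - (x \<bullet> x) / R\<^sup>2 \<le> 0" using assms by (simp add: dot_square_norm)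
  then show "radial_cutoff R x = 0" "radial_cutoff_gradient R x = 0"
    by (simp_all add: radial_cutoff_def radial_cutoff_gradient_def max_def)
qed

lemma positive_part_bounds:
  fixes x :: "'a::euclidean_space"
  shows "0 \<le> max 0 (1 - (x \<bullet> x) / R\<^sup>2)" "max 0 (1 - (x \<bullet> x) / R\<^sup>2) \<le> 1"
  by auto

lemma radial_cutoff_bounds: "0 \<le> radial_cutoff R x" "radial_cutoff R x \<le> 1"
  unfolding radial_cutoff_def using positive_part_bounds[of x R] by (auto intro: power_le_one)

text \<open>The formula has \<open>R^2\<close> in the denominator, and \<open>|x| \<le> R\<close> on
  the support takes back one power; the remaining one makes the gradient vanish as \<open>R\<close>
  grows.\<close>

lemma norm_radial_cutoff_gradient_le:
  assumes "R > 0"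
  shows "norm (radial_cutoff_gradient R x) \<le> 4 / R"
proof (cases "x \<in> cball 0 R")
  case True
  have "norm (radial_cutoff_gradient R x) = 4 / R\<^sup>2 * max 0 (1 - (x \<bullet> x) / R\<^sup>2) * norm x"
    using positive_part_bounds[of x R] by (simp add: radial_cutoff_gradient_def abs_mult)
  also have "\<dots> \<le> 4 / R\<^sup>2 * 1 * R"
    using True positive_part_bounds[of x R] assms by (intro mult_mono) auto
  also have "\<dots> = 4 / R" using assms by (simp add: power2_eq_square)
  finally show ?thesis .
qed (use assms radial_cutoff_eq_0[OF assms, of x] in simp)

lemma radial_cutoff_tendsto: "(\<lambda>n. radial_cutoff (real (Suc n)) x) \<longlonglongrightarrow> 1"
proof -
  have "(\<lambda>n. (max 0 (1 - (x \<bullet> x) * (inverse (real (Suc n)))\<^sup>2))\<^sup>2) \<longlonglongrightarrow> (max 0 (1 - (x \<bullet> x) * 0\<^sup>2))\<^sup>2"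
    by (intro tendsto_intros LIMSEQ_inverse_real_of_nat)
  then show ?thesis by (simp add: radial_cutoff_def divide_inverse power_inverse)
qed

lemma radial_cutoff_gradient_tendsto: "(\<lambda>n. radial_cutoff_gradient (real (Suc n)) x) \<longlonglongrightarrow> 0"
proof (rule Lim_null_comparison)
  show "\<forall>\<^sub>F n in sequentially. norm (radial_cutoff_gradient (real (Suc n)) x) \<le> 4 * inverse (real (Suc n))"
    using norm_radial_cutoff_gradient_le[of "real (Suc n)" x for n] by (intro always_eventually allI) (simp add: divide_inverse)
  show "(\<lambda>n. 4 * inverse (real (Suc n))) \<longlonglongrightarrow> 0"
    using tendsto_mult_left[OF LIMSEQ_inverse_real_of_nat, of 4] by simp
qed

context sobolev_weight
begin

text \<open>Truncation height and cut-off radius grow together. Finiteness of the Hardy term is part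
  of the conclusion, hence Fatou's lemma on the left; division by the positive \<open>c\<close> puts
  the bound in the form in which Fatou delivers it. The right-hand side converges by domination with
  the two weighted norms.\<close>

lemma hardy_limit:
  fixes \<phi> :: "'a \<Rightarrow> real" and g :: "'a \<Rightarrow> 'a" and c C :: real
  assumes phi: "has_weak_gradient \<phi> g"
    and wg: "integrable lebesgue (\<lambda>x. (\<rho> x)\<^sup>2 * (norm (g x))\<^sup>2)"
    and wphi: "integrable lebesgue (\<lambda>x. (\<rho> x)\<^sup>2 * (\<phi> x)\<^sup>2)"
    and hardy_int: "locally_integrable lebesgue (\<lambda>x. (\<rho> x)\<^sup>2 / (x \<bullet> x))"
    and lower: "AE x in lebesgue. \<rho> x \<noteq> 0 \<longrightarrow>
      (\<rho> x)\<^sup>2 * (c / (x \<bullet> x) - C) \<le> l x / 2 - (norm (h x))\<^sup>2 + a\<^sup>2 / (x \<bullet> x) * (\<rho> x)\<^sup>2"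
    and c: "c > 0"
  shows "(\<integral>\<^sup>+ x. ennreal ((\<phi> x)\<^sup>2 * ((\<rho> x)\<^sup>2 / (x \<bullet> x))) \<partial>lebesgue) \<le>
    ennreal (((LINT x|lebesgue. (\<rho> x)\<^sup>2 * (norm (g x))\<^sup>2) + C * (LINT x|lebesgue. (\<rho> x)\<^sup>2 * (\<phi> x)\<^sup>2)) / c)"
proof -
  define N where "N = (\<lambda>j::nat. real (Suc j))"
  have N: "N j > 0" "N j \<ge> 1" for j by (auto simp: N_def)
  define w where "w = (\<lambda>j x. radial_cutoff (N j) x * squash (N j) (\<phi> x))"
  define W where "W = (\<lambda>j x. (radial_cutoff (N j) x * squash' (N j) (\<phi> x)) *\<^sub>R g x + squash (N j) (\<phi> x) *\<^sub>R radial_cutoff_gradient (N j) x)"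
  have [measurable]: "\<phi> \<in> borel_measurable lebesgue" "g \<in> borel_measurable lebesgue" "\<rho> \<in> borel_measurable lebesgue"
    using phi grad by (auto simp: has_weak_gradient_def intro: locally_integrable_measurable)
  have [measurable]: "squash (N j) \<in> borel_measurable borel" "squash' (N j) \<in> borel_measurable borel" for j
    by (intro borel_measurable_continuous_onI squash_continuous squash'_continuous N)+
  have [measurable]: "radial_cutoff (N j) \<in> borel_measurable (lebesgue :: 'a measure)" "radial_cutoff_gradient (N j) \<in> borel_measurable (lebesgue :: 'a measure)" for j
    using radial_cutoff_has_gradient[OF N(1)[of j], where 'a='a]
    by (auto intro!: continuous_borel_measurable_lebesgue intro: has_cont_gradient_cont has_cont_gradient_cont_grad)
  have [measurable]: "w j \<in> borel_measurable lebesgue" "W j \<in> borel_measurable lebesgue" for j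
    unfolding w_def W_def by measurable
  have [measurable]: "(\<lambda>x::'a. x \<bullet> x) \<in> borel_measurable lebesgue"
    by (intro continuous_borel_measurable_lebesgue continuous_intros)
  have wi: "integrable lebesgue (\<lambda>x. (w j x)\<^sup>2 * ((\<rho> x)\<^sup>2 / (x \<bullet> x)))" for j
    unfolding w_def
    by (rule hardy_truncated(1)[OF phi wg hardy_int lower radial_cutoff_has_gradient[OF N(1)[of j]] compact_cball[of 0 "N j"] radial_cutoff_eq_0(1)[OF N(1)[of j]] N(1)[of j]])
  have ineq: "c * (LINT x|lebesgue. (w j x)\<^sup>2 * ((\<rho> x)\<^sup>2 / (x \<bullet> x))) \<le>
      (LINT x|lebesgue. (\<rho> x)\<^sup>2 * (norm (W j x))\<^sup>2) + C * (LINT x|lebesgue. (\<rho> x)\<^sup>2 * (w j x)\<^sup>2)" for j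
    unfolding w_def W_def
    by (rule hardy_truncated(2)[OF phi wg hardy_int lower radial_cutoff_has_gradient[OF N(1)[of j]] compact_cball[of 0 "N j"] radial_cutoff_eq_0(1)[OF N(1)[of j]] N(1)[of j]])
  have wlim: "(\<lambda>j. w j x) \<longlonglongrightarrow> \<phi> x" for x
  proof -
    have "(\<lambda>j. w j x) \<longlonglongrightarrow> 1 * \<phi> x"
      unfolding w_def N_def by (intro tendsto_mult radial_cutoff_tendsto squash_tendsto)
    then show ?thesis by simp
  qed
  have Wlim: "(\<lambda>j. W j x) \<longlonglongrightarrow> g x" for x
  proof -
    have "(\<lambda>j. W j x) \<longlonglongrightarrow> (1 * 1) *\<^sub>R g x + \<phi> x *\<^sub>R 0"
      unfolding W_def N_def by (intro tendsto_add tendsto_scaleR tendsto_mult tendsto_const radial_cutoff_tendsto squash_tendsto squash'_tendsto radial_cutoff_gradient_tendsto)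
    then show ?thesis by simp
  qed
  have wb: "(w j x)\<^sup>2 \<le> (\<phi> x)\<^sup>2" for j x
  proof -
    have "\<bar>radial_cutoff (N j) x\<bar> * \<bar>squash (N j) (\<phi> x)\<bar> \<le> 1 * \<bar>\<phi> x\<bar>"
      using radial_cutoff_bounds[of "N j" x] by (intro mult_mono squash_le_abs) auto
    then have "\<bar>w j x\<bar> \<le> \<bar>\<phi> x\<bar>" by (simp add: w_def abs_mult)
    then show ?thesis by (simp add: abs_le_square_iff)
  qed
  \<comment> \<open>4 bounds \<open>4 / N j\<close>, and \<open>32 = 2 * 4^2\<close>.\<close>
  have Wb: "(norm (W j x))\<^sup>2 \<le> 2 * (norm (g x))\<^sup>2 + 32 * (\<phi> x)\<^sup>2" for j x
  proof -
    have "norm (W j x) \<le> norm ((radial_cutoff (N j) x * squash' (N j) (\<phi> x)) *\<^sub>R g x) + norm (squash (N j) (\<phi> x) *\<^sub>R radial_cutoff_gradient (N j) x)"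
      unfolding W_def by (rule norm_triangle_ineq)
    also have "\<dots> = \<bar>radial_cutoff (N j) x\<bar> * \<bar>squash' (N j) (\<phi> x)\<bar> * norm (g x) + \<bar>squash (N j) (\<phi> x)\<bar> * norm (radial_cutoff_gradient (N j) x)"
      by (simp add: abs_mult)
    also have "\<dots> \<le> 1 * 1 * norm (g x) + \<bar>\<phi> x\<bar> * 4"
    proof (intro add_mono mult_mono mult_right_mono squash_le_abs squash'_le N)
      have "4 / N j \<le> 4" using N[of j] by (simp add: divide_le_eq)
      then show "norm (radial_cutoff_gradient (N j) x) \<le> 4"
        using norm_radial_cutoff_gradient_le[OF N(1)[of j], of x] by simp
    qed (use radial_cutoff_bounds[of "N j" x] in auto)
    finally have "(norm (W j x))\<^sup>2 \<le> (norm (g x) + 4 * \<bar>\<phi> x\<bar>)\<^sup>2" by (intro power_mono) auto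
    also have "\<dots> \<le> 2 * (norm (g x))\<^sup>2 + 2 * (4 * \<bar>\<phi> x\<bar>)\<^sup>2"
      using sum_squares_bound[of "norm (g x)" "4 * \<bar>\<phi> x\<bar>"] by (simp add: power2_sum)
    finally show ?thesis by (simp add: power_mult_distrib)
  qed
  have L1: "(\<lambda>j. LINT x|lebesgue. (\<rho> x)\<^sup>2 * (norm (W j x))\<^sup>2) \<longlonglongrightarrow> (LINT x|lebesgue. (\<rho> x)\<^sup>2 * (norm (g x))\<^sup>2)"
  proof (rule integral_dominated_convergence)
    show "integrable lebesgue (\<lambda>x. 2 * ((\<rho> x)\<^sup>2 * (norm (g x))\<^sup>2) + 32 * ((\<rho> x)\<^sup>2 * (\<phi> x)\<^sup>2))"
      using wg wphi by auto
    show "AE x in lebesgue. (\<lambda>j. (\<rho> x)\<^sup>2 * (norm (W j x))\<^sup>2) \<longlonglongrightarrow> (\<rho> x)\<^sup>2 * (norm (g x))\<^sup>2"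
      by (intro AE_I2 tendsto_intros Wlim)
    show "AE x in lebesgue. norm ((\<rho> x)\<^sup>2 * (norm (W j x))\<^sup>2) \<le> 2 * ((\<rho> x)\<^sup>2 * (norm (g x))\<^sup>2) + 32 * ((\<rho> x)\<^sup>2 * (\<phi> x)\<^sup>2)" for j
    proof (intro AE_I2)
      fix x
      show "norm ((\<rho> x)\<^sup>2 * (norm (W j x))\<^sup>2) \<le> 2 * ((\<rho> x)\<^sup>2 * (norm (g x))\<^sup>2) + 32 * ((\<rho> x)\<^sup>2 * (\<phi> x)\<^sup>2)"
        using mult_left_mono[OF Wb[of j x] zero_le_power2[of "\<rho> x"]] by (simp add: algebra_simps)
    qed
  qed measurable
  have L2: "(\<lambda>j. LINT x|lebesgue. (\<rho> x)\<^sup>2 * (w j x)\<^sup>2) \<longlonglongrightarrow> (LINT x|lebesgue. (\<rho> x)\<^sup>2 * (\<phi> x)\<^sup>2)"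
  proof (rule integral_dominated_convergence[OF _ _ wphi])
    show "AE x in lebesgue. (\<lambda>j. (\<rho> x)\<^sup>2 * (w j x)\<^sup>2) \<longlonglongrightarrow> (\<rho> x)\<^sup>2 * (\<phi> x)\<^sup>2"
      by (intro AE_I2 tendsto_intros wlim)
    show "AE x in lebesgue. norm ((\<rho> x)\<^sup>2 * (w j x)\<^sup>2) \<le> (\<rho> x)\<^sup>2 * (\<phi> x)\<^sup>2" for j
      using mult_left_mono[OF wb zero_le_power2] by (intro AE_I2) simp
  qed measurable
  define b where "b = (\<lambda>j. ((LINT x|lebesgue. (\<rho> x)\<^sup>2 * (norm (W j x))\<^sup>2) + C * (LINT x|lebesgue. (\<rho> x)\<^sup>2 * (w j x)\<^sup>2)) / c)"
  have "(\<integral>\<^sup>+ x. ennreal ((\<phi> x)\<^sup>2 * ((\<rho> x)\<^sup>2 / (x \<bullet> x))) \<partial>lebesgue) = (\<integral>\<^sup>+ x. liminf (\<lambda>j. ennreal ((w j x)\<^sup>2 * ((\<rho> x)\<^sup>2 / (x \<bullet> x)))) \<partial>lebesgue)"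
  proof (rule nn_integral_cong)
    fix x :: 'a
    have "(\<lambda>j. ennreal ((w j x)\<^sup>2 * ((\<rho> x)\<^sup>2 / (x \<bullet> x)))) \<longlonglongrightarrow> ennreal ((\<phi> x)\<^sup>2 * ((\<rho> x)\<^sup>2 / (x \<bullet> x)))"
      by (intro tendsto_ennrealI tendsto_mult tendsto_const tendsto_power wlim)
    from lim_imp_Liminf[OF _ this] show "ennreal ((\<phi> x)\<^sup>2 * ((\<rho> x)\<^sup>2 / (x \<bullet> x))) = liminf (\<lambda>j. ennreal ((w j x)\<^sup>2 * ((\<rho> x)\<^sup>2 / (x \<bullet> x))))"
      by simp
  qed
  also have "\<dots> \<le> liminf (\<lambda>j. \<integral>\<^sup>+ x. ennreal ((w j x)\<^sup>2 * ((\<rho> x)\<^sup>2 / (x \<bullet> x))) \<partial>lebesgue)"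
    by (rule nn_integral_liminf) measurable
  also have "\<dots> \<le> liminf (\<lambda>j. ennreal (b j))"
  proof (rule Liminf_mono, rule always_eventually, rule allI)
    fix j
    have "(\<integral>\<^sup>+ x. ennreal ((w j x)\<^sup>2 * ((\<rho> x)\<^sup>2 / (x \<bullet> x))) \<partial>lebesgue) = ennreal (LINT x|lebesgue. (w j x)\<^sup>2 * ((\<rho> x)\<^sup>2 / (x \<bullet> x)))"
      by (rule nn_integral_eq_integral[OF wi]) simp
    also have "\<dots> \<le> ennreal (b j)"
      unfolding b_def using ineq[of j] c by (intro ennreal_leI) (simp add: le_divide_eq mult.commute)
    finally show "(\<integral>\<^sup>+ x. ennreal ((w j x)\<^sup>2 * ((\<rho> x)\<^sup>2 / (x \<bullet> x))) \<partial>lebesgue) \<le> ennreal (b j)" .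
  qed
  also have "\<dots> = ennreal (((LINT x|lebesgue. (\<rho> x)\<^sup>2 * (norm (g x))\<^sup>2) + C * (LINT x|lebesgue. (\<rho> x)\<^sup>2 * (\<phi> x)\<^sup>2)) / c)"
  proof (rule lim_imp_Liminf)
    show "(\<lambda>j. ennreal (b j)) \<longlonglongrightarrow> ennreal (((LINT x|lebesgue. (\<rho> x)\<^sup>2 * (norm (g x))\<^sup>2) + C * (LINT x|lebesgue. (\<rho> x)\<^sup>2 * (\<phi> x)\<^sup>2)) / c)"
      unfolding b_def using c by (intro tendsto_ennrealI tendsto_divide tendsto_add tendsto_mult tendsto_const L1 L2) auto
  qed simp
  finally show ?thesis .
qed

end

subsection \<open>Sufficiency of \<open>c < c0 N0\<close>\<close>

lemma weighted_measure_measurable: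
  "(f \<in> borel_measurable (weighted_measure \<mu>)) = (f \<in> borel_measurable lebesgue)"
  by (simp add: weighted_measure_def measurable_cong_sets[OF sets_density refl])

lemma AE_weighted_measure:
  assumes "\<mu> \<in> borel_measurable lebesgue"
  shows "(AE x in weighted_measure \<mu>. P x) \<longleftrightarrow> (AE x in lebesgue. 0 < \<mu> x \<longrightarrow> P x)"
  unfolding weighted_measure_def using assms by (subst AE_density) (auto simp: ennreal_zero_less_mult_iff)

lemma integrable_weighted_measure:
  fixes f :: "'a::euclidean_space \<Rightarrow> real"
  assumes "\<mu> \<in> borel_measurable lebesgue" "\<And>x. \<mu> x \<ge> 0" "f \<in> borel_measurable lebesgue"
  shows "integrable (weighted_measure \<mu>) f \<longleftrightarrow> integrable lebesgue (\<lambda>x. \<mu> x * f x)"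
  unfolding weighted_measure_def using assms by (subst integrable_density) auto

lemma integral_weighted_measure:
  fixes f :: "'a::euclidean_space \<Rightarrow> real"
  assumes "\<mu> \<in> borel_measurable lebesgue" "\<And>x. \<mu> x \<ge> 0" "f \<in> borel_measurable lebesgue"
  shows "(LINT x|weighted_measure \<mu>. f x) = (LINT x|lebesgue. \<mu> x * f x)"
  unfolding weighted_measure_def using assms by (subst integral_density) auto

lemma nn_integral_weighted_measure:
  fixes f :: "'a::euclidean_space \<Rightarrow> ennreal"
  assumes "\<mu> \<in> borel_measurable lebesgue" "f \<in> borel_measurable lebesgue"
  shows "(\<integral>\<^sup>+ x. f x \<partial>weighted_measure \<mu>) = (\<integral>\<^sup>+ x. ennreal (\<mu> x) * f x \<partial>lebesgue)"
  unfolding weighted_measure_def using assms by (subst nn_integral_density) auto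

lemma norm_powr_measurable [measurable]:
  "(\<lambda>x::'a::euclidean_space. norm x powr c) \<in> borel_measurable lebesgue"
  by (rule measurable_completion) (simp, measurable)

text \<open>Inside the unit ball the larger exponent dominates, and outside it every such power is
  at most 1; hence the sum of both majorants.\<close>

lemma locally_integrable_N0_set:
  fixes \<mu> :: "'a::euclidean_space \<Rightarrow> real"
  assumes mu: "locally_integrable lebesgue \<mu>" "\<And>x. \<mu> x \<ge> 0"
    and "\<delta> \<in> N0_set \<mu>" "0 \<le> \<delta>'" "\<delta>' \<le> \<delta>"
  shows "locally_integrable lebesgue (\<lambda>x. \<mu> x * norm x powr (- \<delta>'))"
proof (rule locally_integrable_bound)
  note m [measurable] = locally_integrable_measurable[OF mu(1)]
  have "locally_integrable lebesgue (\<lambda>x. \<mu> x * norm x powr (- \<delta>))"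
    unfolding locally_integrable_def
  proof (intro allI impI)
    fix K :: "'a set" assume K: "compact K"
    have [measurable]: "indicat_real K \<in> borel_measurable lebesgue"
      using fmeasurableD[OF lmeasurable_compact[OF K]] by measurable
    have "integrable (weighted_measure \<mu>) (\<lambda>x. indicat_real K x * norm x powr (- \<delta>))"
      using assms(3) K by (auto simp: N0_set_def locally_integrable_def set_integrable_def)
    then have "integrable lebesgue (\<lambda>x. \<mu> x * (indicat_real K x * norm x powr (- \<delta>)))"
      by (subst (asm) integrable_weighted_measure[OF m mu(2)]) auto
    then show "set_integrable lebesgue K (\<lambda>x. \<mu> x * norm x powr (- \<delta>))"
      unfolding set_integrable_def by (simp add: mult_ac)
  qed
  then show "locally_integrable lebesgue (\<lambda>x. \<mu> x * norm x powr (- \<delta>) + \<mu> x)"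
    by (rule locally_integrable_add) (rule mu)
  show "(\<lambda>x. \<mu> x * norm x powr (- \<delta>')) \<in> borel_measurable lebesgue" by measurable
  fix x :: 'a
  have "norm x powr (- \<delta>') \<le> norm x powr (- \<delta>) + 1"
  proof (cases "norm x \<le> 1")
    case True
    then have "norm x powr (- \<delta>') \<le> norm x powr (- \<delta>)"
      using assms(5) by (intro powr_mono') auto
    then show ?thesis by simp
  next
    case False
    then have "norm x powr (- \<delta>') \<le> norm x powr 0"
      using assms(4) by (intro powr_mono) auto
    moreover have "norm x powr 0 = 1" using False by auto
    ultimately show ?thesis using powr_ge_zero[of "norm x" "- \<delta>"] by linarith
  qed
  from mult_left_mono[OF this mu(2)[of x]]
  show "norm (\<mu> x * norm x powr (- \<delta>')) \<le> \<mu> x * norm x powr (- \<delta>) + \<mu> x"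
    using mu(2)[of x] by (simp add: algebra_simps abs_mult)
qed

text \<open>2 lies strictly below the supremum of the admissible exponents, so some admissible
  exponent exceeds it. This is the integrability hypothesis of \<open>hardy_truncated\<close> and
  \<open>hardy_limit\<close>.\<close>

lemma Hardy_potential_locally_integrable:
  fixes \<mu> :: "'a::euclidean_space \<Rightarrow> real"
  assumes mu: "locally_integrable lebesgue \<mu>" "\<And>x. \<mu> x \<ge> 0"
    and N0: "N0_set \<mu> \<noteq> {}" "N0 \<mu> > 2"
  shows "locally_integrable lebesgue (\<lambda>x. \<mu> x / (x \<bullet> x))"
proof -
  obtain \<delta> where d: "\<delta> \<in> N0_set \<mu>" "2 < \<delta>"
    using N0 less_cSupE[of 2 "N0_set \<mu>"] unfolding N0_def by blast
  \<comment> \<open>At the origin both sides are 0 by the conventions for \<open>powr\<close> and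
    for division.\<close>
  have "norm x powr (- 2) = 1 / (x \<bullet> x)" for x :: 'a
    by (cases "x = 0") (simp_all add: powr_minus inverse_eq_divide dot_square_norm)
  then show ?thesis
    using locally_integrable_N0_set[OF mu d(1), of 2] d(2) by simp
qed

text \<open>With \<open>\<nabla>\<mu> = 2 sqrt \<mu> h\<close> the quadratic term of the potential
  is \<open>|h|^2 / \<mu>\<close>; multiplication by \<open>\<mu>\<close> gives, up to sign, the
  terms left over by the completed square.\<close>

lemma U_pot_eq:
  fixes \<mu> :: "'a::euclidean_space \<Rightarrow> real"
  assumes "weak_gradient \<mu> x = (2 * sqrt (\<mu> x)) *\<^sub>R h" "\<mu> x > 0"
  shows "\<mu> x * U_pot \<mu> x = (norm h)\<^sup>2 - weak_laplacian \<mu> x / 2"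
proof -
  have "norm (weak_gradient \<mu> x /\<^sub>R \<mu> x) = 2 * sqrt (\<mu> x) * norm h / \<mu> x"
    using assms by (simp add: divide_inverse abs_mult mult_ac)
  then have "(norm (weak_gradient \<mu> x /\<^sub>R \<mu> x))\<^sup>2 = 4 * (norm h)\<^sup>2 / \<mu> x"
    using assms(2) by (simp add: power_divide power_mult_distrib) (simp add: power2_eq_square)
  then show ?thesis
    using assms(2) by (simp add: U_pot_def field_simps)
qed

text \<open>A property holds eventually along the infimum of the two filters when it holds on the
  intersection of a punctured ball with a set of full weighted measure; this turns the essential
  lower limit into a pointwise bound near the origin.\<close>

lemma c0_weighted_eventually:
  fixes \<mu> :: "'a::euclidean_space \<Rightarrow> real"
  assumes m: "\<mu> \<in> borel_measurable lebesgue" and c: "ereal c < c0_weighted \<mu>"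
  obtains r where "r > 0"
    "AE x in lebesgue. 0 < \<mu> x \<longrightarrow> x \<noteq> 0 \<longrightarrow> norm x < r \<longrightarrow> c < c0 (real DIM('a)) - (norm x)\<^sup>2 * U_pot \<mu> x"
proof -
  have "\<forall>\<^sub>F x in essential_at_zero \<mu>. ereal c < ereal (c0 (real DIM('a)) - (norm x)\<^sup>2 * U_pot \<mu> x)"
    using c unfolding c0_weighted_def by (rule less_LiminfD)
  then have "\<forall>\<^sub>F x in inf (at 0) (ae_filter (weighted_measure \<mu>)). c < c0 (real DIM('a)) - (norm x)\<^sup>2 * U_pot \<mu> x"
    by (simp add: essential_at_zero_def)
  then obtain Q R where Q: "eventually Q (at 0)" and R: "AE x in weighted_measure \<mu>. R x"
    and QR: "\<And>x. Q x \<Longrightarrow> R x \<Longrightarrow> c < c0 (real DIM('a)) - (norm x)\<^sup>2 * U_pot \<mu> x"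
    unfolding eventually_inf by blast
  obtain r where r: "r > 0" "\<And>x. x \<noteq> 0 \<Longrightarrow> norm x < r \<Longrightarrow> Q x"
    using Q unfolding eventually_at by (auto simp: dist_norm)
  show ?thesis
  proof (rule that[OF r(1)])
    show "AE x in lebesgue. 0 < \<mu> x \<longrightarrow> x \<noteq> 0 \<longrightarrow> norm x < r \<longrightarrow> c < c0 (real DIM('a)) - (norm x)\<^sup>2 * U_pot \<mu> x"
      using R unfolding AE_weighted_measure[OF m] by (elim eventually_mono) (use r(2) QR in blast)
  qed
qed

text \<open>The intermediate constant \<open>c'\<close> is positive even if \<open>c\<close> is not:
  \<open>hardy_limit\<close> divides by it. The passage from \<open>c'\<close> to \<open>c\<close>
  then rests on the Hardy term being finite and nonnegative.\<close>

lemma weighted_Hardy_sufficient: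
  fixes \<mu> :: "'a::euclidean_space \<Rightarrow> real"
  assumes dim: "DIM('a) \<ge> 3"
    and nonneg: "\<And>x. \<mu> x \<ge> 0"
    and sqrt_H1: "(\<lambda>x. sqrt (\<mu> x)) \<in> H1_loc"
    and laplacian: "\<exists>l. has_weak_laplacian \<mu> l"
    and U_bounded: "\<And>R. R > 0 \<Longrightarrow>
      \<exists>K. AE x in weighted_measure \<mu>. x \<notin> ball 0 R \<longrightarrow> U_reduced \<mu> x \<le> K"
    and loc_int: "locally_integrable lebesgue \<mu>"
    and N0: "N0_set \<mu> \<noteq> {}" "N0 \<mu> > 2"
    and c': "c' > 0" "ereal c' < c0_weighted \<mu>" and c: "c \<le> c'"
  shows "\<exists>C. \<forall>\<phi>\<in>H1_weighted \<mu>. weighted_Hardy_inequality \<mu> c C \<phi>"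
proof -
  define \<rho> where "\<rho> = (\<lambda>x. sqrt (\<mu> x))"
  define h where "h = weak_gradient \<rho>"
  define l where "l = weak_laplacian \<mu>"
  define a where "a = (real DIM('a) - 2) / 2"
  have rho2: "(\<rho> x)\<^sup>2 = \<mu> x" for x using nonneg by (simp add: \<rho>_def)
  have m [measurable]: "\<mu> \<in> borel_measurable lebesgue" by (rule locally_integrable_measurable[OF loc_int])
  have gr: "has_weak_gradient \<rho> h"
    using sqrt_H1 unfolding H1_loc_def h_def \<rho>_def by (auto intro: has_weak_gradient_weak_gradient)
  have h2: "locally_integrable lebesgue (\<lambda>x. (norm (h x))\<^sup>2)"
    using sqrt_H1 by (simp add: H1_loc_def h_def \<rho>_def locally_square_integrable_def)
  have lap: "has_weak_laplacian \<mu> l"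
    using laplacian unfolding l_def by (auto intro: has_weak_laplacian_weak_laplacian)
  interpret sobolev_weight \<rho> h l a
    by unfold_locales (use dim gr h2 lap loc_int in \<open>simp_all add: rho2 a_def\<close>)
  have hi: "locally_integrable lebesgue (\<lambda>x. (\<rho> x)\<^sup>2 / (x \<bullet> x))"
    unfolding rho2 by (rule Hardy_potential_locally_integrable[OF loc_int nonneg N0])
  have wgm: "AE x in lebesgue. weak_gradient \<mu> x = (2 * \<rho> x) *\<^sub>R h x"
    using weak_gradient_eq_AE[OF grad2] unfolding rho2 by simp
  obtain r where r: "r > 0"
    "AE x in lebesgue. 0 < \<mu> x \<longrightarrow> x \<noteq> 0 \<longrightarrow> norm x < r \<longrightarrow> c' < c0 (real DIM('a)) - (norm x)\<^sup>2 * U_pot \<mu> x"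
    using c0_weighted_eventually[OF m c'(2)] by blast
  obtain K where K: "AE x in lebesgue. 0 < \<mu> x \<longrightarrow> x \<notin> ball 0 r \<longrightarrow> U_reduced \<mu> x \<le> K"
    using U_bounded[OF r(1)] unfolding AE_weighted_measure[OF m] by blast
  define S where "S = real_of_ereal (limsup_U_pot \<mu>)"
  \<comment> \<open>Off the ball of radius \<open>r\<close> the potential is at most
    \<open>K + S / |x|^2\<close>. There \<open>|S| / |x|^2\<close> and the wanted
    \<open>c' / |x|^2\<close> do not exceed their values at radius \<open>r\<close>, so
    \<open>C\<close> absorbs all three.\<close>
  define C where "C = \<bar>K\<bar> + (\<bar>S\<bar> + c') / r\<^sup>2"
  have C0: "C \<ge> 0" using c' by (simp add: C_def)
  have a2: "a\<^sup>2 = c0 (real DIM('a))" by (simp add: a_def c0_def)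
  have lower: "AE x in lebesgue. \<rho> x \<noteq> 0 \<longrightarrow>
      (\<rho> x)\<^sup>2 * (c' / (x \<bullet> x) - C) \<le> l x / 2 - (norm (h x))\<^sup>2 + a\<^sup>2 / (x \<bullet> x) * (\<rho> x)\<^sup>2"
    using wgm r(2) K AE_lebesgue_neq_0[where 'a='a]
  proof eventually_elim
    case (elim x)
    show ?case
    proof
      assume "\<rho> x \<noteq> 0"
      then have mu: "\<mu> x > 0" using nonneg[of x] by (simp add: \<rho>_def)
      have xx: "x \<bullet> x > 0" using elim(4) by simp
      have U: "\<mu> x * U_pot \<mu> x = (norm (h x))\<^sup>2 - l x / 2"
        using U_pot_eq[of \<mu> x "h x"] elim(1) mu by (simp add: l_def \<rho>_def)
      have "c' / (x \<bullet> x) - C \<le> a\<^sup>2 / (x \<bullet> x) - U_pot \<mu> x"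
      proof (cases "norm x < r")
        case True
        then have "c' < a\<^sup>2 - (x \<bullet> x) * U_pot \<mu> x"
          using elim(2,4) mu by (simp add: a2 dot_square_norm)
        then have "c' / (x \<bullet> x) \<le> (a\<^sup>2 - (x \<bullet> x) * U_pot \<mu> x) / (x \<bullet> x)"
          using xx by (intro divide_right_mono) auto
        also have "\<dots> = a\<^sup>2 / (x \<bullet> x) - U_pot \<mu> x" using xx by (simp add: field_simps)
        finally show ?thesis using C0 by simp
      next
        case False
        then have "U_reduced \<mu> x \<le> K" using elim(3) mu by simp
        then have u: "U_pot \<mu> x \<le> K + S / (x \<bullet> x)"
          by (simp add: U_reduced_def S_def dot_square_norm)
        have "r\<^sup>2 \<le> x \<bullet> x" unfolding dot_square_norm using False r(1) by (intro power_mono) auto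
        then have "(\<bar>S\<bar> + c') / (x \<bullet> x) \<le> (\<bar>S\<bar> + c') / r\<^sup>2"
          using r(1) xx c'(1) by (intro divide_left_mono) auto
        moreover have "S / (x \<bullet> x) \<le> \<bar>S\<bar> / (x \<bullet> x)" using xx by (intro divide_right_mono) auto
        moreover have "0 \<le> a\<^sup>2 / (x \<bullet> x)" using xx by simp
        ultimately show ?thesis using u abs_ge_self[of K] unfolding C_def add_divide_distrib by linarith
      qed
      from mult_left_mono[OF this nonneg[of x]]
      show "(\<rho> x)\<^sup>2 * (c' / (x \<bullet> x) - C) \<le> l x / 2 - (norm (h x))\<^sup>2 + a\<^sup>2 / (x \<bullet> x) * (\<rho> x)\<^sup>2"
        using U unfolding rho2 by (simp add: right_diff_distrib mult.commute)
    qed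
  qed
  show ?thesis
  proof (intro exI[of _ C] ballI)
    fix \<phi> assume "\<phi> \<in> H1_weighted \<mu>"
    then have phi: "has_weak_gradient \<phi> (weak_gradient \<phi>)" and sq1: "square_integrable (weighted_measure \<mu>) \<phi>"
      and sq2: "square_integrable (weighted_measure \<mu>) (weak_gradient \<phi>)"
      unfolding H1_weighted_def by (auto intro: has_weak_gradient_weak_gradient)
    have [measurable]: "\<phi> \<in> borel_measurable lebesgue" "weak_gradient \<phi> \<in> borel_measurable lebesgue"
      using phi by (auto simp: has_weak_gradient_def intro: locally_integrable_measurable)
    have wphi: "integrable lebesgue (\<lambda>x. (\<rho> x)\<^sup>2 * (\<phi> x)\<^sup>2)"
      using sq1 unfolding square_integrable_def rho2 by (subst (asm) integrable_weighted_measure[OF m nonneg]) auto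
    have wg: "integrable lebesgue (\<lambda>x. (\<rho> x)\<^sup>2 * (norm (weak_gradient \<phi> x))\<^sup>2)"
      using sq2 unfolding square_integrable_def rho2 by (subst (asm) integrable_weighted_measure[OF m nonneg]) auto
    have I1: "(LINT x|weighted_measure \<mu>. (norm (weak_gradient \<phi> x))\<^sup>2) = (LINT x|lebesgue. (\<rho> x)\<^sup>2 * (norm (weak_gradient \<phi> x))\<^sup>2)"
      unfolding rho2 by (rule integral_weighted_measure[OF m nonneg]) measurable
    have I2: "(LINT x|weighted_measure \<mu>. (\<phi> x)\<^sup>2) = (LINT x|lebesgue. (\<rho> x)\<^sup>2 * (\<phi> x)\<^sup>2)"
      unfolding rho2 by (rule integral_weighted_measure[OF m nonneg]) measurable
    define B where "B = (LINT x|lebesgue. (\<rho> x)\<^sup>2 * (norm (weak_gradient \<phi> x))\<^sup>2) + C * (LINT x|lebesgue. (\<rho> x)\<^sup>2 * (\<phi> x)\<^sup>2)"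
    have B0: "B \<ge> 0" unfolding B_def using C0 by (intro add_nonneg_nonneg mult_nonneg_nonneg integral_nonneg_AE) auto
    define I where "I = (\<integral>\<^sup>+ x. ennreal ((\<phi> x)\<^sup>2 / (norm x)\<^sup>2) \<partial>weighted_measure \<mu>)"
    have "I = (\<integral>\<^sup>+ x. ennreal ((\<phi> x)\<^sup>2 * ((\<rho> x)\<^sup>2 / (x \<bullet> x))) \<partial>lebesgue)"
    proof -
      have [measurable]: "(\<lambda>x::'a. norm x) \<in> borel_measurable lebesgue"
        by (intro continuous_borel_measurable_lebesgue continuous_intros)
      have "I = (\<integral>\<^sup>+ x. ennreal (\<mu> x) * ennreal ((\<phi> x)\<^sup>2 / (norm x)\<^sup>2) \<partial>lebesgue)"
        unfolding I_def by (rule nn_integral_weighted_measure[OF m]) measurable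
      then show ?thesis
        using nonneg by (simp add: ennreal_mult[symmetric] rho2 dot_square_norm mult.commute)
    qed
    also have "\<dots> \<le> ennreal (B / c')"
      unfolding B_def by (rule hardy_limit[OF phi wg wphi hi lower c'(1)])
    finally have I: "I \<le> ennreal (B / c')" .
    \<comment> \<open>The bound just proved excludes the infinite value, which reduces the extended
      inequality to one between reals.\<close>
    then obtain i where i: "I = ennreal i" "i \<ge> 0"
      by (cases I) (auto simp: top_unique)
    then have "i \<le> B / c'" using I B0 c' by simp
    then have "c' * i \<le> B" using c' by (simp add: field_simps)
    moreover have "c * i \<le> c' * i" using c i by (intro mult_right_mono)
    ultimately have "c * i \<le> B" by simp
    then show "weighted_Hardy_inequality \<mu> c C \<phi>"
      unfolding weighted_Hardy_inequality_def I_def[symmetric] I1 I2 i(1)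
      using i(2) by (simp add: B_def enn2ereal_ennreal)
  qed
qed

subsection \<open>Necessity of \<open>c < c0 N0\<close>\<close>

text \<open>A bounded regularisation of \<open>|x|\<^sup>\<gamma>\<close>, truncated to the unit ball.\<close>

definition hardy_bump :: "real \<Rightarrow> real \<Rightarrow> 'a::euclidean_space \<Rightarrow> real" where
  "hardy_bump \<gamma> e x = (x \<bullet> x + e) powr (\<gamma> / 2) * radial_cutoff 1 x"

definition hardy_bump_gradient :: "real \<Rightarrow> real \<Rightarrow> 'a::euclidean_space \<Rightarrow> 'a" where
  "hardy_bump_gradient \<gamma> e x =
     (\<gamma> * (x \<bullet> x + e) powr (\<gamma> / 2 - 1) * (max 0 (1 - x \<bullet> x))\<^sup>2
       - 4 * (x \<bullet> x + e) powr (\<gamma> / 2) * max 0 (1 - x \<bullet> x)) *\<^sub>R x"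

lemma hardy_bump_has_gradient:
  assumes e: "e > 0"
  shows "has_cont_gradient (hardy_bump \<gamma> e) (hardy_bump_gradient \<gamma> e :: 'a::euclidean_space \<Rightarrow> 'a)"
proof -
  have pos: "x \<bullet> x + e > 0" for x :: 'a using e by (simp add: add_nonneg_pos)
  have "has_cont_gradient (\<lambda>x::'a. x \<bullet> x + e) (\<lambda>x. 2 *\<^sub>R x + 0)"
    by (intro has_cont_gradient_add has_cont_gradient_inner_self has_cont_gradient_const)
  then have g: "has_cont_gradient (\<lambda>x::'a. x \<bullet> x + e) (\<lambda>x. 2 *\<^sub>R x)" by simp
  have "has_cont_gradient (\<lambda>x::'a. (x \<bullet> x + e) powr (\<gamma> / 2)) (\<lambda>x. ((\<gamma> / 2) * (x \<bullet> x + e) powr (\<gamma> / 2 - 1)) *\<^sub>R (2 *\<^sub>R x))"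
  proof (rule has_cont_gradient_compose[OF g, where F="\<lambda>s. s powr (\<gamma> / 2)" and F'="\<lambda>s. (\<gamma> / 2) * s powr (\<gamma> / 2 - 1)"])
    show "((\<lambda>s. s powr (\<gamma> / 2)) has_real_derivative \<gamma> / 2 * (x \<bullet> x + e) powr (\<gamma> / 2 - 1)) (at (x \<bullet> x + e))" for x :: 'a
      by (rule has_real_derivative_powr[OF pos])
    show "continuous_on (range (\<lambda>x::'a. x \<bullet> x + e)) (\<lambda>s. \<gamma> / 2 * s powr (\<gamma> / 2 - 1))"
      using less_imp_neq[OF pos] by (intro continuous_intros) fastforce+
  qed
  note G = has_cont_gradient_mult[OF this radial_cutoff_has_gradient[OF zero_less_one]]
  show ?thesis
    unfolding hardy_bump_def[abs_def] hardy_bump_gradient_def[abs_def]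
    using G by (simp add: radial_cutoff_def radial_cutoff_gradient_def algebra_simps)
qed

text \<open>The squared gradient splits into \<open>\<gamma>^2\<close> times the very density that
  bounds the Hardy quotient from below and a remainder less singular by one power of
  \<open>|x|^2 + e\<close>. Comparing the two sides thus leaves \<open>c - \<gamma>^2\<close> in
  front of the singular density.\<close>

lemma hardy_bump_estimates:
  fixes x :: "'a::euclidean_space"
  assumes e: "e > 0" and \<gamma>: "\<gamma> \<le> 0"
  defines "y \<equiv> max 0 (1 - x \<bullet> x)"
  shows "(norm (hardy_bump_gradient \<gamma> e x))\<^sup>2 \<le> \<gamma>\<^sup>2 * ((x \<bullet> x + e) powr (\<gamma> - 1) * y ^ 4)
      + (8 * \<bar>\<gamma>\<bar> + 16) * (indicator (ball 0 1) x * (x \<bullet> x + e) powr \<gamma>)"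
    and "(hardy_bump \<gamma> e x)\<^sup>2 \<le> indicator (ball 0 1) x * (x \<bullet> x + e) powr \<gamma>"
    and "x \<noteq> 0 \<Longrightarrow> (x \<bullet> x + e) powr (\<gamma> - 1) * y ^ 4 \<le> (hardy_bump \<gamma> e x)\<^sup>2 / (norm x)\<^sup>2"
proof -
  define s where "s = x \<bullet> x"
  define d where "d = x \<bullet> x + e"
  have d: "d > 0" using e by (simp add: d_def add_nonneg_pos)
  have s: "0 \<le> s" "s \<le> d" using e by (simp_all add: s_def d_def)
  \<comment> \<open>Every power of \<open>d\<close> that occurs is an integral power of
    \<open>d\<close> times \<open>P\<close> or its square, which makes the comparison
    polynomial.\<close>
  define P where "P = d powr (\<gamma> / 2 - 1)"
  have F: "d powr (\<gamma> / 2) = P * d"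
    using powr_mult_base[of d "\<gamma> / 2 - 1"] d by (simp add: P_def mult.commute)
  have PP: "P * P = d powr (\<gamma> - 2)" by (simp add: P_def powr_add[symmetric])
  have Q: "d powr (\<gamma> - 1) = P\<^sup>2 * d"
    using powr_mult_base[of d "\<gamma> - 2"] d by (simp add: power2_eq_square PP mult.commute)
  have FF: "d powr \<gamma> = P\<^sup>2 * d\<^sup>2"
  proof -
    have "d powr \<gamma> = d powr (\<gamma> / 2) * d powr (\<gamma> / 2)" by (simp add: powr_add[symmetric])
    then show ?thesis unfolding F by (simp add: power2_eq_square mult_ac)
  qed
  have y: "0 \<le> y" "y \<le> 1" by (auto simp: y_def)
  have ind: "indicat_real (ball 0 1) x = (if s < 1 then 1 else 0)"
    by (simp add: s_def indicator_def dot_square_norm abs_square_less_1)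
  have y0: "y = 0" if "\<not> s < 1" using that by (simp add: y_def s_def)
  have hb: "(hardy_bump \<gamma> e x)\<^sup>2 = P\<^sup>2 * d\<^sup>2 * y ^ 4"
    unfolding hardy_bump_def radial_cutoff_def d_def[symmetric] F
    by (simp add: y_def power_mult_distrib)
  have hg: "(norm (hardy_bump_gradient \<gamma> e x))\<^sup>2 = P\<^sup>2 * (s * y\<^sup>2 * (\<gamma> * y - 4 * d)\<^sup>2)"
  proof -
    have "hardy_bump_gradient \<gamma> e x = (P * (y * (\<gamma> * y - 4 * d))) *\<^sub>R x"
      unfolding hardy_bump_gradient_def d_def[symmetric] F P_def[symmetric] y_def[symmetric]
      by (simp add: power2_eq_square algebra_simps)
    then show ?thesis by (simp add: power_mult_distrib s_def dot_square_norm mult_ac)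
  qed
  show "(norm (hardy_bump_gradient \<gamma> e x))\<^sup>2 \<le> \<gamma>\<^sup>2 * ((x \<bullet> x + e) powr (\<gamma> - 1) * y ^ 4)
      + (8 * \<bar>\<gamma>\<bar> + 16) * (indicator (ball 0 1) x * (x \<bullet> x + e) powr \<gamma>)"
  proof (cases "s < 1")
    case True
    \<comment> \<open>As \<open>\<gamma> \<le> 0\<close>, the cross term has coefficient
      \<open>- 8 \<gamma> = 8 |\<gamma>|\<close>. In the next step \<open>s\<close> is replaced by
      \<open>d\<close> in the first two terms and by 1 in the last.\<close>
    have "s * y\<^sup>2 * (\<gamma> * y - 4 * d)\<^sup>2 = s * (\<gamma>\<^sup>2 * y ^ 4) + 8 * \<bar>\<gamma>\<bar> * (s * (y ^ 3 * d)) + 16 * (s * y\<^sup>2 * d\<^sup>2)"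
      using \<gamma> by (simp add: power2_diff power_mult_distrib algebra_simps power2_eq_square power3_eq_cube power4_eq_xxxx)
    also have "\<dots> \<le> d * (\<gamma>\<^sup>2 * y ^ 4) + 8 * \<bar>\<gamma>\<bar> * (d * (1 * d)) + 16 * (1 * 1 * d\<^sup>2)"
      using s y d True by (intro add_mono mult_left_mono mult_mono mult_right_mono power_le_one) auto
    finally have "P\<^sup>2 * (s * y\<^sup>2 * (\<gamma> * y - 4 * d)\<^sup>2) \<le> P\<^sup>2 * (d * (\<gamma>\<^sup>2 * y ^ 4) + 8 * \<bar>\<gamma>\<bar> * (d * (1 * d)) + 16 * (1 * 1 * d\<^sup>2))"
      by (rule mult_left_mono) simp
    then show ?thesis
      unfolding hg d_def[symmetric] Q FF ind using True by (simp add: algebra_simps power2_eq_square)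
  next
    case False
    then show ?thesis unfolding hg using y0 by (simp add: ind)
  qed
  show "(hardy_bump \<gamma> e x)\<^sup>2 \<le> indicator (ball 0 1) x * (x \<bullet> x + e) powr \<gamma>"
  proof (cases "s < 1")
    case True
    have "P\<^sup>2 * d\<^sup>2 * y ^ 4 \<le> P\<^sup>2 * d\<^sup>2 * 1" using y by (intro mult_left_mono power_le_one) auto
    then show ?thesis unfolding hb d_def[symmetric] FF ind using True by simp
  next
    case False
    then show ?thesis unfolding hb using y0 by (simp add: ind)
  qed
  assume "x \<noteq> 0"
  then have sp: "s > 0" by (simp add: s_def)
  have "P\<^sup>2 * d * y ^ 4 * s \<le> P\<^sup>2 * d * y ^ 4 * d"
    using s d y by (intro mult_left_mono mult_nonneg_nonneg) auto
  then show "(x \<bullet> x + e) powr (\<gamma> - 1) * y ^ 4 \<le> (hardy_bump \<gamma> e x)\<^sup>2 / (norm x)\<^sup>2"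
    unfolding hb d_def[symmetric] Q unfolding dot_square_norm[symmetric] s_def[symmetric]
    using sp by (simp add: le_divide_eq power2_eq_square mult_ac)
qed

lemma hardy_bump_eq_0: "x \<notin> cball 0 1 \<Longrightarrow> hardy_bump \<gamma> e x = 0"
  using radial_cutoff_eq_0(1)[of 1 x] by (simp add: hardy_bump_def)

text \<open>\<open>g\<close> is any representative of \<open>f\<close>, because
  \<open>weak_gradient\<close> returns a chosen one that equals the classical gradient only almost
  everywhere.\<close>

lemma square_integrable_continuous_compact_support:
  fixes f :: "'a::euclidean_space \<Rightarrow> 'b::euclidean_space"
  assumes mu: "locally_integrable lebesgue \<mu>" "\<And>x. \<mu> x \<ge> 0"
    and f: "continuous_on UNIV f" "compact K" "\<And>x. x \<notin> K \<Longrightarrow> f x = 0"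
    and g: "g \<in> borel_measurable lebesgue" "AE x in lebesgue. g x = f x"
  shows "square_integrable (weighted_measure \<mu>) g"
    and "(LINT x|weighted_measure \<mu>. (norm (g x))\<^sup>2) = (LINT x|lebesgue. \<mu> x * (norm (f x))\<^sup>2)"
    and "integrable lebesgue (\<lambda>x. \<mu> x * (norm (f x))\<^sup>2)"
proof -
  note m [measurable] = locally_integrable_measurable[OF mu(1)]
  note [measurable] = g(1) continuous_borel_measurable_lebesgue[OF f(1)]
  obtain B where B: "B \<ge> 0" "\<And>x. norm (f x) \<le> B"
    using continuous_compact_support_bounded[OF f] by metis
  have "integrable lebesgue (\<lambda>x. (norm (f x))\<^sup>2 *\<^sub>R \<mu> x)"
  proof (rule locally_integrable_mult_bounded[OF mu(1) _ f(2)])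
    show "\<bar>(norm (f x))\<^sup>2\<bar> \<le> B\<^sup>2" for x using B by (simp add: power_mono)
  qed (auto simp: f(3))
  then show i: "integrable lebesgue (\<lambda>x. \<mu> x * (norm (f x))\<^sup>2)" by (simp add: mult.commute)
  have "integrable lebesgue (\<lambda>x. \<mu> x * (norm (g x))\<^sup>2)"
    using i by (rule integrable_cong_AE_imp) (use g(2) in \<open>auto elim: eventually_mono\<close>)
  then show "square_integrable (weighted_measure \<mu>) g"
    unfolding square_integrable_def weighted_measure_measurable
    by (subst integrable_weighted_measure[OF m mu(2)]) auto
  have "(LINT x|weighted_measure \<mu>. (norm (g x))\<^sup>2) = (LINT x|lebesgue. \<mu> x * (norm (g x))\<^sup>2)"
    by (rule integral_weighted_measure[OF m mu(2)]) measurable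
  also have "\<dots> = (LINT x|lebesgue. \<mu> x * (norm (f x))\<^sup>2)"
    by (rule integral_cong_AE) (use g(2) in \<open>auto elim: eventually_mono\<close>)
  finally show "(LINT x|weighted_measure \<mu>. (norm (g x))\<^sup>2) = (LINT x|lebesgue. \<mu> x * (norm (f x))\<^sup>2)" .
qed

text \<open>With \<open>\<gamma> = (t + 2 - N0) / 2\<close> the integrand \<open>(x \<bullet> x) powr (\<gamma> - 1)\<close> is \<open>|x| powr (t - N0)\<close>.\<close>

lemma weighted_Hardy_regularised_bound:
  fixes \<mu> :: "'a::euclidean_space \<Rightarrow> real"
  assumes mu: "locally_integrable lebesgue \<mu>" "\<And>x. \<mu> x \<ge> 0"
    and ineq: "\<And>\<phi>. \<phi> \<in> H1_weighted \<mu> \<Longrightarrow> weighted_Hardy_inequality \<mu> c C \<phi>"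
    and c: "c > 0" and e: "e > 0" and \<gamma>: "\<gamma> \<le> 0"
    and J: "integrable lebesgue (\<lambda>x. \<mu> x * (indicator (ball 0 1) x * (x \<bullet> x) powr \<gamma>))"
  defines "Q \<equiv> \<lambda>x. (x \<bullet> x + e) powr (\<gamma> - 1) * (max 0 (1 - x \<bullet> x)) ^ 4"
  shows "integrable lebesgue (\<lambda>x. \<mu> x * Q x)"
    and "(c - \<gamma>\<^sup>2) * (LINT x|lebesgue. \<mu> x * Q x) \<le>
      (8 * \<bar>\<gamma>\<bar> + 16 + \<bar>C\<bar>) * (LINT x|lebesgue. \<mu> x * (indicator (ball 0 1) x * (x \<bullet> x) powr \<gamma>))"
proof -
  note m [measurable] = locally_integrable_measurable[OF mu(1)]
  let ?b = "hardy_bump \<gamma> e :: 'a \<Rightarrow> real" and ?g = "hardy_bump_gradient \<gamma> e :: 'a \<Rightarrow> 'a"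
  note G = hardy_bump_has_gradient[OF e, of \<gamma>, where 'a='a]
  have wg: "has_weak_gradient ?b ?g" by (rule has_weak_gradientI_cont[OF G])
  have wgm: "weak_gradient ?b \<in> borel_measurable lebesgue"
    using has_weak_gradient_weak_gradient[OF wg] by (auto simp: has_weak_gradient_def intro: locally_integrable_measurable)
  have g0: "?g x = 0" if "x \<notin> cball 0 1" for x
    using has_cont_gradient_zero_outside[OF G closed_cball hardy_bump_eq_0 that] by auto
  note S1 = square_integrable_continuous_compact_support[OF mu has_cont_gradient_cont[OF G] compact_cball[of 0 1] hardy_bump_eq_0
      continuous_borel_measurable_lebesgue[OF has_cont_gradient_cont[OF G]]]
  note S2 = square_integrable_continuous_compact_support[OF mu has_cont_gradient_cont_grad[OF G] compact_cball[of 0 1] g0 wgm weak_gradient_eq_AE[OF wg]]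
  have "?b \<in> H1_weighted \<mu>"
    unfolding H1_weighted_def using wg S1(1) S2(1) by auto
  from ineq[OF this]
  have W: "ereal c * enn2ereal (\<integral>\<^sup>+ x. ennreal ((?b x)\<^sup>2 / (norm x)\<^sup>2) \<partial>weighted_measure \<mu>)
     \<le> ereal ((LINT x|lebesgue. \<mu> x * (norm (?g x))\<^sup>2) + C * (LINT x|lebesgue. \<mu> x * (norm (?b x))\<^sup>2))"
    using S1(2) S2(2) by (simp add: weighted_Hardy_inequality_def)
  have pos: "x \<bullet> x + e > 0" for x :: 'a using e by (simp add: add_nonneg_pos)
  have cQ: "continuous_on UNIV Q"
    unfolding Q_def using less_imp_neq[OF pos] by (intro continuous_intros) fastforce+
  note mQ [measurable] = continuous_borel_measurable_lebesgue[OF cQ]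
  have Q0: "Q x \<ge> 0" for x by (simp add: Q_def)
  have Qz: "Q x = 0" if "x \<notin> cball 0 1" for x
  proof -
    have "1\<^sup>2 < (norm x)\<^sup>2" using that by (intro power_strict_mono) auto
    then show ?thesis by (simp add: Q_def dot_square_norm)
  qed
  obtain B where B: "\<And>x. norm (Q x) \<le> B"
    using continuous_compact_support_bounded[OF cQ compact_cball[of 0 1] Qz] by metis
  have "integrable lebesgue (\<lambda>x. Q x *\<^sub>R \<mu> x)"
    by (rule locally_integrable_mult_bounded[OF mu(1) mQ compact_cball[of 0 1] Qz, of B]) (use B in auto)
  then show iQ: "integrable lebesgue (\<lambda>x. \<mu> x * Q x)" by (simp add: mult.commute)
  define X where "X = (LINT x|lebesgue. \<mu> x * Q x)"
  have X0: "X \<ge> 0" unfolding X_def by (intro integral_nonneg_AE AE_I2 mult_nonneg_nonneg mu(2) Q0)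
  have [measurable]: "(\<lambda>x::'a. norm x) \<in> borel_measurable lebesgue"
    by (intro continuous_borel_measurable_lebesgue continuous_intros)
  have [measurable]: "?b \<in> borel_measurable lebesgue"
    by (intro continuous_borel_measurable_lebesgue has_cont_gradient_cont[OF G])
  \<comment> \<open>The Hardy term of the trial function dominates the singular integral
    \<open>X\<close>. Since \<open>e > 0\<close> makes \<open>X\<close> finite, the multiple of
    \<open>X\<close> bounding the gradient term can later be moved to the left.\<close>
  have "ennreal X = (\<integral>\<^sup>+ x. ennreal (\<mu> x * Q x) \<partial>lebesgue)"
    unfolding X_def using nn_integral_eq_integral[OF iQ] mu(2) Q0 by simp
  also have "\<dots> \<le> (\<integral>\<^sup>+ x. ennreal (\<mu> x) * ennreal ((?b x)\<^sup>2 / (norm x)\<^sup>2) \<partial>lebesgue)"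
  proof (rule nn_integral_mono_AE, use AE_lebesgue_neq_0[where 'a='a] in eventually_elim)
    fix x :: 'a assume "x \<noteq> 0"
    from mult_left_mono[OF hardy_bump_estimates(3)[OF e \<gamma> this] mu(2)[of x]]
    show "ennreal (\<mu> x * Q x) \<le> ennreal (\<mu> x) * ennreal ((?b x)\<^sup>2 / (norm x)\<^sup>2)"
      using mu(2)[of x] by (simp add: ennreal_mult[symmetric] Q_def)
  qed
  also have "\<dots> = (\<integral>\<^sup>+ x. ennreal ((?b x)\<^sup>2 / (norm x)\<^sup>2) \<partial>weighted_measure \<mu>)"
    by (rule nn_integral_weighted_measure[OF m, symmetric]) measurable
  finally have "ereal X \<le> enn2ereal (\<integral>\<^sup>+ x. ennreal ((?b x)\<^sup>2 / (norm x)\<^sup>2) \<partial>weighted_measure \<mu>)"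
    using X0 by (metis enn2ereal_ennreal less_eq_ennreal.rep_eq)
  then have "ereal c * ereal X \<le> ereal c * enn2ereal (\<integral>\<^sup>+ x. ennreal ((?b x)\<^sup>2 / (norm x)\<^sup>2) \<partial>weighted_measure \<mu>)"
    using c by (intro ereal_mult_left_mono) auto
  from order_trans[OF this W]
  have cX: "c * X \<le> (LINT x|lebesgue. \<mu> x * (norm (?g x))\<^sup>2) + C * (LINT x|lebesgue. \<mu> x * (norm (?b x))\<^sup>2)"
    by simp
  define Y where "Y = (LINT x|lebesgue. \<mu> x * (indicator (ball 0 1) x * (x \<bullet> x) powr \<gamma>))"
  have pw: "(x \<bullet> x + e) powr \<gamma> \<le> (x \<bullet> x) powr \<gamma>" if "x \<noteq> 0" for x :: 'a
    using that \<gamma> e by (intro powr_mono2') auto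
  have iJ: "integrable lebesgue (\<lambda>x. \<mu> x * (norm (?b x))\<^sup>2)"
    using S1(3) by simp
  have b_le: "(LINT x|lebesgue. \<mu> x * (norm (?b x))\<^sup>2) \<le> Y"
    unfolding Y_def
  proof (rule integral_mono_AE[OF iJ J], use AE_lebesgue_neq_0[where 'a='a] in eventually_elim)
    fix x :: 'a assume x: "x \<noteq> 0"
    have "(norm (?b x))\<^sup>2 \<le> indicator (ball 0 1) x * (x \<bullet> x + e) powr \<gamma>"
      using hardy_bump_estimates(2)[OF e \<gamma>, of x] by simp
    also have "\<dots> \<le> indicator (ball 0 1) x * (x \<bullet> x) powr \<gamma>"
      by (intro mult_left_mono pw x) auto
    finally show "\<mu> x * (norm (?b x))\<^sup>2 \<le> \<mu> x * (indicator (ball 0 1) x * (x \<bullet> x) powr \<gamma>)"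
      by (rule mult_left_mono) (rule mu(2))
  qed
  have b0: "0 \<le> (LINT x|lebesgue. \<mu> x * (norm (?b x))\<^sup>2)"
    by (intro integral_nonneg_AE AE_I2 mult_nonneg_nonneg mu(2)) simp
  have g_le: "(LINT x|lebesgue. \<mu> x * (norm (?g x))\<^sup>2) \<le> \<gamma>\<^sup>2 * X + (8 * \<bar>\<gamma>\<bar> + 16) * Y"
  proof -
    have "(LINT x|lebesgue. \<mu> x * (norm (?g x))\<^sup>2) \<le> (LINT x|lebesgue. \<gamma>\<^sup>2 * (\<mu> x * Q x) + (8 * \<bar>\<gamma>\<bar> + 16) * (\<mu> x * (indicator (ball 0 1) x * (x \<bullet> x) powr \<gamma>)))"
    proof (rule integral_mono_AE[OF S2(3)])
      show "integrable lebesgue (\<lambda>x. \<gamma>\<^sup>2 * (\<mu> x * Q x) + (8 * \<bar>\<gamma>\<bar> + 16) * (\<mu> x * (indicator (ball 0 1) x * (x \<bullet> x) powr \<gamma>)))"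
        by (intro Bochner_Integration.integrable_add integrable_mult_right iQ J)
      show "AE x in lebesgue. \<mu> x * (norm (?g x))\<^sup>2 \<le> \<gamma>\<^sup>2 * (\<mu> x * Q x) + (8 * \<bar>\<gamma>\<bar> + 16) * (\<mu> x * (indicator (ball 0 1) x * (x \<bullet> x) powr \<gamma>))"
        using AE_lebesgue_neq_0[where 'a='a]
      proof eventually_elim
        fix x :: 'a assume x: "x \<noteq> 0"
        have "(norm (?g x))\<^sup>2 \<le> \<gamma>\<^sup>2 * Q x + (8 * \<bar>\<gamma>\<bar> + 16) * (indicator (ball 0 1) x * (x \<bullet> x + e) powr \<gamma>)"
          unfolding Q_def by (rule hardy_bump_estimates(1)[OF e \<gamma>])
        also have "\<dots> \<le> \<gamma>\<^sup>2 * Q x + (8 * \<bar>\<gamma>\<bar> + 16) * (indicator (ball 0 1) x * (x \<bullet> x) powr \<gamma>)"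
          by (intro add_left_mono mult_left_mono pw x) auto
        finally have "\<mu> x * (norm (?g x))\<^sup>2 \<le> \<mu> x * (\<gamma>\<^sup>2 * Q x + (8 * \<bar>\<gamma>\<bar> + 16) * (indicator (ball 0 1) x * (x \<bullet> x) powr \<gamma>))"
          by (rule mult_left_mono) (rule mu(2))
        then show "\<mu> x * (norm (?g x))\<^sup>2 \<le> \<gamma>\<^sup>2 * (\<mu> x * Q x) + (8 * \<bar>\<gamma>\<bar> + 16) * (\<mu> x * (indicator (ball 0 1) x * (x \<bullet> x) powr \<gamma>))"
          by (simp add: algebra_simps)
      qed
    qed
    also have "\<dots> = \<gamma>\<^sup>2 * X + (8 * \<bar>\<gamma>\<bar> + 16) * Y"
      unfolding X_def Y_def by (simp only: Bochner_Integration.integral_add integrable_mult_right iQ J integral_mult_right_zero)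
    finally show ?thesis .
  qed
  \<comment> \<open>\<open>C\<close> may be negative, hence the modulus.\<close>
  have "C * (LINT x|lebesgue. \<mu> x * (norm (?b x))\<^sup>2) \<le> \<bar>C\<bar> * Y"
    using b_le b0 by (intro mult_mono) auto
  then show "(c - \<gamma>\<^sup>2) * (LINT x|lebesgue. \<mu> x * Q x) \<le> (8 * \<bar>\<gamma>\<bar> + 16 + \<bar>C\<bar>) * (LINT x|lebesgue. \<mu> x * (indicator (ball 0 1) x * (x \<bullet> x) powr \<gamma>))"
    using cX g_le unfolding X_def[symmetric] Y_def[symmetric] by (simp add: algebra_simps)
qed

lemma norm_powr_eq: "norm x powr (2 * p) = (x \<bullet> x) powr p" for x :: "'a::euclidean_space"
  by (cases "x = 0") (simp_all add: powr_powr[symmetric] powr_numeral dot_square_norm)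

text \<open>With \<open>G = (N0 - 2) / 2\<close> one has \<open>c0 N0 = G^2\<close> and
  \<open>\<gamma> = t / 2 - G\<close>. The factor \<open>c - \<gamma>^2\<close> is at least
  \<open>t G / 2\<close>, while the remainders are controlled by the moment \<open>J\<close> of
  order \<open>2 - N0\<close>, finite and independent of \<open>t\<close>; so \<open>t\<close> times
  the singular moment stays bounded.\<close>

lemma weighted_Hardy_moment_bound:
  fixes \<mu> :: "'a::euclidean_space \<Rightarrow> real"
  assumes mu: "locally_integrable lebesgue \<mu>" "\<And>x. \<mu> x \<ge> 0"
    and ineq: "\<And>\<phi>. \<phi> \<in> H1_weighted \<mu> \<Longrightarrow> weighted_Hardy_inequality \<mu> c C \<phi>"
    and N0: "N0_set \<mu> \<noteq> {}" "N0 \<mu> > 2" and c: "c0 (N0 \<mu>) \<le> c"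
  obtains D where "\<And>t. 0 < t \<Longrightarrow> t < N0 \<mu> - 2 \<Longrightarrow>
    ennreal t * (\<integral>\<^sup>+ x\<in>ball 0 1. ennreal (norm x powr (t - N0 \<mu>)) \<partial>weighted_measure \<mu>) \<le> ennreal D"
proof -
  note m [measurable] = locally_integrable_measurable[OF mu(1)]
  define G where "G = (N0 \<mu> - 2) / 2"
  have G: "G > 0" using N0 by (simp add: G_def)
  have c: "G\<^sup>2 \<le> c" using c by (simp add: c0_def G_def)
  have c_pos: "c > 0" using c G by (meson less_le_trans zero_less_power)
  \<comment> \<open>\<open>N0 - 2\<close> lies strictly below the supremum of the admissible
    exponents; this makes \<open>J\<close> finite.\<close>
  obtain \<delta> where d: "\<delta> \<in> N0_set \<mu>" "N0 \<mu> - 2 < \<delta>"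
    using N0 less_cSupE[of "N0 \<mu> - 2" "N0_set \<mu>"] unfolding N0_def by auto
  have bm [measurable]: "indicat_real (ball 0 (1::real)) \<in> borel_measurable (lebesgue :: 'a measure)"
    by (rule borel_measurable_indicator) auto
  have mxx [measurable]: "(\<lambda>x::'a. x \<bullet> x) \<in> borel_measurable lebesgue"
    by (intro continuous_borel_measurable_lebesgue continuous_intros)
  have iJ: "integrable lebesgue (\<lambda>x. \<mu> x * (indicator (ball 0 1) x * (x \<bullet> x) powr (- G)))"
  proof -
    have l: "locally_integrable lebesgue (\<lambda>x. \<mu> x * norm x powr (- (2 * G)))"
      by (rule locally_integrable_N0_set[OF mu d(1)]) (use d(2) G in \<open>auto simp: G_def\<close>)
    have "integrable lebesgue (\<lambda>x. indicat_real (ball 0 1) x *\<^sub>R (\<mu> x * norm x powr (- (2 * G))))"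
      by (rule locally_integrable_mult_bounded[OF l bm compact_cball[of 0 1], of 1]) (auto simp: indicator_def)
    moreover have "norm x powr (- (2 * G)) = (x \<bullet> x) powr (- G)" for x :: 'a
      using norm_powr_eq[of x "- G"] by simp
    ultimately show ?thesis by (simp only: real_scaleR_def mult.left_commute)
  qed
  define J where "J = (LINT x|lebesgue. \<mu> x * (indicator (ball 0 1) x * (x \<bullet> x) powr (- G)))"
  have J0: "J \<ge> 0" unfolding J_def by (intro integral_nonneg_AE AE_I2 mult_nonneg_nonneg mu(2)) auto
  define B where "B = 8 * G + 16 + \<bar>C\<bar>"
  have B0: "B \<ge> 0" using G by (simp add: B_def)
  show ?thesis
  \<comment> \<open>The first summand is \<open>t * Z\<close>, the second bounds
    \<open>t * (4 * J)\<close> through \<open>t < 2 * G\<close>.\<close>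
  proof (rule that[of "2 * B * J / G + 8 * G * J"])
    fix t :: real assume t: "0 < t" "t < N0 \<mu> - 2"
    define \<gamma> where "\<gamma> = t / 2 - G"
    have \<gamma>: "\<gamma> \<le> 0" "\<bar>\<gamma>\<bar> \<le> G" "- G \<le> \<gamma>" using t by (auto simp: \<gamma>_def G_def field_simps)
    \<comment> \<open>From \<open>t < 2 G\<close>:
      \<open>G^2 - \<gamma>^2 = t G - t^2 / 4 \<ge> t G / 2\<close>.\<close>
    have c\<gamma>: "t * (G / 2) \<le> c - \<gamma>\<^sup>2"
    proof -
      have "t * (t / 4) \<le> t * (G / 2)" using t by (intro mult_left_mono) (auto simp: G_def)
      moreover have "\<gamma>\<^sup>2 = G\<^sup>2 - t * G + t * (t / 4)"
        by (simp add: \<gamma>_def power2_eq_square algebra_simps)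
      moreover have "t * G = 2 * (t * (G / 2))" by simp
      ultimately show ?thesis using c by linarith
    qed
    have pw: "(x \<bullet> x) powr \<gamma> \<le> (x \<bullet> x) powr (- G)" if "x \<in> ball 0 1" for x :: 'a
    proof (rule powr_mono'[OF \<gamma>(3)])
      have "(norm x)\<^sup>2 \<le> 1" using that by (intro power_le_one) auto
      then show "x \<bullet> x \<le> 1" by (simp add: dot_square_norm)
    qed simp
    have iY: "integrable lebesgue (\<lambda>x. \<mu> x * (indicator (ball 0 1) x * (x \<bullet> x) powr \<gamma>))"
    proof (rule Bochner_Integration.integrable_bound[OF iJ])
      show "AE x in lebesgue. norm (\<mu> x * (indicator (ball 0 1) x * (x \<bullet> x) powr \<gamma>)) \<le> norm (\<mu> x * (indicator (ball 0 1) x * (x \<bullet> x) powr (- G)))"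
        using pw mu(2) by (intro AE_I2) (auto simp: abs_mult indicator_def intro!: mult_left_mono)
    qed measurable
    define Y where "Y = (LINT x|lebesgue. \<mu> x * (indicator (ball 0 1) x * (x \<bullet> x) powr \<gamma>))"
    have Y0: "Y \<ge> 0" unfolding Y_def by (intro integral_nonneg_AE AE_I2 mult_nonneg_nonneg mu(2)) auto
    have YJ: "Y \<le> J" unfolding Y_def J_def
      by (rule Bochner_Integration.integral_mono[OF iY iJ]) (use pw mu(2) in \<open>auto simp: indicator_def intro!: mult_left_mono\<close>)
    \<comment> \<open>The regularisation is removed by Fatou's lemma, since the bound
      \<open>QZ\<close> does not depend on \<open>e n\<close>.\<close>
    define e where "e = (\<lambda>n. inverse (real (Suc n)))"
    have e: "e n > 0" for n by (simp add: e_def)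
    define Q where "Q = (\<lambda>n (x::'a). (x \<bullet> x + e n) powr (\<gamma> - 1) * (max 0 (1 - x \<bullet> x)) ^ 4)"
    have [measurable]: "Q n \<in> borel_measurable lebesgue" for n unfolding Q_def by measurable
    have Q0: "Q n x \<ge> 0" for n x by (simp add: Q_def)
    define Z where "Z = 2 * B * J / (t * G)"
    have QZ: "(LINT x|lebesgue. \<mu> x * Q n x) \<le> Z" for n
    proof -
      have n0: "0 \<le> (LINT x|lebesgue. \<mu> x * Q n x)"
        by (intro integral_nonneg_AE AE_I2 mult_nonneg_nonneg mu(2) Q0)
      have "t * (G / 2) * (LINT x|lebesgue. \<mu> x * Q n x) \<le> (c - \<gamma>\<^sup>2) * (LINT x|lebesgue. \<mu> x * Q n x)"
        using c\<gamma> n0 by (rule mult_right_mono)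
      also have "\<dots> \<le> (8 * \<bar>\<gamma>\<bar> + 16 + \<bar>C\<bar>) * Y"
        unfolding Y_def Q_def using weighted_Hardy_regularised_bound(2)[OF mu ineq c_pos e[of n] \<gamma>(1) iY] by simp
      also have "\<dots> \<le> B * J" using \<gamma>(2) YJ Y0 B0 by (intro mult_mono) (auto simp: B_def)
      finally show ?thesis using t G by (simp add: Z_def field_simps)
    qed
    define q where "q = (\<lambda>x::'a. (x \<bullet> x) powr (\<gamma> - 1) * (max 0 (1 - x \<bullet> x)) ^ 4)"
    have [measurable]: "q \<in> borel_measurable lebesgue" unfolding q_def by measurable
    have "(\<integral>\<^sup>+ x. ennreal (\<mu> x * q x) \<partial>lebesgue) = (\<integral>\<^sup>+ x. liminf (\<lambda>n. ennreal (\<mu> x * Q n x)) \<partial>lebesgue)"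
    proof (rule nn_integral_cong_AE, use AE_lebesgue_neq_0[where 'a='a] in eventually_elim)
      fix x :: 'a assume x: "x \<noteq> 0"
      have "(\<lambda>n. ennreal (\<mu> x * Q n x)) \<longlonglongrightarrow> ennreal (\<mu> x * ((x \<bullet> x + 0) powr (\<gamma> - 1) * (max 0 (1 - x \<bullet> x)) ^ 4))"
        unfolding Q_def e_def using x
        by (intro tendsto_ennrealI tendsto_mult tendsto_const tendsto_powr tendsto_add LIMSEQ_inverse_real_of_nat) auto
      from lim_imp_Liminf[OF _ this] show "ennreal (\<mu> x * q x) = liminf (\<lambda>n. ennreal (\<mu> x * Q n x))"
        by (simp add: q_def)
    qed
    also have "\<dots> \<le> liminf (\<lambda>n. \<integral>\<^sup>+ x. ennreal (\<mu> x * Q n x) \<partial>lebesgue)"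
      by (rule nn_integral_liminf) measurable
    also have "\<dots> \<le> liminf (\<lambda>n. ennreal Z)"
    proof (rule Liminf_mono, rule always_eventually, rule allI)
      fix n
      have "integrable lebesgue (\<lambda>x. \<mu> x * Q n x)"
        unfolding Q_def by (rule weighted_Hardy_regularised_bound(1)[OF mu ineq c_pos e[of n] \<gamma>(1) iY])
      then show "(\<integral>\<^sup>+ x. ennreal (\<mu> x * Q n x) \<partial>lebesgue) \<le> ennreal Z"
        using QZ[of n] by (subst nn_integral_eq_integral) (auto simp: mu(2) Q0 intro: ennreal_leI)
    qed
    also have "\<dots> = ennreal Z" by (simp add: Liminf_const)
    finally have qZ: "(\<integral>\<^sup>+ x. ennreal (\<mu> x * q x) \<partial>lebesgue) \<le> ennreal Z" .
    have Z0: "Z \<ge> 0" using B0 J0 t G by (simp add: Z_def)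
    have "(\<integral>\<^sup>+ x\<in>ball 0 1. ennreal (norm x powr (t - N0 \<mu>)) \<partial>weighted_measure \<mu>)
      = (\<integral>\<^sup>+ x. ennreal (\<mu> x) * (ennreal (norm x powr (t - N0 \<mu>)) * indicator (ball 0 1) x) \<partial>lebesgue)"
    proof (rule nn_integral_weighted_measure[OF m], rule borel_measurable_times_ennreal)
      show "(\<lambda>x::'a. ennreal (norm x powr (t - N0 \<mu>))) \<in> borel_measurable lebesgue"
        by (rule measurable_compose[OF norm_powr_measurable measurable_ennreal])
    qed (rule borel_measurable_indicator, auto)
    also have "\<dots> \<le> (\<integral>\<^sup>+ x. ennreal (\<mu> x * q x) + ennreal (4 * (\<mu> x * (indicator (ball 0 1) x * (x \<bullet> x) powr \<gamma>))) \<partial>lebesgue)"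
    proof (rule nn_integral_mono)
      fix x :: 'a
      show "ennreal (\<mu> x) * (ennreal (norm x powr (t - N0 \<mu>)) * indicator (ball 0 1) x)
        \<le> ennreal (\<mu> x * q x) + ennreal (4 * (\<mu> x * (indicator (ball 0 1) x * (x \<bullet> x) powr \<gamma>)))"
      proof (cases "x \<in> ball 0 1")
        case True
        have "(norm x)\<^sup>2 < 1" using True by (simp add: abs_square_less_1)
        then have s1: "x \<bullet> x < 1" by (simp add: dot_square_norm)
        define s where "s = x \<bullet> x"
        have s: "0 \<le> s" "s < 1" using s1 by (simp_all add: s_def)
        have p: "norm x powr (t - N0 \<mu>) = s powr (\<gamma> - 1)"
        proof -
          have "t - N0 \<mu> = 2 * (\<gamma> - 1)" by (simp add: \<gamma>_def G_def field_simps)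
          then show ?thesis using norm_powr_eq[of x "\<gamma> - 1"] by (simp only: s_def)
        qed
        \<comment> \<open>The cut-off \<open>(1 - s)^4\<close> falls short of 1 by at most
          \<open>4 s\<close>, and \<open>s\<close> times the singular power is the milder power
          already controlled by \<open>J\<close>.\<close>
        have b: "1 \<le> (1 - s) ^ 4 + 4 * s"
          using Bernoulli_inequality[of "- s" 4] s by simp
        have "s powr (\<gamma> - 1) * 1 \<le> s powr (\<gamma> - 1) * ((1 - s) ^ 4 + 4 * s)"
          by (rule mult_left_mono[OF b]) simp
        also have "\<dots> = q x + 4 * s powr \<gamma>"
          using powr_mult_base[of s "\<gamma> - 1"] s s1 by (simp add: q_def s_def[symmetric] max_def algebra_simps)
        finally have "\<mu> x * s powr (\<gamma> - 1) \<le> \<mu> x * q x + 4 * (\<mu> x * s powr \<gamma>)"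
          using mult_left_mono[OF _ mu(2)[of x], of "s powr (\<gamma> - 1)" "q x + 4 * s powr \<gamma>"] by (simp add: algebra_simps)
        moreover have "0 \<le> \<mu> x * q x" using mu(2)[of x] by (simp add: q_def)
        ultimately show ?thesis
          using True mu(2)[of x] by (simp add: p ennreal_mult[symmetric] ennreal_plus[symmetric] s_def[symmetric] del: ennreal_plus)
      qed simp
    qed
    also have "\<dots> = (\<integral>\<^sup>+ x. ennreal (\<mu> x * q x) \<partial>lebesgue) + (\<integral>\<^sup>+ x. ennreal (4 * (\<mu> x * (indicator (ball 0 1) x * (x \<bullet> x) powr \<gamma>))) \<partial>lebesgue)"
      by (rule nn_integral_add) measurable
    also have "(\<integral>\<^sup>+ x. ennreal (4 * (\<mu> x * (indicator (ball 0 1) x * (x \<bullet> x) powr \<gamma>))) \<partial>lebesgue) = ennreal (4 * Y)"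
      unfolding Y_def using nn_integral_eq_integral[OF integrable_mult_right[OF iY, of 4]] mu(2) by simp
    also have "(\<integral>\<^sup>+ x. ennreal (\<mu> x * q x) \<partial>lebesgue) + ennreal (4 * Y) \<le> ennreal Z + ennreal (4 * J)"
      using qZ YJ by (intro add_mono ennreal_leI) auto
    also have "\<dots> = ennreal (Z + 4 * J)" using Z0 J0 by simp
    finally have "ennreal t * (\<integral>\<^sup>+ x\<in>ball 0 1. ennreal (norm x powr (t - N0 \<mu>)) \<partial>weighted_measure \<mu>) \<le> ennreal t * ennreal (Z + 4 * J)"
      by (rule mult_left_mono) simp
    also have "\<dots> = ennreal (t * (Z + 4 * J))" using t Z0 J0 by (simp add: ennreal_mult)
    also have "\<dots> \<le> ennreal (2 * B * J / G + 8 * G * J)"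
    proof (rule ennreal_leI)
      have "t * (4 * J) \<le> (2 * G) * (4 * J)" using t J0 by (intro mult_right_mono) (auto simp: G_def)
      moreover have "t * Z = 2 * B * J / G" using t by (simp add: Z_def)
      ultimately show "t * (Z + 4 * J) \<le> 2 * B * J / G + 8 * G * J" by (simp add: distrib_left)
    qed
    finally show "ennreal t * (\<integral>\<^sup>+ x\<in>ball 0 1. ennreal (norm x powr (t - N0 \<mu>)) \<partial>weighted_measure \<mu>) \<le> ennreal (2 * B * J / G + 8 * G * J)" .
  qed
qed

theorem theorem1p3:
  fixes \<mu> :: "real ^ 'n \<Rightarrow> real" and c :: real
  assumes dim: "CARD('n) \<ge> 3"
    and nonneg: "\<And>x. \<mu> x \<ge> 0"
    and sqrt_H1: "(\<lambda>x. sqrt (\<mu> x)) \<in> H1_loc"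
    and laplacian: "\<exists>l. has_weak_laplacian \<mu> l"
    and c0_finite: "\<bar>c0_weighted \<mu>\<bar> \<noteq> \<infinity>"
    and U_bounded: "\<And>R. R > 0 \<Longrightarrow>
      \<exists>K. AE x in weighted_measure \<mu>. x \<notin> ball 0 R \<longrightarrow> U_reduced \<mu> x \<le> K"
    and loc_int: "locally_integrable lebesgue \<mu>"
    and N0_exists: "N0_set \<mu> \<noteq> {}" "bdd_above (N0_set \<mu>)"
    and N0_limsup: "Limsup (at_right 0) (\<lambda>t::real. ennreal t *
      (\<integral>\<^sup>+ x\<in>ball 0 1. ennreal (norm x powr (t - N0 \<mu>)) \<partial>weighted_measure \<mu>)) = \<infinity>"
    and N0_gt: "N0 \<mu> > 2"
    and c0_eq: "c0_weighted \<mu> = ereal (c0 (N0 \<mu>))"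
  shows "(\<exists>C. \<forall>\<phi>\<in>H1_weighted \<mu>. weighted_Hardy_inequality \<mu> c C \<phi>) \<longleftrightarrow> c < c0 (N0 \<mu>)"
proof
  assume "\<exists>C. \<forall>\<phi>\<in>H1_weighted \<mu>. weighted_Hardy_inequality \<mu> c C \<phi>"
  then obtain C where C: "\<And>\<phi>. \<phi> \<in> H1_weighted \<mu> \<Longrightarrow> weighted_Hardy_inequality \<mu> c C \<phi>" by blast
  show "c < c0 (N0 \<mu>)"
  proof (rule ccontr)
    assume "\<not> c < c0 (N0 \<mu>)"
    then have c: "c0 (N0 \<mu>) \<le> c" by simp
    obtain D where D: "\<And>t. 0 < t \<Longrightarrow> t < N0 \<mu> - 2 \<Longrightarrow>
        ennreal t * (\<integral>\<^sup>+ x\<in>ball 0 1. ennreal (norm x powr (t - N0 \<mu>)) \<partial>weighted_measure \<mu>) \<le> ennreal D"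
      using weighted_Hardy_moment_bound[OF loc_int nonneg C N0_exists(1) N0_gt c] by blast
    have "\<forall>\<^sub>F t in at_right 0. ennreal t * (\<integral>\<^sup>+ x\<in>ball 0 1. ennreal (norm x powr (t - N0 \<mu>)) \<partial>weighted_measure \<mu>) \<le> ennreal D"
      unfolding eventually_at_right_field using D N0_gt by (intro exI[of _ "N0 \<mu> - 2"]) auto
    from Limsup_bounded[OF this] show False unfolding N0_limsup by (simp add: top_unique)
  qed
next
  assume c: "c < c0 (N0 \<mu>)"
  have pos: "0 < c0 (N0 \<mu>)" using N0_gt by (simp add: c0_def)
  \<comment> \<open>The midpoint between \<open>max c 0\<close> and the critical constant is
    positive and strictly subcritical even when \<open>c \<le> 0\<close>.\<close>
  define c' where "c' = (max c 0 + c0 (N0 \<mu>)) / 2"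
  have c': "c' > 0" "c' < c0 (N0 \<mu>)" "c \<le> c'" using c pos by (auto simp: c'_def max_def)
  show "\<exists>C. \<forall>\<phi>\<in>H1_weighted \<mu>. weighted_Hardy_inequality \<mu> c C \<phi>"
    by (rule weighted_Hardy_sufficient[OF _ nonneg sqrt_H1 laplacian U_bounded loc_int N0_exists(1) N0_gt c'(1) _ c'(3)])
      (use dim c'(2) c0_eq in auto)
qed

end
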